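(* Let $(X,d)$ be a compact, path-connected, locally path-connected metric space with homotopy rectifiable paths, let $S$ be a finite set of homeomorphisms of $X$ such that $(X,\delta_S)$ is jumping-geodesic, let $x_0\in X$, and fix an integer $\theta\ge 1$. Let $\mathrm{Ell}_\theta=\{w\in F_S : |w|\le 4\theta,\ \mathrm{Fix}(w)\ne\emptyset\}$. Then there exists $t_0$ such that for every $t\ge t_0$ and every $w\in F_S$ the following are equivalent: (i) there exists $[\gamma]\in\pi_1(X,x_0)$ with $([\gamma],w)\in\ker\bigl(\widehat\Phi_S\colon \pi_1(X,x_0)\rtimes_{\phi_S}F_S\to\pi_{1,\theta}((X,\delta_S^t),x_0)\bigr)$; (ii) $w$ belongs to the normal closure $\langle\langle \mathrm{Ell}_\theta\rangle\rangle$ of $\mathrm{Ell}_\theta$ in $F_S$. Moreover, if $X$ is semi-locally simply connected, then $t_0$ can be chosen so that for every $t\ge t_0$ $$\pi_{1,\theta}\bigl((X,\delta_S^t),x_0\bigr)\cong\bigl(\pi_1(X,x_0)\rtimes_{\phi_S}F_S\bigr)/\langle\langle K_\theta\rangle\rangle,$$ where $$K_\theta=\bigl\{([\beta\, w(\beta^* )\,\alpha_w^*],w) : w\in \mathrm{Ell}_\theta,\ \beta\colon[0,1]\to X \text{ a continuous path with } \beta(0)=x_0,\ \beta(1)\in\mathrm{Fix}(w)\bigr\}.$$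
   Context: Discrete fundamental group. Let $(Z,\rho)$ be a metric space and $\theta>0$. A $\theta$-path is a finite sequence $(z_0,\dots,z_n)$ with $\rho(z_i,z_{i+1})\le\theta$, viewed as a $\theta$-Lipschitz map $[n]=\{0,\dots,n\}\to Z$. A lazification of it is its precomposition with a surjective monotone map $[m]\to[n]$. Two $\theta$-paths $Z_1,Z_2$ of the same length $n$ are $\theta$-grid homotopic if there is a $\theta$-Lipschitz map $H\colon[n]\times[m]\to Z$ (with the $\ell^1$ metric on $[n]\times[m]$) with $H(\cdot,0)=Z_1$, $H(\cdot,m)=Z_2$ and $H(0,\cdot)$, $H(n,\cdot)$ constant. $\theta$-homotopy is the equivalence relation generated by lazifications and $\theta$-grid homotopies. $\pi_{1,\theta}(Z,z_0)$ is the group of $\theta$-homotopy classes of closed $\theta$-paths based at $z_0$, with concatenation. Warped metrics. $F_S$ is the free group on $S$; it acts on $X$; $|w|$ is the length of the reduced word of $w$; $\mathrm{Fix}(w)$ is the fixed point set of $w$ in $X$. The warped metric $\delta_S$ is the largest metric on $X$ with $\delta_S\le d$ and $\delta_S(x,s(x))\le 1$ for all $x\in X$, $s\in S$. For $t\ge1$, $\delta_S^t$ is the warped metric obtained in the same way from $d^t=t\cdot d$ in place of $d$. Jumping-paths. A jumping-path is a finite sequence of continuous paths $\gamma_0,\dots,\gamma_n\colon[0,1]\to X$ and elements $\vec s_1,\dots,\vec s_n\in S\cup S^{-1}$ with $\gamma_i(0)=\vec s_i\cdot\gamma_{i-1}(1)$; its length is $n+\sum_i\|\gamma_i\|$, with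 $\|\gamma_i\|$ the length of $\gamma_i$ in $(X,d)$. $(X,\delta_S)$ is jumping-geodesic if $(X,d)$ is a geodesic metric space and any two points $x,y$ are joined by a jumping-path of length exactly $\delta_S(x,y)$. $(X,d)$ has homotopy rectifiable paths if every continuous path is homotopic (rel endpoints) to a path of finite length. The maps $\phi_S$ and $\widehat\Phi_S$. For a path $\gamma$, $\gamma^*$ is the reversed path; juxtaposition is concatenation. For every $s\in S$ fix a continuous path $\alpha_s$ from $x_0$ to $s\cdot x_0$, put $\alpha_{s^{-1}}=s^{-1}(\alpha_s^* )$, and for a word $w=\vec s_1\cdots\vec s_n$ in $S\cup S^{-1}$ put $\alpha_w=\alpha_{\vec s_1}\,\vec s_1(\alpha_{\vec s_2})\cdots(\vec s_1\cdots\vec s_{n-1})(\alpha_{\vec s_n})$, a path from $x_0$ to $w\cdot x_0$ (its homotopy class only depends on $w\in F_S$). The homomorphism $\phi_S\colon F_S\to\mathrm{Aut}(\pi_1(X,x_0))$ is $\phi_S(w)[\gamma]=[\alpha_w\,w(\gamma)\,\alpha_w^*]$. A $\theta$-discretisation of a continuous path $\eta$ (at scale $t$) is a sequence $(\eta(t_0),\dots,\eta(t_m))$ with $0=t_0<\dots<t_m=1$ and $\eta([t_{i-1},t_i])$ contained in the closed $d^t$-ball of radius $\theta$ centred at $\eta(t_{i-1})$. $\widehat\Phi_S$ is the surjective homomorphism sending $([\gamma],w)$, $w=\vec s_1\cdots\vec s_n$, to the class of the closed $\theta$-path in $(X,\delta_S^t)$ given by a $\theta$-discretisation of $\gamma\alpha_w$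 (ending at $w x_0$) followed by the points $\vec s_1^{\,-1}wx_0,\ \vec s_2^{\,-1}\vec s_1^{\,-1}wx_0,\ \dots,\ \vec s_n^{\,-1}\cdots\vec s_1^{\,-1}wx_0=x_0$. *)

theory Defs
  imports "HOL-Analysis.Analysis" "HOL-Algebra.Coset"
begin

section \<open>Free groups, semidirect products, normal closures\<close>

text \<open>A letter \<open>(s, True)\<close> stands for \<open>s\<close> and \<open>(s, False)\<close> for the formal inverse of \<open>s\<close>.\<close>

type_synonym 'b letter = "'b \<times> bool"

definition letter_inv :: "'b letter \<Rightarrow> 'b letter" where
  "letter_inv l = (fst l, \<not> snd l)"

definition reduced_word :: "'b letter list \<Rightarrow> bool" where
  "reduced_word = successively (\<lambda>a b. b \<noteq> letter_inv a)"

fun cons_cancel :: "'b letter \<Rightarrow> 'b letter list \<Rightarrow> 'b letter list" where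
  "cons_cancel l [] = [l]"
| "cons_cancel l (m # ms) = (if m = letter_inv l then ms else l # m # ms)"

definition reduce_word :: "'b letter list \<Rightarrow> 'b letter list" where
  "reduce_word w = foldr cons_cancel w []"

text \<open>Elements of the free group are reduced words, so the word length is \<^const>\<open>length\<close>.\<close>

definition free_group :: "'b set \<Rightarrow> 'b letter list monoid" where
  "free_group S = \<lparr>carrier = {w. reduced_word w \<and> set w \<subseteq> S \<times> UNIV},
                   mult = (\<lambda>u v. reduce_word (u @ v)), one = []\<rparr>"

definition semidirect_product ::
  "('a, 'm) monoid_scheme \<Rightarrow> ('b, 'n) monoid_scheme \<Rightarrow> ('b \<Rightarrow> 'a \<Rightarrow> 'a) \<Rightarrow> ('a \<times> 'b) monoid" where
  "semidirect_product N H \<phi> =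
     \<lparr>carrier = carrier N \<times> carrier H,
      mult = (\<lambda>(n, h) (n', h'). (n \<otimes>\<^bsub>N\<^esub> \<phi> h n', h \<otimes>\<^bsub>H\<^esub> h')),
      one = (\<one>\<^bsub>N\<^esub>, \<one>\<^bsub>H\<^esub>)\<rparr>"

definition normal_closure :: "('a, 'm) monoid_scheme \<Rightarrow> 'a set \<Rightarrow> 'a set" where
  "normal_closure G A = \<Inter> {N. N \<lhd> G \<and> A \<subseteq> N}"

section \<open>Paths, lengths, fundamental group\<close>

definition path_class :: "'a::topological_space set \<Rightarrow> (real \<Rightarrow> 'a) \<Rightarrow> (real \<Rightarrow> 'a) set" where
  "path_class X p = {q. homotopic_paths X p q}"

text \<open>The unions in this and the following quotient constructions range over equal classes.\<close>

definition fundamental_group ::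
  "'a::topological_space set \<Rightarrow> 'a \<Rightarrow> (real \<Rightarrow> 'a) set monoid" where
  "fundamental_group X x0 =
     \<lparr>carrier = {path_class X p | p. path p \<and> path_image p \<subseteq> X \<and> pathstart p = x0 \<and> pathfinish p = x0},
      mult = (\<lambda>A B. \<Union>p\<in>A. \<Union>q\<in>B. path_class X (p +++ q)),
      one = path_class X (\<lambda>_. x0)\<rparr>"

definition semi_locally_simply_connected :: "'a::topological_space set \<Rightarrow> bool" where
  "semi_locally_simply_connected X \<longleftrightarrow>
     (\<forall>x\<in>X. \<exists>U. openin (top_of_set X) U \<and> x \<in> U \<and>
        (\<forall>p. path p \<and> path_image p \<subseteq> U \<and> pathstart p = x \<and> pathfinish p = x
             \<longrightarrow> homotopic_paths X p (\<lambda>_. x)))"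

definition path_length :: "(real \<Rightarrow> 'a::metric_space) \<Rightarrow> ennreal" where
  "path_length g =
     (SUP (n, \<tau>) \<in> {(n::nat, \<tau>::nat \<Rightarrow> real). mono_on {..n} \<tau> \<and> \<tau> 0 = 0 \<and> \<tau> n = 1}.
        \<Sum>i<n. ennreal (dist (g (\<tau> i)) (g (\<tau> (Suc i)))))"

definition homotopy_rectifiable_paths :: "'a::metric_space set \<Rightarrow> bool" where
  "homotopy_rectifiable_paths X \<longleftrightarrow>
     (\<forall>p. path p \<and> path_image p \<subseteq> X \<longrightarrow> (\<exists>q. homotopic_paths X p q \<and> path_length q < \<infinity>))"

definition geodesic_space :: "'a::metric_space set \<Rightarrow> bool" where
  "geodesic_space X \<longleftrightarrow>
     (\<forall>x\<in>X. \<forall>y\<in>X. \<exists>g::real \<Rightarrow> 'a. g ` {0..1} \<subseteq> X \<and> g 0 = x \<and> g 1 = y \<and>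
        (\<forall>u\<in>{0..1}. \<forall>v\<in>{0..1}. dist (g u) (g v) = \<bar>u - v\<bar> * dist x y))"

section \<open>Warped metrics and jumping-paths\<close>

definition warp_admissible ::
  "('a \<Rightarrow> 'a \<Rightarrow> real) \<Rightarrow> ('a \<Rightarrow> 'a) set \<Rightarrow> ('a \<Rightarrow> 'a \<Rightarrow> real) \<Rightarrow> bool" where
  "warp_admissible d S \<rho> \<longleftrightarrow>
     Metric_space UNIV \<rho> \<and> (\<forall>x y. \<rho> x y \<le> d x y) \<and> (\<forall>x. \<forall>s\<in>S. \<rho> x (s x) \<le> 1)"

definition warped_metric ::
  "('a \<Rightarrow> 'a \<Rightarrow> real) \<Rightarrow> ('a \<Rightarrow> 'a) set \<Rightarrow> 'a \<Rightarrow> 'a \<Rightarrow> real" where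
  "warped_metric d S = (GREATEST \<rho>. warp_admissible d S \<rho>)"

text \<open>The greatest admissible metric exists.\<close>

lemma
  assumes "Metric_space UNIV d"
  shows warp_admissible_warped_metric: "warp_admissible d S (warped_metric d S)"
    and warped_metric_greatest: "warp_admissible d S \<rho> \<Longrightarrow> \<rho> \<le> warped_metric d S"
proof -
  interpret d: Metric_space UNIV d by fact
  define D where "D = (\<lambda>x y. SUP \<rho>\<in>Collect (warp_admissible d S). \<rho> x y)"
  have m: "warp_admissible d S (\<lambda>x y. min 1 (d x y))"
    unfolding warp_admissible_def Metric_space_def
  proof (intro conjI allI ballI impI)
    fix x y z
    show "min 1 (d x z) \<le> min 1 (d x y) + min 1 (d y z)"
      using d.triangle[OF UNIV_I UNIV_I UNIV_I, of x z y] d.nonneg[of x y] d.nonneg[of y z] by linarith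
  qed (auto simp: d.commute min_def)
  have bdd: "bdd_above ((\<lambda>\<rho>. \<rho> x y) ` Collect (warp_admissible d S))" for x y
    by (rule bdd_aboveI[of _ "d x y"]) (auto simp: warp_admissible_def)
  have up: "\<rho> x y \<le> D x y" if "warp_admissible d S \<rho>" for \<rho> x y
    unfolding D_def by (rule cSUP_upper[OF _ bdd]) (use that in auto)
  have least: "D x y \<le> c" if "\<And>\<rho>. warp_admissible d S \<rho> \<Longrightarrow> \<rho> x y \<le> c" for x y c
    unfolding D_def by (rule cSUP_least) (use m that in auto)
  have Dd: "D x y \<le> d x y" for x y
    by (rule least) (auto simp: warp_admissible_def)
  have D: "warp_admissible d S D"
    unfolding warp_admissible_def Metric_space_def
  proof (intro conjI allI ballI impI)
    fix x y z
    show nn: "0 \<le> D x y"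
      using up[OF m, of x y] d.nonneg[of x y] by linarith
    show "D x y = D y x"
      by (rule antisym; rule least; metis up warp_admissible_def Metric_space.commute)
    show "(D x y = 0) = (x = y)"
      using up[OF m, of x y] Dd[of x y] nn d.zero[of x y] d.nonneg[of x y]
      by (auto simp: min_def split: if_splits)
    show "D x z \<le> D x y + D y z"
    proof (rule least)
      fix \<rho> assume r: "warp_admissible d S \<rho>"
      have "\<rho> x z \<le> \<rho> x y + \<rho> y z"
        using r by (auto simp: warp_admissible_def Metric_space_def)
      then show "\<rho> x z \<le> D x y + D y z"
        using up[OF r, of x y] up[OF r, of y z] by linarith
    qed
  next
    fix x s assume "s \<in> S"
    then show "D x (s x) \<le> 1" by (intro least) (auto simp: warp_admissible_def)
  qed (use Dd in auto)
  have eq: "warped_metric d S = D"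
    unfolding warped_metric_def
    by (rule Greatest_equality) (use D up in \<open>auto simp: le_fun_def\<close>)
  show "warp_admissible d S (warped_metric d S)" using D eq by simp
  show "\<rho> \<le> warped_metric d S" if "warp_admissible d S \<rho>"
    using up[OF that] eq by (auto simp: le_fun_def)
qed

definition letter_act :: "('a \<Rightarrow> 'a) letter \<Rightarrow> 'a \<Rightarrow> 'a" where
  "letter_act l = (if snd l then fst l else inv_into UNIV (fst l))"

definition word_act :: "('a \<Rightarrow> 'a) letter list \<Rightarrow> 'a \<Rightarrow> 'a" where
  "word_act w = foldr letter_act w"

definition Fix_word :: "('a \<Rightarrow> 'a) letter list \<Rightarrow> 'a set" where
  "Fix_word w = {x. word_act w x = x}"

text \<open>The letter \<open>ls ! i\<close> is the jump between the paths \<open>gs ! i\<close> and \<open>gs ! Suc i\<close>.\<close>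

definition jumping_path ::
  "('a::metric_space \<Rightarrow> 'a) set \<Rightarrow> (real \<Rightarrow> 'a) list \<Rightarrow> ('a \<Rightarrow> 'a) letter list \<Rightarrow> bool" where
  "jumping_path S gs ls \<longleftrightarrow>
     length gs = Suc (length ls) \<and> (\<forall>g\<in>set gs. path g) \<and> set ls \<subseteq> S \<times> UNIV \<and>
     (\<forall>i<length ls. pathstart (gs ! Suc i) = letter_act (ls ! i) (pathfinish (gs ! i)))"

definition jumping_length ::
  "(real \<Rightarrow> 'a::metric_space) list \<Rightarrow> ('a \<Rightarrow> 'a) letter list \<Rightarrow> ennreal" where
  "jumping_length gs ls = of_nat (length ls) + (\<Sum>g\<leftarrow>gs. path_length g)"

definition jumping_geodesic :: "('a::metric_space \<Rightarrow> 'a) set \<Rightarrow> bool" where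
  "jumping_geodesic S \<longleftrightarrow>
     geodesic_space (UNIV :: 'a set) \<and>
     (\<forall>x y. \<exists>gs ls. jumping_path S gs ls \<and> pathstart (hd gs) = x \<and> pathfinish (last gs) = y \<and>
        jumping_length gs ls = ennreal (warped_metric dist S x y))"

section \<open>Discrete fundamental group\<close>

text \<open>A path indexed by \<open>{0..n}\<close> is a list of length \<open>Suc n\<close>.\<close>

definition theta_path :: "('a \<Rightarrow> 'a \<Rightarrow> real) \<Rightarrow> real \<Rightarrow> 'a list \<Rightarrow> bool" where
  "theta_path \<rho> \<theta> zs \<longleftrightarrow> zs \<noteq> [] \<and> (\<forall>i. Suc i < length zs \<longrightarrow> \<rho> (zs ! i) (zs ! Suc i) \<le> \<theta>)"

definition lazification :: "'a list \<Rightarrow> 'a list \<Rightarrow> bool" where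
  "lazification zs zs' \<longleftrightarrow>
     (\<exists>f. mono_on {..<length zs'} f \<and> f ` {..<length zs'} = {..<length zs} \<and>
          (\<forall>i<length zs'. zs' ! i = zs ! f i))"

definition grid_homotopic :: "('a \<Rightarrow> 'a \<Rightarrow> real) \<Rightarrow> real \<Rightarrow> 'a list \<Rightarrow> 'a list \<Rightarrow> bool" where
  "grid_homotopic \<rho> \<theta> zs zs' \<longleftrightarrow>
     (\<exists>n m H. length zs = Suc n \<and> length zs' = Suc n \<and>
        (\<forall>i\<le>n. \<forall>i'\<le>n. \<forall>j\<le>m. \<forall>j'\<le>m.
           \<rho> (H i j) (H i' j') \<le> \<theta> * (\<bar>real i - real i'\<bar> + \<bar>real j - real j'\<bar>)) \<and>
        (\<forall>i\<le>n. H i 0 = zs ! i) \<and> (\<forall>i\<le>n. H i m = zs' ! i) \<and>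
        (\<forall>j\<le>m. H 0 j = H 0 0) \<and> (\<forall>j\<le>m. H n j = H n 0))"

definition theta_homotopic :: "('a \<Rightarrow> 'a \<Rightarrow> real) \<Rightarrow> real \<Rightarrow> 'a list \<Rightarrow> 'a list \<Rightarrow> bool" where
  "theta_homotopic \<rho> \<theta> =
     equivclp (\<lambda>zs zs'. theta_path \<rho> \<theta> zs \<and> theta_path \<rho> \<theta> zs' \<and>
                        (lazification zs zs' \<or> grid_homotopic \<rho> \<theta> zs zs'))"

definition theta_class :: "('a \<Rightarrow> 'a \<Rightarrow> real) \<Rightarrow> real \<Rightarrow> 'a list \<Rightarrow> 'a list set" where
  "theta_class \<rho> \<theta> zs = {zs'. theta_homotopic \<rho> \<theta> zs zs'}"

definition discrete_fundamental_group ::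
  "('a \<Rightarrow> 'a \<Rightarrow> real) \<Rightarrow> real \<Rightarrow> 'a \<Rightarrow> 'a list set monoid" where
  "discrete_fundamental_group \<rho> \<theta> z0 =
     \<lparr>carrier = {theta_class \<rho> \<theta> zs | zs. theta_path \<rho> \<theta> zs \<and> hd zs = z0 \<and> last zs = z0},
      mult = (\<lambda>A B. \<Union>zs\<in>A. \<Union>ws\<in>B. theta_class \<rho> \<theta> (zs @ tl ws)),
      one = theta_class \<rho> \<theta> [z0]\<rparr>"

section \<open>The maps $\phi_S$ and $\widehat\Phi_S$\<close>

definition alpha_letter ::
  "(('a::topological_space \<Rightarrow> 'a) \<Rightarrow> real \<Rightarrow> 'a) \<Rightarrow> ('a \<Rightarrow> 'a) letter \<Rightarrow> real \<Rightarrow> 'a" where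
  "alpha_letter \<alpha> l =
     (if snd l then \<alpha> (fst l) else inv_into UNIV (fst l) \<circ> reversepath (\<alpha> (fst l)))"

text \<open>Concatenation is bracketed to the right and ends with a constant path, which is the
  value for the empty word.\<close>

fun alpha_word ::
  "(('a::topological_space \<Rightarrow> 'a) \<Rightarrow> real \<Rightarrow> 'a) \<Rightarrow> 'a \<Rightarrow> ('a \<Rightarrow> 'a) letter list \<Rightarrow> real \<Rightarrow> 'a" where
  "alpha_word \<alpha> x0 [] = (\<lambda>_. x0)"
| "alpha_word \<alpha> x0 (l # ls) = alpha_letter \<alpha> l +++ (letter_act l \<circ> alpha_word \<alpha> x0 ls)"

definition phi_S ::
  "(('a::topological_space \<Rightarrow> 'a) \<Rightarrow> real \<Rightarrow> 'a) \<Rightarrow> 'a \<Rightarrow> ('a \<Rightarrow> 'a) letter list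
     \<Rightarrow> (real \<Rightarrow> 'a) set \<Rightarrow> (real \<Rightarrow> 'a) set" where
  "phi_S \<alpha> x0 w A =
     (\<Union>\<gamma>\<in>A. path_class UNIV
        (alpha_word \<alpha> x0 w +++ (word_act w \<circ> \<gamma>) +++ reversepath (alpha_word \<alpha> x0 w)))"

definition pi1_semidirect ::
  "('a::topological_space \<Rightarrow> 'a) set \<Rightarrow> (('a \<Rightarrow> 'a) \<Rightarrow> real \<Rightarrow> 'a) \<Rightarrow> 'a
     \<Rightarrow> ((real \<Rightarrow> 'a) set \<times> ('a \<Rightarrow> 'a) letter list) monoid" where
  "pi1_semidirect S \<alpha> x0 =
     semidirect_product (fundamental_group UNIV x0) (free_group S) (phi_S \<alpha> x0)"

definition discretisation ::
  "real \<Rightarrow> real \<Rightarrow> (real \<Rightarrow> 'a::metric_space) \<Rightarrow> 'a list \<Rightarrow> bool" where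
  "discretisation t \<theta> \<eta> zs \<longleftrightarrow>
     (\<exists>\<tau>. \<tau> \<noteq> [] \<and> sorted_wrt (<) \<tau> \<and> hd \<tau> = 0 \<and> last \<tau> = 1 \<and> zs = map \<eta> \<tau> \<and>
        (\<forall>i. Suc i < length \<tau> \<longrightarrow>
           (\<forall>u\<in>{\<tau> ! i..\<tau> ! Suc i}. t * dist (\<eta> (\<tau> ! i)) (\<eta> u) \<le> \<theta>)))"

fun jump_back :: "('a \<Rightarrow> 'a) letter list \<Rightarrow> 'a \<Rightarrow> 'a list" where
  "jump_back [] y = []"
| "jump_back (l # ls) y =
     letter_act (letter_inv l) y # jump_back ls (letter_act (letter_inv l) y)"

definition warped_pi1 ::
  "real \<Rightarrow> ('a::metric_space \<Rightarrow> 'a) set \<Rightarrow> real \<Rightarrow> 'a \<Rightarrow> 'a list set monoid" where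
  "warped_pi1 t S \<theta> x0 =
     discrete_fundamental_group (warped_metric (\<lambda>x y. t * dist x y) S) \<theta> x0"

definition Phi_S ::
  "real \<Rightarrow> ('a::metric_space \<Rightarrow> 'a) set \<Rightarrow> real \<Rightarrow> (('a \<Rightarrow> 'a) \<Rightarrow> real \<Rightarrow> 'a) \<Rightarrow> 'a
     \<Rightarrow> (real \<Rightarrow> 'a) set \<times> ('a \<Rightarrow> 'a) letter list \<Rightarrow> 'a list set" where
  "Phi_S t S \<theta> \<alpha> x0 = (\<lambda>(A, w).
     \<Union>\<gamma>\<in>A. \<Union>zs\<in>{zs. discretisation t \<theta> (\<gamma> +++ alpha_word \<alpha> x0 w) zs}.
       theta_class (warped_metric (\<lambda>x y. t * dist x y) S) \<theta> (zs @ jump_back w (word_act w x0)))"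

section \<open>Elliptic elements\<close>

definition Ell :: "('a \<Rightarrow> 'a) set \<Rightarrow> nat \<Rightarrow> ('a \<Rightarrow> 'a) letter list set" where
  "Ell S \<theta> = {w \<in> carrier (free_group S). length w \<le> 4 * \<theta> \<and> Fix_word w \<noteq> {}}"

definition K_set ::
  "('a::topological_space \<Rightarrow> 'a) set \<Rightarrow> nat \<Rightarrow> (('a \<Rightarrow> 'a) \<Rightarrow> real \<Rightarrow> 'a) \<Rightarrow> 'a
     \<Rightarrow> ((real \<Rightarrow> 'a) set \<times> ('a \<Rightarrow> 'a) letter list) set" where
  "K_set S \<theta> \<alpha> x0 =
     {(path_class UNIV
         (\<beta> +++ (word_act w \<circ> reversepath \<beta>) +++ reversepath (alpha_word \<alpha> x0 w)), w) | \<beta> w.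
        w \<in> Ell S \<theta> \<and> path \<beta> \<and> pathstart \<beta> = x0 \<and> pathfinish \<beta> \<in> Fix_word w}"

end

theory Submission
  imports Defs
begin

text \<open>
  An element of the semidirect product is the same thing as a pair of a word \<open>w\<close> and the class of a
  path \<open>c\<close> from \<open>x0\<close> to \<open>w x0\<close>: follow \<open>c\<close>, then jump back along \<open>w\<close>. In these coordinates \<open>\<alpha>\<close>
  disappears, the product of \<open>(c, w)\<close> and \<open>(d, v)\<close> is \<open>(c \<cdot> w d, w v)\<close>, and \<open>K\<close> consists of the pairs
  \<open>(\<beta> \<cdot> w \<beta>\<^sup>*, w)\<close> with \<open>w\<close> elliptic. The comparison map is a surjective homomorphism, because a step
  of length at most \<open>\<theta>\<close> can be subdivided along a minimal jumping path, and it kills \<open>K\<close>, because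
  \<open>\<theta>\<close> is an integer: a closed run of at most \<open>4\<theta>\<close> jumps splits into four \<open>\<theta>\<close>-steps, hence is null.

  Conversely, send a \<open>\<theta>\<close>-step to the class, in a quotient of the semidirect product, of any short
  jumping path realising it. This is a homotopy invariant of \<open>\<theta>\<close>-paths as soon as the quotient kills
  the jumping loops with at most \<open>4\<theta>\<close> jumps and short continuous part. For large \<open>t\<close>, by compactness,
  the word of such a loop has a fixed point close to the loop; so the loop is killed modulo the
  normal closure of the elliptic words, and, if short loops of \<open>X\<close> are null, modulo that of \<open>K\<close>.
\<close>

section \<open>The fundamental groupoid\<close>

text \<open>Why the bound is 4\<theta>: an elementary homotopy fills a square whose four sides are
  \<theta>-steps. In one direction, a closed run of at most 4\<theta> jumps coarsens to the boundary
  of such a square and is filled. In the other, homotopy invariance only asks that boundaries of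
  such squares die in the quotient, and these carry at most 4\<theta> jumps.

  The obstacle is that homeomorphisms distort distances and lengths, so collecting the continuous
  parts of a jumping path into a single path has no bounded cost in length. But only words of
  bounded length occur, finitely many of them, and these are equicontinuous on a compact space.
  Smallness is therefore measured by distance from the starting point. The constants are fixed in
  this order: a radius within which a loop with at most 4\<theta> jumps has an elliptic word, a
  radius for single steps such that four of them compose to such a loop, and finally t0, which makes
  the continuous part of every \<theta>-step that small. None of them depends on the quotient, so
  one t0 serves both claims.\<close>

abbreviation hpaths :: "(real \<Rightarrow> 'a::topological_space) \<Rightarrow> (real \<Rightarrow> 'a) \<Rightarrow> bool" where
  "hpaths \<equiv> homotopic_paths UNIV"

lemma path_comp_linepath: "p \<circ> linepath 0 1 = (p :: real \<Rightarrow> 'a)"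
  by (auto simp: linepath_def)

text \<open>The target carries no linear structure, so homotopies between reparametrisations are
  made in the interval and pushed forward along \<open>p\<close>.\<close>

lemma hpaths_image_of_interval:
  assumes "path p" "homotopic_paths {0..1::real} f g"
  shows "hpaths (p \<circ> f) (p \<circ> g)"
  by (rule homotopic_paths_continuous_image[OF assms(2)]) (use assms(1) in \<open>auto simp: path_def\<close>)

lemma hpaths_rinv:
  assumes "path p" shows "hpaths (p +++ reversepath p) (\<lambda>_. pathstart p)"
proof -
  have "homotopic_paths {0..1::real} (linepath 0 1 +++ reversepath (linepath 0 1)) (linepath 0 0)"
    using homotopic_paths_rinv[of "linepath 0 (1::real)" "{0..1}"]
    by (simp add: closed_segment_eq_real_ivl)
  from hpaths_image_of_interval[OF assms this] show ?thesis
    by (simp add: path_compose_join path_compose_reversepath path_comp_linepath)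
       (simp add: comp_def linepath_def pathstart_def reversepath_def)
qed

lemma hpaths_rid:
  assumes "path p" shows "hpaths (p +++ (\<lambda>_. pathfinish p)) p"
proof -
  have "homotopic_paths {0..1::real} (linepath 0 1 +++ linepath 1 1) (linepath 0 1)"
    using homotopic_paths_rid[of "linepath 0 (1::real)" "{0..1}"]
    by (simp add: closed_segment_eq_real_ivl)
  from hpaths_image_of_interval[OF assms this] show ?thesis
    by (simp add: path_compose_join path_comp_linepath)
       (simp add: comp_def linepath_def pathfinish_def)
qed

lemma hpaths_lid:
  assumes "path p" shows "hpaths ((\<lambda>_. pathstart p) +++ p) p"
proof -
  have "homotopic_paths {0..1::real} (linepath 0 0 +++ linepath 0 1) (linepath 0 1)"
    using homotopic_paths_lid[of "linepath 0 (1::real)" "{0..1}"]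
    by (simp add: closed_segment_eq_real_ivl)
  from hpaths_image_of_interval[OF assms this] show ?thesis
    by (simp add: path_compose_join path_comp_linepath)
       (simp add: comp_def linepath_def pathstart_def)
qed

lemma hpaths_comp:
  assumes "hpaths p q" "continuous_on UNIV f" shows "hpaths (f \<circ> p) (f \<circ> q)"
  using homotopic_paths_continuous_image[OF assms] by auto

lemma path_comp: "path p \<Longrightarrow> continuous_on UNIV f \<Longrightarrow> path (f \<circ> p)"
  by (simp add: continuous_on_subset path_continuous_image)

abbreviation pc :: "(real \<Rightarrow> 'a::topological_space) \<Rightarrow> (real \<Rightarrow> 'a) set" where
  "pc \<equiv> path_class UNIV"

lemma pc_eq_iff: "path p \<Longrightarrow> pc p = pc q \<longleftrightarrow> hpaths p q"
  unfolding path_class_def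
  by (auto intro: homotopic_paths_trans homotopic_paths_sym)

lemma mem_pc: "q \<in> pc p \<longleftrightarrow> hpaths p q"
  by (simp add: path_class_def)

lemma mem_pc_self: "path p \<Longrightarrow> p \<in> pc p"
  by (simp add: path_class_def)

lemma hpathsD:
  assumes "hpaths p q"
  shows "path p" "path q" "pathstart q = pathstart p" "pathfinish q = pathfinish p"
  using assms homotopic_paths_imp_path homotopic_paths_imp_pathstart homotopic_paths_imp_pathfinish
  by metis+

text \<open>Arrows of the fundamental groupoid. Passing to classes turns the homotopies for
  associativity, units and inverses into equations for the simplifier; \<open>src\<close> and
  \<open>tgt\<close> may choose any representative because homotopies fix end points.\<close>

definition arr :: "(real \<Rightarrow> 'a::topological_space) set \<Rightarrow> bool" where
  "arr a \<longleftrightarrow> (\<exists>p. path p \<and> a = pc p)"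

definition src :: "(real \<Rightarrow> 'a::topological_space) set \<Rightarrow> 'a" where
  "src a = pathstart (SOME p. p \<in> a)"

definition tgt :: "(real \<Rightarrow> 'a::topological_space) set \<Rightarrow> 'a" where
  "tgt a = pathfinish (SOME p. p \<in> a)"

definition cmp :: "(real \<Rightarrow> 'a::topological_space) set \<Rightarrow> (real \<Rightarrow> 'a) set \<Rightarrow> (real \<Rightarrow> 'a) set"
    (infixr "\<star>" 70) where
  "a \<star> b = (\<Union>p\<in>a. \<Union>q\<in>b. pc (p +++ q))"

definition rv :: "(real \<Rightarrow> 'a::topological_space) set \<Rightarrow> (real \<Rightarrow> 'a) set" where
  "rv a = (\<Union>p\<in>a. pc (reversepath p))"

definition im :: "('a::topological_space \<Rightarrow> 'a) \<Rightarrow> (real \<Rightarrow> 'a) set \<Rightarrow> (real \<Rightarrow> 'a) set" where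
  "im f a = (\<Union>p\<in>a. pc (f \<circ> p))"

abbreviation cn :: "'a::topological_space \<Rightarrow> (real \<Rightarrow> 'a) set" where
  "cn x \<equiv> pc (\<lambda>_. x)"

lemma path_constant [simp]: "path (\<lambda>_. x)"
  by (simp add: path_def)

lemma pathstart_constant [simp]: "pathstart (\<lambda>_. x) = x"
  by (simp add: pathstart_def)

lemma pathfinish_constant [simp]: "pathfinish (\<lambda>_. x) = x"
  by (simp add: pathfinish_def)

lemma arr_pc [simp]: "path p \<Longrightarrow> arr (pc p)"
  by (auto simp: arr_def)

lemma arrE:
  assumes "arr a" obtains p where "path p" "a = pc p" "pathstart p = src a" "pathfinish p = tgt a"
proof -
  obtain p where p: "path p" "a = pc p" using assms by (auto simp: arr_def)
  have "(SOME p. p \<in> a) \<in> a" by (rule someI[of _ p]) (simp add: p mem_pc_self)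
  then have "pathstart (SOME p. p \<in> a) = pathstart p" "pathfinish (SOME p. p \<in> a) = pathfinish p"
    unfolding p(2) mem_pc using hpathsD by metis+
  then show ?thesis using that p by (simp add: src_def tgt_def)
qed

lemma arr_cases: "arr a \<Longrightarrow> (\<And>p. path p \<Longrightarrow> a = pc p \<Longrightarrow> P) \<Longrightarrow> P"
  by (auto simp: arr_def)

lemma src_pc [simp]: "path p \<Longrightarrow> src (pc p) = pathstart p"
  by (metis arrE arr_pc hpathsD(3) pc_eq_iff)

lemma tgt_pc [simp]: "path p \<Longrightarrow> tgt (pc p) = pathfinish p"
  by (metis arrE arr_pc hpathsD(4) pc_eq_iff)

lemma cmp_pc:
  assumes "path p" "path q" "pathfinish p = pathstart q"
  shows "pc p \<star> pc q = pc (p +++ q)"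
proof -
  have "pc (p' +++ q') = pc (p +++ q)" if "p' \<in> pc p" "q' \<in> pc q" for p' q'
    using that assms pc_eq_iff[of "p +++ q" "p' +++ q'"]
    by (auto simp: mem_pc homotopic_paths_join)
  then show ?thesis unfolding cmp_def using mem_pc_self assms by fastforce
qed

lemma rv_pc:
  assumes "path p" shows "rv (pc p) = pc (reversepath p)"
proof -
  have "pc (reversepath p') = pc (reversepath p)" if "p' \<in> pc p" for p'
    using that assms pc_eq_iff[of "reversepath p" "reversepath p'"]
    by (auto simp: mem_pc homotopic_paths_reversepath)
  then show ?thesis unfolding rv_def using mem_pc_self assms by fastforce
qed

lemma im_pc:
  assumes "path p" "continuous_on UNIV f" shows "im f (pc p) = pc (f \<circ> p)"
proof -
  have "pc (f \<circ> p') = pc (f \<circ> p)" if "p' \<in> pc p" for p'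
    using that assms pc_eq_iff[of "f \<circ> p" "f \<circ> p'"]
    by (auto simp: mem_pc hpaths_comp path_comp)
  then show ?thesis unfolding im_def using mem_pc_self assms by fastforce
qed

lemma
  assumes "arr a" "arr b" "tgt a = src b"
  shows arr_cmp [simp]: "arr (a \<star> b)"
    and src_cmp [simp]: "src (a \<star> b) = src a"
    and tgt_cmp [simp]: "tgt (a \<star> b) = tgt b"
  using assms by (auto elim!: arr_cases simp: cmp_pc)

lemma
  assumes "arr a"
  shows arr_rv [simp]: "arr (rv a)"
    and src_rv [simp]: "src (rv a) = tgt a"
    and tgt_rv [simp]: "tgt (rv a) = src a"
  using assms by (auto elim!: arr_cases simp: rv_pc)

lemma
  assumes "arr a" "continuous_on UNIV f"
  shows arr_im [simp]: "arr (im f a)"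
    and src_im [simp]: "src (im f a) = f (src a)"
    and tgt_im [simp]: "tgt (im f a) = f (tgt a)"
  using assms by (auto elim!: arr_cases simp: im_pc path_comp pathstart_compose pathfinish_compose)

lemma cmp_assoc [simp]:
  assumes "arr a" "arr b" "arr c" "tgt a = src b" "tgt b = src c"
  shows "(a \<star> b) \<star> c = a \<star> b \<star> c"
proof -
  obtain p q r where p: "path p" "a = pc p" and q: "path q" "b = pc q" and r: "path r" "c = pc r"
    using assms by (auto simp: arr_def)
  have "pathfinish p = pathstart q" "pathfinish q = pathstart r" using assms p q r by simp_all
  then show ?thesis using p q r
    by (simp add: cmp_pc pc_eq_iff homotopic_paths_assoc homotopic_paths_sym)
qed

lemma cmp_cn_right [simp]: "arr a \<Longrightarrow> x = tgt a \<Longrightarrow> a \<star> cn x = a"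
  by (erule arr_cases) (simp add: cmp_pc pc_eq_iff hpaths_rid)

lemma cmp_cn_left [simp]: "arr a \<Longrightarrow> x = src a \<Longrightarrow> cn x \<star> a = a"
  by (erule arr_cases) (simp add: cmp_pc pc_eq_iff hpaths_lid)

lemma cmp_rv_right [simp]: "arr a \<Longrightarrow> a \<star> rv a = cn (src a)"
  by (erule arr_cases) (simp add: cmp_pc rv_pc hpaths_rinv pc_eq_iff)

lemma rv_rv [simp]: "arr a \<Longrightarrow> rv (rv a) = a"
  by (erule arr_cases) (simp add: rv_pc)

lemma cmp_rv_left [simp]: "arr a \<Longrightarrow> rv a \<star> a = cn (tgt a)"
  using cmp_rv_right[of "rv a"] by simp

lemma cmp_rv_cancel_left [simp]:
  "arr a \<Longrightarrow> arr b \<Longrightarrow> tgt a = src b \<Longrightarrow> rv a \<star> a \<star> b = b"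
  by (subst cmp_assoc[symmetric]) simp_all

lemma rv_cmp [simp]:
  assumes "arr a" "arr b" "tgt a = src b" shows "rv (a \<star> b) = rv b \<star> rv a"
  using assms by (auto elim!: arr_cases simp: cmp_pc rv_pc reversepath_joinpaths)

lemma rv_cn [simp]: "rv (cn x) = cn x"
  by (simp add: rv_pc reversepath_def)

lemma im_cmp [simp]:
  assumes "arr a" "arr b" "tgt a = src b" "continuous_on UNIV f" shows "im f (a \<star> b) = im f a \<star> im f b"
  using assms
  by (auto elim!: arr_cases simp: cmp_pc im_pc path_comp path_compose_join pathstart_compose pathfinish_compose)

lemma im_rv [simp]:
  assumes "arr a" "continuous_on UNIV f" shows "im f (rv a) = rv (im f a)"
  using assms by (auto elim!: arr_cases simp: rv_pc im_pc path_comp path_compose_reversepath)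

lemma im_cn [simp]: "continuous_on UNIV f \<Longrightarrow> im f (cn x) = cn (f x)"
  by (simp add: im_pc comp_def)

lemma im_im [simp]:
  assumes "arr a" "continuous_on UNIV f" "continuous_on UNIV g" shows "im f (im g a) = im (f \<circ> g) a"
proof -
  obtain p where "path p" "a = pc p" using assms(1) by (auto simp: arr_def)
  moreover have "continuous_on UNIV (f \<circ> g)"
    by (intro continuous_on_compose assms(3) continuous_on_subset[OF assms(2)]) simp
  ultimately show ?thesis using assms by (simp add: im_pc path_comp comp_assoc)
qed

lemma im_ident [simp]: "arr a \<Longrightarrow> im (\<lambda>x. x) a = a" "arr a \<Longrightarrow> im id a = a"
  by (auto elim!: arr_cases simp: im_pc comp_def)

section \<open>Free groups\<close>

lemma letter_inv_inv [simp]: "letter_inv (letter_inv l) = l"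
  by (simp add: letter_inv_def)

lemma letter_inv_mem: "letter_inv l \<in> S \<times> UNIV \<longleftrightarrow> l \<in> S \<times> UNIV"
  by (cases l) (simp add: letter_inv_def)

lemma reduced_word_Nil [simp]: "reduced_word []"
  by (simp add: reduced_word_def)

lemma reduced_word_Cons:
  "reduced_word (l # w) \<longleftrightarrow> reduced_word w \<and> (w \<noteq> [] \<longrightarrow> hd w \<noteq> letter_inv l)"
  by (cases w) (auto simp: reduced_word_def)

lemma reduced_word_cons_cancel: "reduced_word w \<Longrightarrow> reduced_word (cons_cancel l w)"
  by (cases w) (auto simp: reduced_word_Cons)

lemma cons_cancel_inv:
  assumes "reduced_word w" shows "cons_cancel l (cons_cancel (letter_inv l) w) = w"
  using assms by (cases w rule: list.exhaust; cases "tl w") (auto simp: reduced_word_Cons)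

text \<open>Van der Waerden's trick: letters act on reduced words by \<open>cons_cancel\<close>, and
  \<open>reduce_word w\<close> is the image of the empty word under \<open>w\<close>. Associativity
  of the free group becomes composition of this action.\<close>

definition reduce_onto :: "'b letter list \<Rightarrow> 'b letter list \<Rightarrow> 'b letter list" where
  "reduce_onto u w = foldr cons_cancel u w"

lemma reduce_onto_simps [simp]:
  "reduce_onto [] w = w" "reduce_onto (l # u) w = cons_cancel l (reduce_onto u w)"
  "reduce_onto (u @ v) w = reduce_onto u (reduce_onto v w)"
  by (simp_all add: reduce_onto_def)

lemma reduce_word_onto: "reduce_word w = reduce_onto w []"
  by (simp add: reduce_word_def reduce_onto_def)

lemma reduced_reduce_onto: "reduced_word w \<Longrightarrow> reduced_word (reduce_onto u w)"
  by (induction u) (auto intro: reduced_word_cons_cancel)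

lemma reduced_reduce_word [simp]: "reduced_word (reduce_word w)"
  by (simp add: reduce_word_onto reduced_reduce_onto)

lemma reduce_word_id [simp]: "reduced_word w \<Longrightarrow> reduce_word w = w"
proof (induction w)
  case (Cons l w)
  then show ?case by (cases w) (auto simp: reduced_word_Cons reduce_word_onto)
qed (simp add: reduce_word_onto)

text \<open>A cancelled pair acts as \<open>l\<close> after its inverse, which is the identity on
  reduced words by \<open>cons_cancel_inv\<close>.\<close>

lemma reduce_onto_cons_cancel:
  assumes "reduced_word w"
  shows "reduce_onto (cons_cancel l u) w = cons_cancel l (reduce_onto u w)"
proof (cases u)
  case (Cons m ms)
  have "ms = cons_cancel l (cons_cancel (letter_inv l) ms)" if "reduced_word ms"
    using cons_cancel_inv[OF that] by simp
  then show ?thesis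
    using Cons cons_cancel_inv[OF reduced_reduce_onto[OF assms, of ms], of l] by simp
qed simp

lemma reduce_onto_reduce_word:
  "reduced_word w \<Longrightarrow> reduce_onto (reduce_word u) w = reduce_onto u w"
  by (induction u) (simp_all add: reduce_word_onto reduce_onto_cons_cancel)

lemma reduce_word_append: "reduce_word (u @ v) = reduce_onto u (reduce_word v)"
  by (simp add: reduce_word_onto)

lemma reduce_word_append_reduce:
  "reduce_word (reduce_word u @ v) = reduce_word (u @ v)"
  "reduce_word (u @ reduce_word v) = reduce_word (u @ v)"
  by (simp_all add: reduce_word_append reduce_onto_reduce_word)

lemma set_cons_cancel: "set (cons_cancel l w) \<subseteq> insert l (set w)"
  by (cases w) auto

lemma set_reduce_word: "set (reduce_word w) \<subseteq> set w"
proof (induction w)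
  case (Cons l w)
  then show ?case using set_cons_cancel[of l "reduce_word w"] by (auto simp: reduce_word_onto)
qed (simp add: reduce_word_onto)

lemma length_cons_cancel: "length (cons_cancel l w) \<le> Suc (length w)"
  by (cases w) auto

lemma length_reduce_word: "length (reduce_word w) \<le> length w"
proof (induction w)
  case (Cons l w)
  then show ?case using length_cons_cancel[of l "reduce_word w"] by (simp add: reduce_word_onto)
qed (simp add: reduce_word_onto)

definition word_inv :: "'b letter list \<Rightarrow> 'b letter list" where
  "word_inv w = map letter_inv (rev w)"

lemma word_inv_simps [simp]:
  "word_inv [] = []" "word_inv (l # w) = word_inv w @ [letter_inv l]"
  "length (word_inv w) = length w"
  by (simp_all add: word_inv_def)

lemma word_inv_inv [simp]: "word_inv (word_inv w) = w"
  by (simp add: word_inv_def rev_map comp_def)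

lemma set_word_inv: "set w \<subseteq> S \<times> UNIV \<Longrightarrow> set (word_inv w) \<subseteq> S \<times> UNIV"
  by (auto simp: word_inv_def letter_inv_def mem_Times_iff)

lemma reduce_onto_word_inv:
  "reduced_word v \<Longrightarrow> reduce_onto w (reduce_onto (word_inv w) v) = v"
proof (induction w arbitrary: v)
  case (Cons l w)
  show ?case
    using Cons.IH[OF reduced_word_cons_cancel[OF Cons.prems, of "letter_inv l"]]
      cons_cancel_inv[OF Cons.prems, of l] by simp
qed simp

lemma reduce_word_inv [simp]: "reduce_word (w @ word_inv w) = []" "reduce_word (word_inv w @ w) = []"
  using reduce_onto_word_inv[of "[]" w] reduce_onto_word_inv[of "[]" "word_inv w"]
  by (simp_all add: reduce_word_onto)

lemma free_group_sel [simp]: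
  "w \<in> carrier (free_group S) \<longleftrightarrow> reduced_word w \<and> set w \<subseteq> S \<times> UNIV"
  "mult (free_group S) u v = reduce_word (u @ v)"
  "one (free_group S) = []"
  by (simp_all add: free_group_def)

lemma group_free_group: "group (free_group S)"
proof (rule groupI)
  fix u v w assume "u \<in> carrier (free_group S)" "v \<in> carrier (free_group S)"
  then show "u \<otimes>\<^bsub>free_group S\<^esub> v \<in> carrier (free_group S)"
    using set_reduce_word[of "u @ v"] by auto
next
  fix w assume w: "w \<in> carrier (free_group S)"
  have "reduce_word (word_inv w) \<in> carrier (free_group S)"
    using w set_word_inv[of w S] set_reduce_word[of "word_inv w"] by auto
  moreover have "reduce_word (word_inv w) \<otimes>\<^bsub>free_group S\<^esub> w = \<one>\<^bsub>free_group S\<^esub>"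
    by (simp add: reduce_word_append_reduce)
  ultimately show "\<exists>y\<in>carrier (free_group S). y \<otimes>\<^bsub>free_group S\<^esub> w = \<one>\<^bsub>free_group S\<^esub>"
    by blast
qed (simp_all add: reduce_word_append_reduce)

section \<open>The action of words\<close>

lemma word_act_simps [simp]:
  "word_act [] = (\<lambda>x. x)" "word_act (l # w) = letter_act l \<circ> word_act w"
  by (auto simp: word_act_def)

lemma word_act_append [simp]: "word_act (u @ v) = word_act u \<circ> word_act v"
  by (induction u) (auto simp: comp_def)

locale warped_action =
  fixes S :: "('a::metric_space \<Rightarrow> 'a) set"
  assumes homeo: "s \<in> S \<Longrightarrow> \<exists>g. homeomorphism UNIV UNIV s g"
begin

abbreviation wd :: "('a \<Rightarrow> 'a) letter list \<Rightarrow> bool" where "wd w \<equiv> set w \<subseteq> S \<times> UNIV"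

lemma bij_letter_act: assumes "l \<in> S \<times> UNIV" shows "bij (letter_act l)"
proof -
  obtain g where g: "homeomorphism UNIV UNIV (fst l) g" using homeo[of "fst l"] assms by auto
  have "bij (fst l)"
    by (rule o_bij[of g]) (use g in \<open>auto simp: homeomorphism_def fun_eq_iff\<close>)
  then show ?thesis by (simp add: letter_act_def bij_imp_bij_inv)
qed

lemma continuous_letter_act:
  assumes "l \<in> S \<times> UNIV" shows "continuous_on UNIV (letter_act l)"
proof -
  obtain g where g: "homeomorphism UNIV UNIV (fst l) g" using homeo[of "fst l"] assms by auto
  then have "inv_into UNIV (fst l) = g"
    by (intro inv_unique_comp) (auto simp: homeomorphism_def fun_eq_iff)
  then show ?thesis using g by (simp add: letter_act_def homeomorphism_def)
qed

lemma letter_act_inv [simp]: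
  assumes "l \<in> S \<times> UNIV"
  shows "letter_act l (letter_act (letter_inv l) x) = x"
    and "letter_act (letter_inv l) (letter_act l x) = x"
proof -
  have b: "bij (letter_act (fst l, True))" using bij_letter_act[of "(fst l, True)"] assms by auto
  show "letter_act l (letter_act (letter_inv l) x) = x"
    using b by (auto simp: letter_act_def letter_inv_def bij_is_surj bij_is_inj surj_f_inv_f)
  show "letter_act (letter_inv l) (letter_act l x) = x"
    using b by (auto simp: letter_act_def letter_inv_def bij_is_surj bij_is_inj surj_f_inv_f)
qed

lemma continuous_word_act [simp]: "wd w \<Longrightarrow> continuous_on UNIV (word_act w)"
proof (induction w)
  case (Cons l w)
  then show ?case
    using continuous_letter_act[of l]
    by (auto simp del: o_apply intro!: continuous_on_compose intro: continuous_on_subset)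
qed simp

lemma wd_word_inv [simp]: "wd w \<Longrightarrow> wd (word_inv w)"
  by (rule set_word_inv)

lemma wd_reduce_word [simp]: "wd w \<Longrightarrow> wd (reduce_word w)"
  using set_reduce_word[of w] by auto

lemma word_act_cons_cancel:
  assumes "l \<in> S \<times> UNIV" shows "word_act (cons_cancel l w) = letter_act l \<circ> word_act w"
  using assms by (cases w) (auto simp: fun_eq_iff)

lemma word_act_reduce [simp]: "wd w \<Longrightarrow> word_act (reduce_word w) = word_act w"
  by (induction w) (auto simp: reduce_word_onto word_act_cons_cancel)

lemma word_act_inv [simp]:
  assumes "wd w"
  shows "word_act w (word_act (word_inv w) x) = x" "word_act (word_inv w) (word_act w x) = x"
proof -
  show "word_act w (word_act (word_inv w) x) = x"
    using word_act_reduce[of "w @ word_inv w"] assms by (simp add: fun_eq_iff)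
  show "word_act (word_inv w) (word_act w x) = x"
    using word_act_reduce[of "word_inv w @ w"] assms by (simp add: fun_eq_iff)
qed

end

section \<open>The semidirect product as a group of jumping loops\<close>

locale warped_base = warped_action S for S :: "('a::metric_space \<Rightarrow> 'a) set" +
  fixes \<alpha> :: "('a \<Rightarrow> 'a) \<Rightarrow> real \<Rightarrow> 'a" and x0 :: 'a
  assumes alpha: "s \<in> S \<Longrightarrow> path (\<alpha> s) \<and> pathstart (\<alpha> s) = x0 \<and> pathfinish (\<alpha> s) = s x0"
begin

lemma alpha_letter:
  assumes "l \<in> S \<times> UNIV"
  shows "path (alpha_letter \<alpha> l)" "pathstart (alpha_letter \<alpha> l) = x0"
    "pathfinish (alpha_letter \<alpha> l) = letter_act l x0"
proof -
  have l: "fst l \<in> S" using assms by auto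
  note a = alpha[OF l]
  show "path (alpha_letter \<alpha> l)"
    using continuous_letter_act[OF assms] a
    by (auto simp: alpha_letter_def letter_act_def intro!: path_comp split: if_splits)
  show "pathstart (alpha_letter \<alpha> l) = x0"
    using letter_act_inv(2)[of "(fst l, True)" x0] l a
    by (auto simp: alpha_letter_def letter_act_def letter_inv_def pathstart_compose)
  show "pathfinish (alpha_letter \<alpha> l) = letter_act l x0"
    using a by (auto simp: alpha_letter_def letter_act_def pathfinish_compose)
qed

lemma alpha_word:
  assumes "wd w"
  shows "path (alpha_word \<alpha> x0 w)" "pathstart (alpha_word \<alpha> x0 w) = x0"
    "pathfinish (alpha_word \<alpha> x0 w) = word_act w x0"
proof -
  have "path (alpha_word \<alpha> x0 w) \<and> pathstart (alpha_word \<alpha> x0 w) = x0 \<and>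
    pathfinish (alpha_word \<alpha> x0 w) = word_act w x0"
    using assms
    by (induction w) (auto simp: alpha_letter pathstart_compose pathfinish_compose path_comp
        continuous_letter_act)
  then show "path (alpha_word \<alpha> x0 w)" "pathstart (alpha_word \<alpha> x0 w) = x0"
    "pathfinish (alpha_word \<alpha> x0 w) = word_act w x0" by auto
qed

text \<open>Maps under \<open>im\<close> are kept in lambda form; these continuity rules and
  \<open>im_comp\<close> let the simplifier merge nested translates.\<close>

lemma continuous_word_act_comp [simp]:
  assumes "wd u" "continuous_on UNIV g" shows "continuous_on UNIV (\<lambda>x. word_act u (g x))"
  using continuous_on_compose2[OF continuous_word_act[OF assms(1)] assms(2)] by simp

lemma continuous_letter_act_comp [simp]:
  assumes "l \<in> S \<times> UNIV" "continuous_on UNIV g" shows "continuous_on UNIV (\<lambda>x. letter_act l (g x))"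
  using continuous_on_compose2[OF continuous_letter_act[OF assms(1)] assms(2)] by simp

lemma im_comp [simp]: "im (f \<circ> g) a = im (\<lambda>x. f (g x)) a"
  by (simp add: comp_def)

section \<open>The path class attached to a word\<close>

definition al :: "('a \<Rightarrow> 'a) letter list \<Rightarrow> (real \<Rightarrow> 'a) set" where
  "al w = pc (alpha_word \<alpha> x0 w)"

lemma al_arr [simp]: "wd w \<Longrightarrow> arr (al w)" "wd w \<Longrightarrow> src (al w) = x0"
  "wd w \<Longrightarrow> tgt (al w) = word_act w x0"
  by (simp_all add: al_def alpha_word)

lemma al_Nil [simp]: "al [] = cn x0"
  by (simp add: al_def)

lemma al_Cons:
  assumes "l \<in> S \<times> UNIV" "wd w"
  shows "al (l # w) = pc (alpha_letter \<alpha> l) \<star> im (letter_act l) (al w)"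
  using assms
  by (simp add: al_def alpha_letter alpha_word continuous_letter_act im_pc cmp_pc path_comp
      pathstart_compose)

text \<open>The cocycle identity; together with \<open>al_reduce\<close> it makes \<open>al\<close>
  a crossed homomorphism on the free group.\<close>

lemma al_append [simp]:
  assumes "wd u" "wd v" shows "al (u @ v) = al u \<star> im (word_act u) (al v)"
  using assms
proof (induction u)
  case (Cons l u)
  then have l: "l \<in> S \<times> UNIV" "wd u" "continuous_on UNIV (letter_act l)"
    by (auto simp: continuous_letter_act)
  have "al ((l # u) @ v) = pc (alpha_letter \<alpha> l) \<star> im (letter_act l) (al u)
      \<star> im (letter_act l) (im (word_act u) (al v))"
    using Cons l by (simp add: al_Cons del: im_im)
  then show ?case
    using Cons.prems l alpha_letter[of l] by (simp add: al_Cons)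
qed simp

text \<open>By the definition of \<open>alpha_letter\<close>, translating the path of the inverse
  letter by \<open>l\<close> gives the reversed path of \<open>l\<close>. This is what lets
  \<open>al\<close> descend to reduced words.\<close>

lemma alpha_letter_cancel:
  assumes "l \<in> S \<times> UNIV"
  shows "pc (alpha_letter \<alpha> l) \<star> im (letter_act l) (pc (alpha_letter \<alpha> (letter_inv l))) = cn x0"
proof -
  have "letter_act l \<circ> alpha_letter \<alpha> (letter_inv l) = reversepath (alpha_letter \<alpha> l)"
    using assms letter_act_inv(1)[of l] letter_act_inv(1)[of "letter_inv l"]
    by (cases "snd l") (fastforce simp: fun_eq_iff alpha_letter_def letter_act_def letter_inv_def
        reversepath_def mem_Times_iff)+
  moreover have "letter_inv l \<in> S \<times> UNIV" using assms by (simp add: letter_inv_mem)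
  ultimately have "im (letter_act l) (pc (alpha_letter \<alpha> (letter_inv l))) = rv (pc (alpha_letter \<alpha> l))"
    using assms by (simp add: alpha_letter continuous_letter_act im_pc rv_pc)
  then show ?thesis using assms by (simp add: alpha_letter)
qed

lemma al_cons_cancel:
  assumes "l \<in> S \<times> UNIV" "wd w" shows "al (cons_cancel l w) = al (l # w)"
proof (cases "\<exists>v. w = letter_inv l # v")
  case True
  then obtain v where w: "w = letter_inv l # v" by blast
  have l': "letter_inv l \<in> S \<times> UNIV" and v: "wd v" using assms w by (auto simp: letter_inv_mem)
  have "al (l # w) = pc (alpha_letter \<alpha> l) \<star> im (letter_act l) (pc (alpha_letter \<alpha> (letter_inv l)))
      \<star> im (letter_act l) (im (letter_act (letter_inv l)) (al v))"
    using assms l' v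
    by (simp add: w al_Cons alpha_letter continuous_letter_act del: im_im)
  also have "im (letter_act l) (im (letter_act (letter_inv l)) (al v)) = al v"
    using assms l' v by (simp add: continuous_letter_act)
  also have "pc (alpha_letter \<alpha> l) \<star> im (letter_act l) (pc (alpha_letter \<alpha> (letter_inv l))) \<star> al v
     = (pc (alpha_letter \<alpha> l) \<star> im (letter_act l) (pc (alpha_letter \<alpha> (letter_inv l)))) \<star> al v"
    using assms l' v by (intro cmp_assoc[symmetric]) (simp_all add: alpha_letter continuous_letter_act)
  also have "\<dots> = al v" unfolding alpha_letter_cancel[OF assms(1)] using v by simp
  finally show ?thesis by (simp add: w)
next
  case False
  then have "cons_cancel l w = l # w" by (cases w) auto
  then show ?thesis by simp
qed

lemma al_reduce [simp]: "wd w \<Longrightarrow> al (reduce_word w) = al w"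
proof (induction w)
  case (Cons l w)
  then show ?case
    using al_cons_cancel[of l "reduce_word w"] wd_reduce_word[of w]
    by (auto simp: reduce_word_onto al_Cons)
qed (simp add: reduce_word_onto)

section \<open>The semidirect product in path coordinates\<close>

lemma fundamental_group_sel [simp]:
  "A \<in> carrier (fundamental_group UNIV x) \<longleftrightarrow> arr A \<and> src A = x \<and> tgt A = x"
  "mult (fundamental_group UNIV x) A B = A \<star> B"
  "one (fundamental_group UNIV x) = cn x"
proof -
  show "A \<in> carrier (fundamental_group UNIV x) \<longleftrightarrow> arr A \<and> src A = x \<and> tgt A = x"
    by (auto simp: fundamental_group_def arr_def)
qed (simp_all add: fundamental_group_def cmp_def)

lemma phi_S_eq:
  assumes "wd w" "arr A" "src A = x0" "tgt A = x0"
  shows "phi_S \<alpha> x0 w A = al w \<star> im (word_act w) A \<star> rv (al w)"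
proof -
  obtain g where g: "path g" "A = pc g" "pathstart g = x0" "pathfinish g = x0"
    using arrE[OF assms(2)] assms(3,4) by metis
  have eq: "pc (alpha_word \<alpha> x0 w +++ (word_act w \<circ> h) +++ reversepath (alpha_word \<alpha> x0 w)) =
     al w \<star> im (word_act w) A \<star> rv (al w)" if "h \<in> A" for h
  proof -
    have h: "path h" "A = pc h" "pathstart h = x0" "pathfinish h = x0"
      using that g hpathsD[of g h] pc_eq_iff[of g h] by (auto simp: mem_pc)
    then show ?thesis using assms(1)
      by (simp add: al_def alpha_word im_pc rv_pc cmp_pc path_comp pathstart_compose pathfinish_compose)
  qed
  have "g \<in> A" using g mem_pc_self by metis
  then show ?thesis unfolding phi_S_def using eq by auto
qed

abbreviation GG where "GG \<equiv> pi1_semidirect S \<alpha> x0"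

text \<open>\<open>J a w\<close> is the element whose jumping loop follows \<open>a\<close> from \<open>x0\<close> to \<open>w x0\<close> and jumps back along \<open>w\<close>;
  \<open>mor x y a w\<close> says that \<open>(a, w)\<close> is a morphism from \<open>x\<close> to \<open>y\<close> of the corresponding groupoid.\<close>

definition J :: "(real \<Rightarrow> 'a) set \<Rightarrow> ('a \<Rightarrow> 'a) letter list \<Rightarrow> (real \<Rightarrow> 'a) set \<times> ('a \<Rightarrow> 'a) letter list" where
  "J a w = (a \<star> rv (al w), w)"

definition mor :: "'a \<Rightarrow> 'a \<Rightarrow> (real \<Rightarrow> 'a) set \<Rightarrow> ('a \<Rightarrow> 'a) letter list \<Rightarrow> bool" where
  "mor x y a w \<longleftrightarrow> wd w \<and> arr a \<and> src a = x \<and> tgt a = word_act w y"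

lemma J_carrier: "mor x0 x0 a w \<Longrightarrow> reduced_word w \<Longrightarrow> J a w \<in> carrier GG"
  by (simp add: pi1_semidirect_def semidirect_product_def J_def mor_def)

lemma GG_cases:
  assumes "g \<in> carrier GG"
  obtains a w where "mor x0 x0 a w" "reduced_word w" "g = J a w"
proof -
  obtain A w where g: "g = (A, w)" "arr A" "src A = x0" "tgt A = x0" "reduced_word w" "wd w"
    using assms by (cases g) (auto simp: pi1_semidirect_def semidirect_product_def)
  then show ?thesis
    by (intro that[of "A \<star> al w" w]) (auto simp: mor_def J_def)
qed

lemma mor_cmp: "mor x y a w \<Longrightarrow> mor y z b v \<Longrightarrow> mor x z (a \<star> im (word_act w) b) (w @ v)"
  by (simp add: mor_def)

lemma mor_reduce: "mor x y a w \<Longrightarrow> mor x y a (reduce_word w)"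
  by (simp add: mor_def)

text \<open>The conjugation by \<open>al w\<close> inside \<open>phi_S\<close> cancels against the
  factor \<open>rv (al w)\<close> of \<open>J a w\<close>; the remaining correction is the one of
  the product word, by the cocycle identity.\<close>

lemma J_mult:
  assumes "mor x0 x0 a w" "mor x0 x0 b v"
  shows "J a w \<otimes>\<^bsub>GG\<^esub> J b v = J (a \<star> im (word_act w) b) (reduce_word (w @ v))"
  using assms
  by (simp add: pi1_semidirect_def semidirect_product_def J_def mor_def phi_S_eq)

lemma GG_one: "\<one>\<^bsub>GG\<^esub> = J (cn x0) []"
  by (simp add: pi1_semidirect_def semidirect_product_def J_def)

lemma group_GG: "group GG"
proof (rule groupI)
  fix x y assume "x \<in> carrier GG" "y \<in> carrier GG"
  then show "x \<otimes>\<^bsub>GG\<^esub> y \<in> carrier GG"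
    by (elim GG_cases) (auto simp: J_mult intro!: J_carrier mor_reduce mor_cmp)
next
  show "\<one>\<^bsub>GG\<^esub> \<in> carrier GG" unfolding GG_one by (rule J_carrier) (auto simp: mor_def)
next
  fix x y z assume "x \<in> carrier GG" "y \<in> carrier GG" "z \<in> carrier GG"
  then obtain a u b v c w where *: "mor x0 x0 a u" "mor x0 x0 b v" "mor x0 x0 c w"
    and [simp]: "x = J a u" "y = J b v" "z = J c w"
    by (elim GG_cases) metis
  have "J a u \<otimes>\<^bsub>GG\<^esub> J b v \<otimes>\<^bsub>GG\<^esub> J c w
      = J (a \<star> im (word_act u) b \<star> im (\<lambda>x. word_act u (word_act v x)) c) (reduce_word (u @ v @ w))"
    using * mor_reduce[OF mor_cmp[OF *(1,2)]]
    by (simp add: J_mult reduce_word_append_reduce) (simp add: mor_def)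
  also have "\<dots> = J a u \<otimes>\<^bsub>GG\<^esub> (J b v \<otimes>\<^bsub>GG\<^esub> J c w)"
    using * mor_reduce[OF mor_cmp[OF *(2,3)]]
    by (simp add: J_mult reduce_word_append_reduce) (simp add: mor_def)
  finally show "x \<otimes>\<^bsub>GG\<^esub> y \<otimes>\<^bsub>GG\<^esub> z = x \<otimes>\<^bsub>GG\<^esub> (y \<otimes>\<^bsub>GG\<^esub> z)" by simp
next
  fix x assume "x \<in> carrier GG"
  then obtain a w where *: "mor x0 x0 a w" "reduced_word w" "x = J a w" by (rule GG_cases)
  have c: "mor x0 x0 (cn x0) []" by (simp add: mor_def)
  show "\<one>\<^bsub>GG\<^esub> \<otimes>\<^bsub>GG\<^esub> x = x"
    using * by (simp add: GG_one J_mult[OF c]) (simp add: mor_def)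
  \<comment> \<open>Inverting reverses \<open>a\<close> and moves it back by the inverse word, so
    that it starts at \<open>x0\<close> again.\<close>
  have i: "mor x0 x0 (im (word_act (word_inv w)) (rv a)) (reduce_word (word_inv w))"
    using *(1) by (simp add: mor_def)
  have "J (im (word_act (word_inv w)) (rv a)) (reduce_word (word_inv w)) \<otimes>\<^bsub>GG\<^esub> x = \<one>\<^bsub>GG\<^esub>"
    using * by (simp add: GG_one J_mult[OF i] reduce_word_append_reduce) (simp add: mor_def flip: im_cmp)
  then show "\<exists>y\<in>carrier GG. y \<otimes>\<^bsub>GG\<^esub> x = \<one>\<^bsub>GG\<^esub>"
    using J_carrier[OF i] by auto
qed

text \<open>The last factor in the definition of \<open>K_set\<close> is the correction that
  \<open>J\<close> adds, so only the bracketing of the concatenation changes.\<close>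

lemma K_set_eq:
  "K_set S \<theta> \<alpha> x0 = {J (b \<star> im (word_act w) (rv b)) w | b w.
     w \<in> Ell S \<theta> \<and> arr b \<and> src b = x0 \<and> tgt b \<in> Fix_word w}"
proof -
  have eq: "pc (\<beta> +++ (word_act w \<circ> reversepath \<beta>) +++ reversepath (alpha_word \<alpha> x0 w)) =
     (pc \<beta> \<star> im (word_act w) (rv (pc \<beta>))) \<star> rv (al w)"
    if "wd w" "path \<beta>" "pathstart \<beta> = x0" "pathfinish \<beta> \<in> Fix_word w" for \<beta> w
    using that
    by (simp add: al_def rv_pc im_pc alpha_word cmp_pc path_comp pathstart_compose
        pathfinish_compose Fix_word_def pc_eq_iff homotopic_paths_assoc)
  have "g \<in> K_set S \<theta> \<alpha> x0 \<longleftrightarrow> (\<exists>b w. g = J (b \<star> im (word_act w) (rv b)) w \<and>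
     w \<in> Ell S \<theta> \<and> arr b \<and> src b = x0 \<and> tgt b \<in> Fix_word w)" for g
  proof
    assume "g \<in> K_set S \<theta> \<alpha> x0"
    then obtain \<beta> w where *: "g = (pc (\<beta> +++ (word_act w \<circ> reversepath \<beta>) +++
        reversepath (alpha_word \<alpha> x0 w)), w)"
      "w \<in> Ell S \<theta>" "path \<beta>" "pathstart \<beta> = x0" "pathfinish \<beta> \<in> Fix_word w"
      unfolding K_set_def by blast
    have "wd w" using *(2) by (simp add: Ell_def)
    have "g = J (pc \<beta> \<star> im (word_act w) (rv (pc \<beta>))) w"
      using *(1) eq[OF \<open>wd w\<close> *(3-5)] by (simp only: J_def)
    moreover have "arr (pc \<beta>)" "src (pc \<beta>) = x0" "tgt (pc \<beta>) \<in> Fix_word w"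
      using *(3-5) by simp_all
    ultimately show "\<exists>b w. g = J (b \<star> im (word_act w) (rv b)) w \<and>
       w \<in> Ell S \<theta> \<and> arr b \<and> src b = x0 \<and> tgt b \<in> Fix_word w"
      using *(2) by blast
  next
    assume "\<exists>b w. g = J (b \<star> im (word_act w) (rv b)) w \<and>
       w \<in> Ell S \<theta> \<and> arr b \<and> src b = x0 \<and> tgt b \<in> Fix_word w"
    then obtain b w where *: "g = J (b \<star> im (word_act w) (rv b)) w"
      "w \<in> Ell S \<theta>" "arr b" "src b = x0" "tgt b \<in> Fix_word w" by blast
    obtain \<beta> where \<beta>: "path \<beta>" "b = pc \<beta>" "pathstart \<beta> = src b" "pathfinish \<beta> = tgt b"
      using *(3) by (rule arrE)
    have "wd w" using *(2) by (simp add: Ell_def)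
    have \<beta>': "pathstart \<beta> = x0" "pathfinish \<beta> \<in> Fix_word w" using \<beta>(3,4) *(4,5) by simp_all
    then have "g = (pc (\<beta> +++ (word_act w \<circ> reversepath \<beta>) +++ reversepath (alpha_word \<alpha> x0 w)), w)"
      using *(1) eq[OF \<open>wd w\<close> \<beta>(1)] by (simp only: J_def \<beta>(2))
    then show "g \<in> K_set S \<theta> \<alpha> x0"
      unfolding K_set_def using *(2) \<beta>(1) \<beta>' by auto
  qed
  then show ?thesis by auto
qed

end

text \<open>Conjugating with the chosen paths \<open>bs x\<close> from \<open>x0\<close> turns morphisms of the groupoid into
  elements of the group at \<open>x0\<close>.\<close>

locale warped_based = warped_base S \<alpha> x0
  for S :: "('a::metric_space \<Rightarrow> 'a) set" and \<alpha> :: "('a \<Rightarrow> 'a) \<Rightarrow> real \<Rightarrow> 'a" and x0 :: 'a +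
  fixes bs :: "'a \<Rightarrow> (real \<Rightarrow> 'a) set"
  assumes bs [simp]: "arr (bs x)" "src (bs x) = x0" "tgt (bs x) = x"
    and bs_x0 [simp]: "bs x0 = cn x0"
begin

text \<open>Morphisms may carry unreduced words, so that composing them is plain append; the word is
  reduced when an element of the group is formed.\<close>

definition B :: "'a \<Rightarrow> 'a \<Rightarrow> (real \<Rightarrow> 'a) set \<Rightarrow> ('a \<Rightarrow> 'a) letter list
    \<Rightarrow> (real \<Rightarrow> 'a) set \<times> ('a \<Rightarrow> 'a) letter list" where
  "B x y a w = J (bs x \<star> a \<star> im (word_act w) (rv (bs y))) (reduce_word w)"

lemma mor_bs: "mor x y a w \<Longrightarrow> mor x0 x0 (bs x \<star> a \<star> im (word_act w) (rv (bs y))) w"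
  by (simp add: mor_def)

lemma B_carrier: "mor x y a w \<Longrightarrow> B x y a w \<in> carrier GG"
  unfolding B_def by (intro J_carrier mor_reduce mor_bs) simp_all

text \<open>Functoriality: the return along \<open>bs y\<close> cancels against the departure along
  \<open>bs y\<close>, both being translated by \<open>w\<close>.\<close>

lemma B_mult:
  assumes "mor x y a w" "mor y z b v"
  shows "B x y a w \<otimes>\<^bsub>GG\<^esub> B y z b v = B x z (a \<star> im (word_act w) b) (w @ v)"
proof -
  have "wd w" using assms by (simp add: mor_def)
  then have "B x y a w \<otimes>\<^bsub>GG\<^esub> B y z b v = J ((bs x \<star> a \<star> im (word_act w) (rv (bs y))) \<star>
      im (word_act w) (bs y \<star> b \<star> im (word_act v) (rv (bs z)))) (reduce_word (w @ v))"
    unfolding B_def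
    using mor_reduce[OF mor_bs[OF assms(1)]] mor_reduce[OF mor_bs[OF assms(2)]]
    by (simp add: J_mult reduce_word_append_reduce)
  also have "\<dots> = B x z (a \<star> im (word_act w) b) (w @ v)"
    using assms by (simp add: B_def mor_def)
  finally show ?thesis .
qed

lemma B_base: "mor x0 x0 a w \<Longrightarrow> reduced_word w \<Longrightarrow> B x0 x0 a w = J a w"
  by (simp add: B_def mor_def)

lemma B_reduce: "mor x y a w \<Longrightarrow> B x y a (reduce_word w) = B x y a w"
  by (simp add: B_def mor_def)

end

section \<open>Moves on discrete paths\<close>

lemma lazification_refl: "lazification zs zs"
  unfolding lazification_def by (intro exI[of _ "\<lambda>i. i"]) (auto simp: mono_on_def)

lemma lazification_append:
  assumes "lazification xs xs'" "lazification ys ys'"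
  shows "lazification (xs @ ys) (xs' @ ys')"
proof -
  obtain f where f: "mono_on {..<length xs'} f" "f ` {..<length xs'} = {..<length xs}"
    "\<And>i. i < length xs' \<Longrightarrow> xs' ! i = xs ! f i" using assms(1) by (auto simp: lazification_def)
  obtain g where g: "mono_on {..<length ys'} g" "g ` {..<length ys'} = {..<length ys}"
    "\<And>i. i < length ys' \<Longrightarrow> ys' ! i = ys ! g i" using assms(2) by (auto simp: lazification_def)
  define h where "h i = (if i < length xs' then f i else length xs + g (i - length xs'))" for i
  have fx: "f i < length xs" if "i < length xs'" for i using f(2) that by auto
  have gy: "g i < length ys" if "i < length ys'" for i using g(2) that by auto
  have "mono_on {..<length (xs' @ ys')} h"
  proof (rule mono_onI)
    fix r s assume *: "r \<in> {..<length (xs' @ ys')}" "s \<in> {..<length (xs' @ ys')}" "r \<le> s"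
    show "h r \<le> h s"
      using * mono_onD[OF f(1), of r s] mono_onD[OF g(1), of "r - length xs'" "s - length xs'"]
        fx[of r] by (auto simp: h_def)
  qed
  moreover have "h ` {..<length (xs' @ ys')} = {..<length (xs @ ys)}"
  proof
    show "h ` {..<length (xs' @ ys')} \<subseteq> {..<length (xs @ ys)}"
      using fx gy by (fastforce simp: h_def)
    show "{..<length (xs @ ys)} \<subseteq> h ` {..<length (xs' @ ys')}"
    proof
      fix k assume k: "k \<in> {..<length (xs @ ys)}"
      show "k \<in> h ` {..<length (xs' @ ys')}"
      proof (cases "k < length xs")
        case True
        then have "k \<in> f ` {..<length xs'}" using f(2) by simp
        then obtain i where "i < length xs'" "k = f i" by auto
        then show ?thesis by (intro image_eqI[of _ _ i]) (auto simp: h_def)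
      next
        case False
        then have "k - length xs \<in> g ` {..<length ys'}" using g(2) k by auto
        then obtain i where "i < length ys'" "k - length xs = g i" by auto
        then show ?thesis using False by (intro image_eqI[of _ _ "length xs' + i"]) (auto simp: h_def)
      qed
    qed
  qed
  moreover have "(xs' @ ys') ! i = (xs @ ys) ! h i" if "i < length (xs' @ ys')" for i
    using that f(3)[of i] g(3)[of "i - length xs'"] fx[of i]
    by (auto simp: h_def nth_append)
  ultimately show ?thesis unfolding lazification_def by blast
qed

lemma lazification_dup: "lazification [x] [x, x]"
  unfolding lazification_def
  by (intro exI[of _ "\<lambda>_. 0"]) (auto simp: mono_on_def nth_Cons split: nat.splits)

text \<open>A monotone surjection of index ranges preserves the first and the last index.\<close>

lemma lazification_hd_last:
  assumes "lazification zs zs'" "zs' \<noteq> []" shows "zs \<noteq> []" "hd zs' = hd zs" "last zs' = last zs"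
proof -
  obtain f where f: "mono_on {..<length zs'} f" "f ` {..<length zs'} = {..<length zs}"
    "\<And>i. i < length zs' \<Longrightarrow> zs' ! i = zs ! f i" using assms(1) by (auto simp: lazification_def)
  have l': "0 < length zs'" using assms(2) by simp
  then have "f 0 \<in> {..<length zs}" using f(2) by blast
  then have l: "0 < length zs" by auto
  then show ne: "zs \<noteq> []" by simp
  have "0 \<in> f ` {..<length zs'}" "length zs - 1 \<in> f ` {..<length zs'}" using f(2) l by auto
  then obtain i j where i: "i < length zs'" "f i = 0" and j: "j < length zs'" "f j = length zs - 1"
    by fastforce
  have "f 0 = 0" using mono_onD[OF f(1), of 0 i] i l' by simp
  then show "hd zs' = hd zs" using f(3)[OF l'] ne assms(2) by (simp add: hd_conv_nth)
  have "f (length zs' - 1) \<in> {..<length zs}" using f(2) l' by auto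
  moreover have "f j \<le> f (length zs' - 1)" by (rule mono_onD[OF f(1)]) (use j in auto)
  ultimately have "f (length zs' - 1) = length zs - 1" using j by auto
  then show "last zs' = last zs"
    using f(3)[of "length zs' - 1"] ne assms(2) l' by (simp add: last_conv_nth)
qed

locale discrete_paths =
  fixes \<rho> :: "'a \<Rightarrow> 'a \<Rightarrow> real" and \<theta> :: real
  assumes metric: "Metric_space UNIV \<rho>" and theta_nonneg: "0 \<le> \<theta>"
begin

abbreviation tp :: "'a list \<Rightarrow> bool" where "tp \<equiv> theta_path \<rho> \<theta>"
abbreviation th :: "'a list \<Rightarrow> 'a list \<Rightarrow> bool" where "th \<equiv> theta_homotopic \<rho> \<theta>"

lemma rho_self [simp]: "\<rho> x x = 0"
  using metric by (simp add: Metric_space_def)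

lemma rho_commute: "\<rho> x y = \<rho> y x"
  using metric by (simp add: Metric_space_def)

lemma rho_triangle: "\<rho> x z \<le> \<rho> x y + \<rho> y z"
  using metric by (simp add: Metric_space_def)

lemma tp_successively: "tp zs \<longleftrightarrow> zs \<noteq> [] \<and> successively (\<lambda>x y. \<rho> x y \<le> \<theta>) zs"
  by (auto simp: theta_path_def successively_conv_nth)

lemma tp_simps [simp]:
  "\<not> tp []" "tp [x]" "tp (x # y # zs) \<longleftrightarrow> \<rho> x y \<le> \<theta> \<and> tp (y # zs)"
  by (auto simp: tp_successively)

lemma tp_ne: "tp xs \<Longrightarrow> xs \<noteq> []"
  by (simp add: theta_path_def)

lemma tp_append:
  "xs \<noteq> [] \<Longrightarrow> ys \<noteq> [] \<Longrightarrow> tp (xs @ ys) \<longleftrightarrow> tp xs \<and> tp ys \<and> \<rho> (last xs) (hd ys) \<le> \<theta>"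
  by (auto simp: tp_successively successively_append_iff)

lemma tp_context_cong:
  assumes "tp (ps @ xs @ qs)" "tp xs" "tp ys" "hd xs = hd ys" "last xs = last ys"
  shows "tp (ps @ ys @ qs)"
proof -
  have [simp]: "xs \<noteq> []" "ys \<noteq> []" using assms by (auto simp: tp_successively)
  show ?thesis
    using assms by (cases "ps = []"; cases "qs = []") (auto simp: tp_append)
qed

text \<open>Two adjacent rows of a grid homotopy. Every grid homotopy is a chain of these
  (\<open>close_chain_if_grid\<close>), so invariants need only be checked from one row to the
  next.\<close>

definition pointwise_close :: "'a list \<Rightarrow> 'a list \<Rightarrow> bool" where
  "pointwise_close xs ys \<longleftrightarrow> tp xs \<and> tp ys \<and> list_all2 (\<lambda>x y. \<rho> x y \<le> \<theta>) xs ys \<and>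
     hd xs = hd ys \<and> last xs = last ys"

lemma rho_nth_le:
  assumes "tp zs" "i \<le> j" "j < length zs" shows "\<rho> (zs ! i) (zs ! j) \<le> \<theta> * (real j - real i)"
  using assms(2,3)
proof (induction rule: dec_induct)
  case (step k)
  have "\<rho> (zs ! k) (zs ! Suc k) \<le> \<theta>" using assms(1) step.prems by (simp add: theta_path_def)
  then show ?case
    using step rho_triangle[of "zs ! i" "zs ! Suc k" "zs ! k"] by (simp add: algebra_simps)
qed simp

lemma rho_nth_le_abs:
  assumes "tp zs" "i < length zs" "j < length zs"
  shows "\<rho> (zs ! i) (zs ! j) \<le> \<theta> * \<bar>real i - real j\<bar>"
proof (cases "i \<le> j")
  case True then show ?thesis using rho_nth_le[OF assms(1) True] assms by simp
next
  case False then show ?thesis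
    using rho_nth_le[OF assms(1), of j i] assms by (simp add: rho_commute)
qed

lemma grid_homotopic_if_close:
  assumes "pointwise_close xs ys" shows "grid_homotopic \<rho> \<theta> xs ys"
proof -
  have tp: "tp xs" "tp ys" and len: "length xs = length ys"
    and le: "\<And>i. i < length xs \<Longrightarrow> \<rho> (xs ! i) (ys ! i) \<le> \<theta>"
    and ends: "hd xs = hd ys" "last xs = last ys"
    using assms by (auto simp: pointwise_close_def list_all2_conv_all_nth)
  have ne: "xs \<noteq> []" "ys \<noteq> []" using tp by auto
  define n where "n = length xs - 1"
  have n: "length xs = Suc n" "length ys = Suc n" using ne len by (auto simp: n_def)
  define H where "H i j = (if j = (0::nat) then xs ! i else ys ! i)" for i j
  have lip: "\<rho> (H i j) (H i' j') \<le> \<theta> * (\<bar>real i - real i'\<bar> + \<bar>real j - real j'\<bar>)"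
    if *: "i \<le> n" "i' \<le> n" "j \<le> 1" "j' \<le> 1" for i i' j j'
  proof -
    have x: "\<rho> (xs ! i) (xs ! i') \<le> \<theta> * \<bar>real i - real i'\<bar>"
      and y: "\<rho> (ys ! i) (ys ! i') \<le> \<theta> * \<bar>real i - real i'\<bar>"
      using rho_nth_le_abs tp n * by auto
    \<comment> \<open>The l1 distance of a diagonal pair is the horizontal distance plus one, so the
      triangle inequality through a corner suffices.\<close>
    have "\<rho> (xs ! i) (ys ! i') \<le> \<theta> * (\<bar>real i - real i'\<bar> + 1)"
      using x le[of i'] n * rho_triangle[of "xs ! i" "ys ! i'" "xs ! i'"] by (simp add: algebra_simps)
    moreover have "\<rho> (ys ! i) (xs ! i') \<le> \<theta> * (\<bar>real i - real i'\<bar> + 1)"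
      using y le[of i'] n * rho_triangle[of "ys ! i" "xs ! i'" "ys ! i'"]
      by (simp add: algebra_simps rho_commute)
    moreover have "j = 0 \<or> j = 1" "j' = 0 \<or> j' = 1" using * by auto
    ultimately show ?thesis using x y by (auto simp: H_def)
  qed
  have H: "\<forall>j\<le>1. H 0 j = H 0 0" "\<forall>j\<le>1. H n j = H n 0"
    using ends ne n by (auto simp: H_def hd_conv_nth last_conv_nth)
  show ?thesis unfolding grid_homotopic_def
    by (rule exI[of _ n], rule exI[of _ 1], rule exI[of _ H])
       (use lip H n in \<open>auto simp: H_def\<close>)
qed

section \<open>Homotopy as a generated equivalence\<close>

lemma th_refl [simp]: "th x x" by (simp add: theta_homotopic_def)

lemma th_sym: "th x y \<Longrightarrow> th y x" by (simp add: theta_homotopic_def equivclp_sym)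

lemma th_trans [trans]: "th x y \<Longrightarrow> th y z \<Longrightarrow> th x z"
  unfolding theta_homotopic_def by (rule equivclp_trans)

lemma th_lazification: "tp xs \<Longrightarrow> tp ys \<Longrightarrow> lazification xs ys \<Longrightarrow> th xs ys"
  unfolding theta_homotopic_def by (rule r_into_equivclp) simp

lemma th_if_close: "pointwise_close xs ys \<Longrightarrow> th xs ys"
  unfolding theta_homotopic_def
  by (rule r_into_equivclp) (simp add: grid_homotopic_if_close pointwise_close_def)

lemma close_chain_if_grid:
  assumes "grid_homotopic \<rho> \<theta> xs ys" shows "pointwise_close\<^sup>*\<^sup>* xs ys"
proof -
  obtain n m H where G: "length xs = Suc n \<and> length ys = Suc n \<and>
        (\<forall>i\<le>n. \<forall>i'\<le>n. \<forall>j\<le>m. \<forall>j'\<le>m.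
           \<rho> (H i j) (H i' j') \<le> \<theta> * (\<bar>real i - real i'\<bar> + \<bar>real j - real j'\<bar>)) \<and>
        (\<forall>i\<le>n. H i 0 = xs ! i) \<and> (\<forall>i\<le>n. H i m = ys ! i) \<and>
        (\<forall>j\<le>m. H 0 j = H 0 0) \<and> (\<forall>j\<le>m. H n j = H n 0)"
    using assms unfolding grid_homotopic_def by (elim exE)
  then have len: "length xs = Suc n" "length ys = Suc n" by simp_all
  have lip: "\<rho> (H i j) (H i' j') \<le> \<theta> * (\<bar>real i - real i'\<bar> + \<bar>real j - real j'\<bar>)"
    if "i \<le> n" "i' \<le> n" "j \<le> m" "j' \<le> m" for i i' j j'
    using G that by simp
  have ends: "H i 0 = xs ! i" "H i m = ys ! i" "H 0 j = H 0 0" "H n j = H n 0"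
    if "i \<le> n" "j \<le> m" for i j
    using G that by auto
  define C where "C j = map (\<lambda>i. H i j) [0..<Suc n]" for j
  have nth: "C j ! i = H i j" if "i \<le> n" for i j
    using that unfolding C_def by (simp del: upt_Suc)
  have lenC: "length (C j) = Suc n" for j by (simp add: C_def)
  then have ne: "C j \<noteq> []" for j by (metis length_0_conv nat.distinct(1))
  have tp: "tp (C j)" if "j \<le> m" for j
  proof -
    have "\<rho> (C j ! i) (C j ! Suc i) \<le> \<theta>" if "Suc i < length (C j)" for i
      using that lip[of i "Suc i" j j] \<open>j \<le> m\<close> by (simp add: nth lenC)
    then show ?thesis using ne by (simp add: theta_path_def)
  qed
  have next_row: "pointwise_close (C j) (C (Suc j))" if "Suc j \<le> m" for j
  proof -
    have "\<rho> (C j ! i) (C (Suc j) ! i) \<le> \<theta>" if "i < Suc n" for i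
      using that lip[of i i j "Suc j"] \<open>Suc j \<le> m\<close> by (simp add: nth)
    moreover have "hd (C j) = hd (C (Suc j))" "last (C j) = last (C (Suc j))"
      using that ends(3)[of 0 j] ends(3)[of 0 "Suc j"] ends(4)[of 0 j] ends(4)[of 0 "Suc j"]
      by (simp_all add: hd_conv_nth last_conv_nth ne lenC nth)
    ultimately show ?thesis
      using tp[of j] tp[of "Suc j"] that
      by (simp add: pointwise_close_def list_all2_conv_all_nth lenC)
  qed
  have "pointwise_close\<^sup>*\<^sup>* (C 0) (C j)" if "j \<le> m" for j
    using that
  proof (induction j)
    case (Suc j)
    then have "pointwise_close\<^sup>*\<^sup>* (C 0) (C j)" by simp
    then show ?case using next_row[OF Suc.prems] by (rule rtranclp.rtrancl_into_rtrancl)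
  qed simp
  moreover have "C 0 = xs" "C m = ys"
    using len ends(1,2)[of _ 0] by (auto intro!: nth_equalityI simp: lenC nth)
  ultimately show ?thesis by auto
qed

text \<open>Grid homotopies are traded for single pairs of close rows, and symmetry and transitivity
  are separate cases, so a property has to be checked on two elementary moves only.\<close>

lemma th_induct [consumes 1, case_names refl lazy close sym trans]:
  assumes "th xs ys"
    and refl: "\<And>xs. P xs xs"
    and lazy: "\<And>xs ys. tp xs \<Longrightarrow> tp ys \<Longrightarrow> lazification xs ys \<Longrightarrow> P xs ys"
    and close: "\<And>xs ys. pointwise_close xs ys \<Longrightarrow> P xs ys"
    and sym: "\<And>xs ys. P xs ys \<Longrightarrow> P ys xs"
    and trans: "\<And>xs ys zs. P xs ys \<Longrightarrow> P ys zs \<Longrightarrow> P xs zs"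
  shows "P xs ys"
proof -
  have chain: "P xs ys" if "pointwise_close\<^sup>*\<^sup>* xs ys" for xs ys
    using that by (induction rule: rtranclp_induct) (blast intro: refl trans close)+
  show ?thesis
    using assms(1) unfolding theta_homotopic_def
  proof (induction rule: equivclp_induct)
    case (step y z)
    then have "P y z" using lazy chain close_chain_if_grid sym by blast
    then show ?case using step.IH trans by blast
  qed (rule refl)
qed

text \<open>\<open>th\<close> relates every list to itself, \<theta>-path or not, so being a
  \<theta>-path has to travel through the induction together with the end points.\<close>

lemma th_invariants:
  assumes "th xs ys" shows "(tp xs \<longleftrightarrow> tp ys) \<and> (tp xs \<longrightarrow> hd xs = hd ys \<and> last xs = last ys)"
  using assms
proof (induction rule: th_induct)
  case (lazy xs ys)
  then show ?case using lazification_hd_last[OF lazy(3) tp_ne] by simp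
qed (auto simp: pointwise_close_def)

lemma th_tp: "th xs ys \<Longrightarrow> tp xs \<Longrightarrow> tp ys"
  and th_hd: "th xs ys \<Longrightarrow> tp xs \<Longrightarrow> hd ys = hd xs"
  and th_last: "th xs ys \<Longrightarrow> tp xs \<Longrightarrow> last ys = last xs"
  using th_invariants by metis+

lemma th_context:
  assumes "th xs ys" "tp xs" "tp (ps @ xs @ qs)" shows "th (ps @ xs @ qs) (ps @ ys @ qs)"
proof -
  \<comment> \<open>The equivalence for the extended lists is part of the claim because the
    transitivity case needs it at the intermediate list.\<close>
  have "(tp xs \<longleftrightarrow> tp ys) \<and> (tp xs \<longrightarrow> hd xs = hd ys \<and> last xs = last ys \<and>
      (tp (ps @ xs @ qs) \<longleftrightarrow> tp (ps @ ys @ qs)) \<and> (tp (ps @ xs @ qs) \<longrightarrow> th (ps @ xs @ qs) (ps @ ys @ qs)))"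
    using assms(1)
  proof (induction rule: th_induct)
    case (lazy xs ys)
    have e: "hd xs = hd ys" "last xs = last ys" using lazification_hd_last[OF lazy(3) tp_ne] lazy by simp_all
    have "lazification (ps @ xs @ qs) (ps @ ys @ qs)"
      by (intro lazification_append lazification_refl lazy)
    moreover have "tp (ps @ xs @ qs) \<longleftrightarrow> tp (ps @ ys @ qs)"
      using tp_context_cong[OF _ lazy(1,2) e] tp_context_cong[OF _ lazy(2,1) e[symmetric]] by blast
    ultimately show ?case using lazy e th_lazification by simp
  next
    case (close xs ys)
    then have e: "tp xs" "tp ys" "hd xs = hd ys" "last xs = last ys"
      "list_all2 (\<lambda>x y. \<rho> x y \<le> \<theta>) xs ys" by (auto simp: pointwise_close_def)
    have "list_all2 (\<lambda>x y. \<rho> x y \<le> \<theta>) (ps @ xs @ qs) (ps @ ys @ qs)"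
      using e theta_nonneg by (auto intro!: list_all2_appendI list_all2_refl)
    moreover have "hd (ps @ xs @ qs) = hd (ps @ ys @ qs)" "last (ps @ xs @ qs) = last (ps @ ys @ qs)"
      using e by (cases "ps = []"; cases "qs = []"; cases "xs = []"; cases "ys = []"; auto)+
    ultimately have "th (ps @ xs @ qs) (ps @ ys @ qs)" if "tp (ps @ xs @ qs)"
      using that tp_context_cong[OF that e(1-4)] by (intro th_if_close) (simp add: pointwise_close_def)
    moreover have "tp (ps @ xs @ qs) \<longleftrightarrow> tp (ps @ ys @ qs)"
      using tp_context_cong[OF _ e(1-4)] tp_context_cong[OF _ e(2,1) e(3,4)[symmetric]] by blast
    ultimately show ?case using e by simp
  next
    case (sym xs ys) then show ?case using th_sym[of "ps @ xs @ qs" "ps @ ys @ qs"] by simp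
  next
    case (trans xs ys zs)
    then show ?case using th_trans[of "ps @ xs @ qs" "ps @ ys @ qs" "ps @ zs @ qs"] by simp
  qed simp
  then show ?thesis using assms by blast
qed

section \<open>Elementary moves\<close>

lemma th_dup: "tp (ps @ x # qs) \<Longrightarrow> th (ps @ x # qs) (ps @ x # x # qs)"
  using th_context[OF th_lazification[OF _ _ lazification_dup[of x]], of ps qs] theta_nonneg by simp

text \<open>Duplicate \<open>x\<close>, then move the second copy to \<open>y\<close>: the rows
  \<open>[x, x, z]\<close> and \<open>[x, y, z]\<close> are close.\<close>

lemma th_triangle_local:
  assumes "\<rho> x y \<le> \<theta>" "\<rho> y z \<le> \<theta>" "\<rho> x z \<le> \<theta>" shows "th [x, y, z] [x, z]"
proof -
  have "th [x, z] [x, x, z]" using th_dup[of "[]" x "[z]"] assms by simp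
  also have "th [x, x, z] [x, y, z]"
    using assms theta_nonneg by (intro th_if_close) (simp add: pointwise_close_def)
  finally show ?thesis by (rule th_sym)
qed

lemma th_triangle:
  assumes "tp (ps @ x # y # z # qs)" "\<rho> x z \<le> \<theta>"
  shows "th (ps @ x # y # z # qs) (ps @ x # z # qs)"
proof -
  have "tp (x # y # z # qs)" using assms(1) by (cases "ps = []") (auto simp: tp_append)
  then show ?thesis
    using th_context[OF th_triangle_local[of x y z], of ps qs] assms by simp
qed

text \<open>With one end duplicated the rows are \<open>[x, x, y, z]\<close> and
  \<open>[x, y', z, z]\<close>. Their columns compare \<open>x\<close> with \<open>y'\<close> and
  \<open>y\<close> with \<open>z\<close>, which are sides of the square; its diagonals are never
  measured.\<close>

lemma th_square:
  assumes "tp (ps @ x # y # z # qs)" "\<rho> x y' \<le> \<theta>" "\<rho> y' z \<le> \<theta>"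
  shows "th (ps @ x # y # z # qs) (ps @ x # y' # z # qs)"
proof -
  have t: "tp (x # y # z # qs)" using assms(1) by (cases "ps = []") (auto simp: tp_append)
  then have d: "\<rho> x y \<le> \<theta>" "\<rho> y z \<le> \<theta>" by auto
  have "th [x, y, z] [x, x, y, z]" using th_dup[of "[]" x "[y, z]"] d by simp
  also have "th [x, x, y, z] [x, y', z, z]"
    using assms d theta_nonneg by (intro th_if_close) (simp add: pointwise_close_def)
  also have "th [x, y', z, z] [x, y', z]"
    using th_sym[OF th_dup[of "[x, y']" z "[]"]] assms by simp
  finally have "th [x, y, z] [x, y', z]" .
  then show ?thesis
    using th_context[of "[x, y, z]" "[x, y', z]" ps qs] assms d by simp
qed

lemma th_backtrack:
  assumes "tp (ps @ x # y # x # qs)" shows "th (ps @ x # y # x # qs) (ps @ x # qs)"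
proof -
  have t: "th (ps @ x # y # x # qs) (ps @ x # x # qs)"
    using th_triangle[OF assms] theta_nonneg by simp
  have "tp (ps @ x # x # qs)" using th_tp[OF t assms] .
  then have "tp (ps @ x # qs)" by (cases "ps = []") (auto simp: tp_append)
  then show ?thesis using t th_sym[OF th_dup] th_trans by blast
qed

lemma th_append_tl:
  assumes "th xs xs'" "th ys ys'" "tp xs" "tp ys" "last xs = hd ys"
  shows "th (xs @ tl ys) (xs' @ tl ys')" "tp (xs @ tl ys)"
proof -
  have t: "tp xs'" "tp ys'" using th_tp assms by blast+
  have e: "hd ys' = hd ys" "last xs' = last xs" using th_hd th_last assms by blast+
  have ne: "xs \<noteq> []" "ys \<noteq> []" "xs' \<noteq> []" "ys' \<noteq> []" using assms t by auto
  \<comment> \<open>The common point may be counted with either factor; counting it with the second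
    one lets the second homotopy act in context.\<close>
  have eq: "zs @ tl ws = butlast zs @ ws" if "zs \<noteq> []" "ws \<noteq> []" "last zs = hd ws" for zs ws :: "'a list"
    using that by (metis append_butlast_last_id append.assoc append_Cons append_Nil list.collapse)
  have tpj: "tp (zs @ tl ws)" if "tp zs" "tp ws" "last zs = hd ws" for zs ws
  proof (cases "tl ws = []")
    case False
    moreover have "ws \<noteq> []" "zs \<noteq> []" using that by auto
    ultimately show ?thesis using that
      by (cases ws; cases "tl ws") (auto simp: tp_append)
  qed (use that in simp)
  show tpx: "tp (xs @ tl ys)" using tpj assms by blast
  have "th ([] @ xs @ tl ys) ([] @ xs' @ tl ys)"
    by (rule th_context) (use assms tpx in auto)
  moreover have "th (butlast xs' @ ys @ []) (butlast xs' @ ys' @ [])"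
    by (rule th_context) (use assms e ne t tpj[of xs' ys] eq[of xs' ys] in auto)
  ultimately show "th (xs @ tl ys) (xs' @ tl ys')"
    using eq[of xs' ys] eq[of xs' ys'] e ne assms th_trans by auto
qed

text \<open>A chord from the first point is at most the number of unit steps below it, hence at most
  \<theta>, so each new point is absorbed by a triangle.\<close>

lemma th_collapse_steps:
  assumes "\<And>i. Suc i < length zs \<Longrightarrow> \<rho> (zs ! i) (zs ! Suc i) \<le> 1" "real (length zs - 1) \<le> \<theta>"
    "zs \<noteq> []" "1 \<le> \<theta>"
  shows "th zs [hd zs, last zs] \<and> \<rho> (hd zs) (last zs) \<le> real (length zs - 1)"
  using assms
proof (induction zs rule: rev_induct)
  case (snoc z zs)
  show ?case
  proof (cases "zs = []")
    case True
    then show ?thesis using th_dup[of "[]" z "[]"] by simp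
  next
    case False
    have "\<rho> (zs ! i) (zs ! Suc i) \<le> 1" if "Suc i < length zs" for i
      using snoc.prems(1)[of i] that by (simp add: nth_append)
    then have IH: "th zs [hd zs, last zs] \<and> \<rho> (hd zs) (last zs) \<le> real (length zs - 1)"
      using snoc.prems(2,4) False by (intro snoc.IH) auto
    then have IH: "th zs [hd zs, last zs]" "\<rho> (hd zs) (last zs) \<le> real (length zs - 1)"
      using IH by auto
    have lz: "\<rho> (last zs) z \<le> 1"
      using snoc.prems(1)[of "length zs - 1"] False by (simp add: nth_append last_conv_nth)
    have hz: "\<rho> (hd zs) z \<le> real (length zs)"
      using IH(2) lz rho_triangle[of "hd zs" z "last zs"] False by (simp add: of_nat_diff Suc_leI)
    have t: "tp [hd zs, last zs]" using IH(2) snoc.prems(2) by simp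
    have "tp zs" using th_tp[OF th_sym[OF IH(1)] t] .
    have "th ([] @ zs @ [z]) ([] @ [hd zs, last zs] @ [z])"
      by (rule th_context[OF IH(1) \<open>tp zs\<close>])
         (use \<open>tp zs\<close> False lz snoc.prems in \<open>auto simp: tp_append\<close>)
    also have "th ([] @ [hd zs, last zs] @ [z]) [hd zs, z]"
      using th_triangle_local[of "hd zs" "last zs" z] t lz hz snoc.prems(2,4) by simp
    finally show ?thesis using False hz by simp
  qed
qed simp

end

section \<open>Homotopy invariants of discrete paths\<close>

text \<open>A monotone map that skips a value never returns to it, contrary to surjectivity.\<close>

lemma lazification_step:
  assumes "mono_on {..<m::nat} f" "f ` {..<m} = {..<n::nat}" "Suc i < m"
  shows "f (Suc i) = f i \<or> f (Suc i) = Suc (f i)"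
proof (rule ccontr)
  assume "\<not> ?thesis"
  moreover have "f i \<le> f (Suc i)" using assms by (intro mono_onD[OF assms(1)]) auto
  ultimately have *: "Suc (f i) < f (Suc i)" by linarith
  have "f (Suc i) \<in> {..<n}" using assms by blast
  then have "Suc (f i) \<in> f ` {..<m}" using * assms(2) by simp
  then obtain k where k: "k < m" "f k = Suc (f i)" by auto
  show False
  proof (cases "k \<le> i")
    case True
    then show ?thesis using mono_onD[OF assms(1), of k i] k assms(3) by simp
  next
    case False
    then show ?thesis using mono_onD[OF assms(1), of "Suc i" k] k * assms(3) by simp
  qed
qed

lemma (in discrete_paths) tp_lazification:
  assumes "lazification xs ys" "tp xs" "ys \<noteq> []" shows "tp ys"
proof -
  obtain f where f: "mono_on {..<length ys} f" "f ` {..<length ys} = {..<length xs}"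
    "\<And>i. i < length ys \<Longrightarrow> ys ! i = xs ! f i" using assms(1) by (auto simp: lazification_def)
  have "\<rho> (ys ! i) (ys ! Suc i) \<le> \<theta>" if "Suc i < length ys" for i
  proof -
    have "f (Suc i) \<in> {..<length xs}" using f(2) that by blast
    then show ?thesis
      using lazification_step[OF f(1,2) that] f(3)[of i] f(3)[of "Suc i"] that assms(2) theta_nonneg
      by (auto simp: theta_path_def)
  qed
  then show ?thesis using assms(3) by (simp add: theta_path_def)
qed

lemma (in discrete_paths) tp_if_unit_steps:
  assumes "\<And>i. Suc i < length zs \<Longrightarrow> \<rho> (zs ! i) (zs ! Suc i) \<le> 1" "1 \<le> \<theta>" "zs \<noteq> []"
  shows "tp zs"
  using assms unfolding theta_path_def by (auto intro: order_trans)

text \<open>A discrete local system: \<open>M\<close> is parallel transport along a \<theta>-step,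
  with trivial holonomy around squares. Triangles and backtracking are degenerate squares, one side
  being a pair of equal points.\<close>

locale discrete_invariant = discrete_paths \<rho> \<theta> + Q: group Q
  for \<rho> :: "'a \<Rightarrow> 'a \<Rightarrow> real" and \<theta> and Q :: "('q, 'm) monoid_scheme" (structure) +
  fixes M :: "'a \<Rightarrow> 'a \<Rightarrow> 'q"
  assumes M_closed: "\<rho> x y \<le> \<theta> \<Longrightarrow> M x y \<in> carrier Q"
    and M_self: "M x x = \<one>"
    and M_square: "\<rho> a b \<le> \<theta> \<Longrightarrow> \<rho> b c \<le> \<theta> \<Longrightarrow> \<rho> a d \<le> \<theta> \<Longrightarrow> \<rho> d c \<le> \<theta> \<Longrightarrow>
      M a b \<otimes> M b c = M a d \<otimes> M d c"
begin

primrec partial_product :: "'a list \<Rightarrow> nat \<Rightarrow> 'q" where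
  "partial_product zs 0 = \<one>"
| "partial_product zs (Suc j) = partial_product zs j \<otimes> M (zs ! j) (zs ! Suc j)"

definition mu :: "'a list \<Rightarrow> 'q" where
  "mu zs = partial_product zs (length zs - 1)"

lemma partial_product_closed: "tp zs \<Longrightarrow> j < length zs \<Longrightarrow> partial_product zs j \<in> carrier Q"
  by (induction j) (auto simp: theta_path_def intro!: M_closed)

lemma partial_product_append: "j < length zs \<Longrightarrow> partial_product (zs @ ws) j = partial_product zs j"
  by (induction j) (auto simp: nth_append)

lemma mu_singleton [simp]: "mu [z] = \<one>"
  by (simp add: mu_def)

lemma mu_snoc: "zs \<noteq> [] \<Longrightarrow> mu (zs @ [z]) = mu zs \<otimes> M (last zs) z"
  by (cases "length zs") (auto simp: mu_def partial_product_append nth_append last_conv_nth)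

lemma mu_lazification:
  assumes "lazification xs ys" "tp xs" "tp ys" shows "mu ys = mu xs"
proof -
  obtain f where f: "mono_on {..<length ys} f" "f ` {..<length ys} = {..<length xs}"
    "\<And>i. i < length ys \<Longrightarrow> ys ! i = xs ! f i" using assms(1) by (auto simp: lazification_def)
  have ne: "xs \<noteq> []" "ys \<noteq> []" using assms tp_ne by auto
  have lt: "f i < length xs" if "i < length ys" for i using f(2) that by auto
  have "0 \<in> f ` {..<length ys}" "length xs - 1 \<in> f ` {..<length ys}" using f(2) ne by auto
  then obtain i j where i: "i < length ys" "f i = 0" and j: "j < length ys" "f j = length xs - 1"
    by fastforce
  have f0: "f 0 = 0" using mono_onD[OF f(1), of 0 i] i ne by auto
  have "f j \<le> f (length ys - 1)" by (rule mono_onD[OF f(1)]) (use j in auto)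
  then have fl: "f (length ys - 1) = length xs - 1" using j lt[of "length ys - 1"] ne by simp
  \<comment> \<open>A lazification only inserts factors \<open>M x x\<close>, so the product up to
    \<open>k\<close> is the original product up to \<open>f k\<close>.\<close>
  have "partial_product ys k = partial_product xs (f k)" if "k < length ys" for k
    using that
  proof (induction k)
    case (Suc k)
    have eq: "partial_product ys k = partial_product xs (f k)" using Suc by simp
    have c: "partial_product xs (f k) \<in> carrier Q"
      using partial_product_closed[OF assms(2)] lt Suc.prems by simp
    show ?case
      using lazification_step[OF f(1,2) Suc.prems]
    proof
      assume "f (Suc k) = f k"
      then show ?thesis using eq c f(3) Suc.prems by (simp add: M_self)
    next
      assume "f (Suc k) = Suc (f k)"
      then show ?thesis using eq f(3) Suc.prems by simp
    qed
  qed (simp add: f0)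
  then show ?thesis using fl ne by (simp add: mu_def)
qed

lemma mu_close:
  assumes "pointwise_close xs ys" shows "mu xs = mu ys"
proof -
  have tp: "tp xs" "tp ys" and len: "length xs = length ys"
    and le: "\<And>i. i < length xs \<Longrightarrow> \<rho> (xs ! i) (ys ! i) \<le> \<theta>"
    and ends: "hd xs = hd ys" "last xs = last ys"
    using assms by (auto simp: pointwise_close_def list_all2_conv_all_nth)
  have ne: "xs \<noteq> []" "ys \<noteq> []" using tp tp_ne by auto
  \<comment> \<open>Sweep the ladder between the two rows: going along the first row and down the
    rung at \<open>i\<close> equals going along the second row. Each step is one square, and the
    rungs at both ends are trivial.\<close>
  have "partial_product xs i \<otimes> M (xs ! i) (ys ! i) = partial_product ys i" if "i < length xs" for i
    using that
  proof (induction i)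
    case 0
    then show ?case using ends ne by (simp add: hd_conv_nth M_self)
  next
    case (Suc i)
    have s: "\<rho> (xs ! i) (xs ! Suc i) \<le> \<theta>" "\<rho> (ys ! i) (ys ! Suc i) \<le> \<theta>"
      using tp Suc.prems len by (auto simp: theta_path_def)
    have c: "partial_product xs i \<in> carrier Q" using partial_product_closed tp Suc.prems by simp
    have "partial_product xs (Suc i) \<otimes> M (xs ! Suc i) (ys ! Suc i)
        = partial_product xs i \<otimes> (M (xs ! i) (xs ! Suc i) \<otimes> M (xs ! Suc i) (ys ! Suc i))"
      using c M_closed s le Suc.prems by (simp add: Q.m_assoc)
    also have "\<dots> = partial_product xs i \<otimes> (M (xs ! i) (ys ! i) \<otimes> M (ys ! i) (ys ! Suc i))"
      using M_square[of "xs ! i" "xs ! Suc i" "ys ! Suc i" "ys ! i"] s le Suc.prems by simp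
    also have "\<dots> = partial_product ys (Suc i)"
      using c M_closed s le Suc by (simp add: Q.m_assoc[symmetric])
    finally show ?case .
  qed
  from this[of "length xs - 1"] show ?thesis
    using ends ne len partial_product_closed[OF tp(1), of "length xs - 1"]
    by (simp add: mu_def last_conv_nth M_self)
qed

lemma mu_th:
  assumes "th xs ys" "tp xs" shows "mu xs = mu ys"
proof -
  have "(tp xs \<longleftrightarrow> tp ys) \<and> (tp xs \<longrightarrow> mu xs = mu ys)"
    using assms(1)
  proof (induction rule: th_induct)
    case (lazy xs ys) then show ?case using mu_lazification by simp
  next
    case (close xs ys) then show ?case using mu_close by (simp add: pointwise_close_def)
  qed auto
  then show ?thesis using assms by simp
qed

end

section \<open>Discretising continuous paths\<close>

definition upath :: "nat \<Rightarrow> (real \<Rightarrow> 'a) \<Rightarrow> 'a list" where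
  "upath N c = map (\<lambda>i. c (real i / real N)) [0..<Suc N]"

lemma length_upath [simp]: "length (upath N c) = Suc N"
  by (simp add: upath_def)

lemma upath_ne [simp]: "upath N c \<noteq> []"
  by (metis length_0_conv length_upath nat.distinct(1))

lemma nth_upath [simp]: "i \<le> N \<Longrightarrow> upath N c ! i = c (real i / real N)"
  unfolding upath_def by (simp del: upt_Suc)

lemma hd_upath [simp]: "hd (upath N c) = pathstart c"
  by (simp add: hd_conv_nth pathstart_def)

lemma last_upath [simp]: "0 < N \<Longrightarrow> last (upath N c) = pathfinish c"
  by (simp add: last_conv_nth pathfinish_def)

text \<open>\<open>+++\<close> runs through each factor at double speed, so mesh 1/(2N) on the
  concatenation is mesh 1/N on each factor.\<close>

lemma upath_join:
  assumes "0 < N" "pathfinish c = pathstart c'"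
  shows "upath (2 * N) (c +++ c') = upath N c @ tl (upath N c')"
proof (rule nth_equalityI)
  fix i assume "i < length (upath (2 * N) (c +++ c'))"
  then have i: "i \<le> 2 * N" by simp
  show "upath (2 * N) (c +++ c') ! i = (upath N c @ tl (upath N c')) ! i"
  proof (cases "i \<le> N")
    case True
    then show ?thesis using assms i by (simp add: nth_append joinpaths_def field_simps)
  next
    case False
    then have "\<not> real i / real (2 * N) \<le> 1 / 2" using assms by (simp add: field_simps)
    moreover have "2 * (real i / real (2 * N)) - 1 = real (i - N) / real N"
      using False assms i by (simp add: field_simps of_nat_diff)
    ultimately show ?thesis
      using False i assms by (simp add: nth_append joinpaths_def nth_tl Suc_diff_Suc)
  qed
qed (use assms in simp)

text \<open>Building homotopies takes only upper bounds on the metric, so \<open>\<rho>\<close> is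
  here any admissible metric; that the warped metric is the greatest one enters later, when steps
  are subdivided.\<close>

locale warped_scale = warped_base S \<alpha> x0
  for S :: "('a::metric_space \<Rightarrow> 'a) set" and \<alpha> :: "('a \<Rightarrow> 'a) \<Rightarrow> real \<Rightarrow> 'a" and x0 :: 'a +
  fixes \<rho> :: "'a \<Rightarrow> 'a \<Rightarrow> real" and t :: real and n\<theta> :: nat
  assumes rho_metric: "Metric_space UNIV \<rho>"
    and rho_le_dist: "\<rho> x y \<le> t * dist x y"
    and rho_jump: "s \<in> S \<Longrightarrow> \<rho> x (s x) \<le> 1"
    and t_pos: "0 < t" and theta_ge_1: "1 \<le> n\<theta>"
begin

abbreviation \<theta> :: real where "\<theta> \<equiv> real n\<theta>"

sublocale discrete_paths \<rho> "real n\<theta>"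
  by (rule discrete_paths.intro) (rule rho_metric, simp)

lemma rho_letter:
  assumes "l \<in> S \<times> UNIV" shows "\<rho> x (letter_act l x) \<le> 1"
proof (cases "snd l")
  case True
  then show ?thesis using assms rho_jump[of "fst l" x] by (auto simp: letter_act_def)
next
  case False
  then have "letter_act (letter_inv l) = fst l" by (simp add: letter_act_def letter_inv_def)
  then show ?thesis
    using assms letter_act_inv(2)[of "letter_inv l" x] rho_jump[of "fst l" "letter_act l x"]
      letter_act_inv(2)[OF assms] letter_act_inv(1)[of "letter_inv l" x]
    by (auto simp: rho_commute letter_inv_mem)
qed

lemma rho_letter_le: "l \<in> S \<times> UNIV \<Longrightarrow> \<rho> x (letter_act l x) \<le> \<theta>"
  using rho_letter[of l x] theta_ge_1 by simp

lemma rho_letter_le': "l \<in> S \<times> UNIV \<Longrightarrow> \<rho> (letter_act l x) x \<le> \<theta>"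
  using rho_letter_le by (simp add: rho_commute)

lemma jump_back_append:
  "jump_back (u @ v) y = jump_back u y @ jump_back v (word_act (word_inv u) y)"
  by (induction u arbitrary: y) auto

lemma last_jump_back: "last (y # jump_back w y) = word_act (word_inv w) y"
  by (induction w arbitrary: y) auto

lemma jump_back_steps:
  assumes "wd w" "Suc i < length (y # jump_back w y)"
  shows "\<rho> ((y # jump_back w y) ! i) ((y # jump_back w y) ! Suc i) \<le> 1"
  using assms
proof (induction w arbitrary: y i)
  case (Cons l w)
  then show ?case
    using rho_letter[of "letter_inv l" y] Cons.IH[of "i - 1" "letter_act (letter_inv l) y"]
    by (cases i) (auto simp: letter_inv_mem)
qed simp

lemma tp_jump_back: "wd w \<Longrightarrow> tp (y # jump_back w y)"
  using jump_back_steps[of w _ y] theta_ge_1 by (intro tp_if_unit_steps) simp_all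

lemma length_jump_back [simp]: "length (jump_back w y) = length w"
  by (induction w arbitrary: y) auto

lemma tp_append_jump_back:
  assumes "tp zs" "wd w" "last zs = y" shows "tp (zs @ jump_back w y)"
  using th_append_tl(2)[OF th_refl th_refl assms(1) tp_jump_back[OF assms(2)], of y] assms by simp

text \<open>Cancelling two adjacent letters of the word removes a backtrack from the discrete
  path.\<close>

lemma jump_back_reduce:
  assumes "wd w" shows "th (y # jump_back w y) (y # jump_back (reduce_word w) y)"
  using assms
proof (induction w arbitrary: y)
  case (Cons l w)
  define z where "z = letter_act (letter_inv l) y"
  have l: "l \<in> S \<times> UNIV" "letter_inv l \<in> S \<times> UNIV" "wd w" using Cons.prems by (auto simp: letter_inv_mem)
  have "th (y # z # jump_back w z) (y # z # jump_back (reduce_word w) z)"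
    using th_context[OF Cons.IH[OF l(3), of z] tp_jump_back[OF l(3)], of "[y]" "[]"]
      tp_jump_back[OF Cons.prems, of y] by (simp add: z_def)
  also have "th (y # z # jump_back (reduce_word w) z) (y # jump_back (reduce_word (l # w)) y)"
  proof (cases "\<exists>v. reduce_word w = letter_inv l # v")
    case True
    then obtain v where v: "reduce_word w = letter_inv l # v" by blast
    have "letter_act l z = y" using l by (simp add: z_def)
    then have "th (y # z # y # jump_back v y) (y # jump_back v y)"
      using th_backtrack[of "[]" y z "jump_back v y"] tp_jump_back[of "l # reduce_word w" y]
        l wd_reduce_word[OF l(3)] v by (simp add: z_def)
    then show ?thesis using v \<open>letter_act l z = y\<close> by (simp add: reduce_word_onto)
  next
    case False
    then have "cons_cancel l (reduce_word w) = l # reduce_word w" by (cases "reduce_word w") auto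
    then show ?thesis by (simp add: reduce_word_onto z_def)
  qed
  finally show ?case by (simp add: z_def)
qed (simp add: reduce_word_onto)

text \<open>Cut the unit steps into \<open>k\<close> blocks of at most \<open>n\<theta>\<close> and
  collapse each block. Exhausted blocks give constant steps, so the number of new points is exactly
  \<open>k\<close>.\<close>

lemma unit_steps_coarsen:
  assumes "\<And>i. Suc i < length (z # r) \<Longrightarrow> \<rho> ((z # r) ! i) ((z # r) ! Suc i) \<le> 1"
    "length r \<le> k * n\<theta>"
  shows "\<exists>qs. length qs = k \<and> th (z # r) (z # qs)"
  using assms
proof (induction k arbitrary: z r)
  case (Suc k)
  define a where "a = z # take n\<theta> r"
  define b where "b = drop n\<theta> r"
  have zr: "z # r = a @ b" by (simp add: a_def b_def)
  have a: "th a [z, last a]" "\<rho> z (last a) \<le> real (length a - 1)"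
  proof -
    have "\<rho> (a ! i) (a ! Suc i) \<le> 1" if "Suc i < length a" for i
      using Suc.prems(1)[of i] that unfolding zr by (simp add: nth_append)
    then have "th a [hd a, last a] \<and> \<rho> (hd a) (last a) \<le> real (length a - 1)"
      using theta_ge_1 by (intro th_collapse_steps) (auto simp: a_def)
    then show "th a [z, last a]" "\<rho> z (last a) \<le> real (length a - 1)" by (auto simp: a_def)
  qed
  have zl: "\<rho> z (last a) \<le> \<theta>"
  proof -
    have "length a - 1 \<le> n\<theta>" by (simp add: a_def)
    then show ?thesis using a(2) by linarith
  qed
  have ia: "length a > 0" "a ! (length a - 1) = last a" by (simp_all add: a_def last_conv_nth)
  have "\<rho> ((last a # b) ! i) ((last a # b) ! Suc i) \<le> 1" if "Suc i < length (last a # b)" for i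
    using Suc.prems(1)[of "length a - 1 + i"] that ia unfolding zr
    by (cases i) (simp_all add: nth_append)
  moreover have "length b \<le> k * n\<theta>" using Suc.prems(2) by (simp add: b_def)
  ultimately obtain qs where qs: "length qs = k" "th (last a # b) (last a # qs)"
    using Suc.IH[of "last a" b] by blast
  have tpa: "tp a" using th_tp[OF th_sym[OF a(1)]] zl by simp
  have tpzr: "tp (z # r)"
    using Suc.prems(1) theta_ge_1 by (intro tp_if_unit_steps) simp_all
  have 1: "th (z # r) (z # last a # b)"
    using th_context[OF a(1) tpa, of "[]" b] tpzr unfolding zr by simp
  have 2: "tp (z # last a # b)" using th_tp[OF 1 tpzr] .
  then have "th (z # last a # b) (z # last a # qs)"
    using th_context[OF qs(2), of "[z]" "[]"] by simp
  with 1 have "th (z # r) (z # last a # qs)" by (rule th_trans)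
  then show ?case using qs(1) by (intro exI[of _ "last a # qs"]) simp
qed simp

text \<open>The four coarse steps run around a square with corners \<open>x\<close>,
  \<open>q1\<close>, \<open>q2\<close>, \<open>q3\<close>. Replacing \<open>q1\<close> by the
  opposite corner \<open>q3\<close> leaves a path that only backtracks.\<close>

lemma jump_loop_null:
  assumes "wd w" "length w \<le> 4 * n\<theta>" "word_act w x = x"
  shows "th (x # jump_back w x) [x]"
proof -
  obtain qs where qs: "length qs = 4" "th (x # jump_back w x) (x # qs)"
    using unit_steps_coarsen[of x "jump_back w x" 4] jump_back_steps[OF assms(1), of _ x] assms(2)
    by auto
  then obtain q1 q2 q3 q4 where q: "qs = [q1, q2, q3, q4]"
    by (auto simp: numeral_eq_Suc length_Suc_conv)
  have tp: "tp (x # jump_back w x)" by (rule tp_jump_back[OF assms(1)])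
  have "q4 = x"
    using th_last[OF qs(2) tp] word_act_inv(2)[OF assms(1), of x]
    unfolding last_jump_back q assms(3) by simp
  then have l: "th (x # jump_back w x) [x, q1, q2, q3, x]" using qs q by simp
  have tpq: "tp [x, q1, q2, q3, x]" using th_tp[OF l tp] .
  have "th [x, q1, q2, q3, x] [x, q3, q2, q3, x]"
    using th_square[of "[]" x q1 q2 "[q3, x]" q3] tpq by (simp add: rho_commute)
  also have "th [x, q3, q2, q3, x] [x, q3, x]"
    using th_backtrack[of "[x]" q3 q2 "[x]"] tpq by (simp add: rho_commute)
  also have "th [x, q3, x] [x]"
    using th_backtrack[of "[]" x q3 "[]"] tpq by (simp add: rho_commute)
  finally show ?thesis using l th_trans by blast
qed

end

context warped_scale
begin

section \<open>Uniform discretisations of continuous paths\<close>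

definition fine_mesh :: "nat \<Rightarrow> (real \<Rightarrow> 'a) \<Rightarrow> bool" where
  "fine_mesh N c \<longleftrightarrow> 0 < N \<and> (\<forall>u\<in>{0..1}. \<forall>v\<in>{0..1}. \<bar>u - v\<bar> \<le> 1 / real N \<longrightarrow> t * dist (c u) (c v) \<le> \<theta>)"

lemma eventually_inverse_less: "0 < e \<Longrightarrow> \<forall>\<^sub>F N in sequentially. 0 < N \<and> 1 / real N < e"
proof -
  assume "0 < e"
  then obtain n where n: "1 / real (Suc n) < e" using nat_approx_posE by blast
  have "0 < N \<and> 1 / real N < e" if "N \<ge> Suc n" for N
  proof -
    have "1 / real N \<le> 1 / real (Suc n)" using that by (intro divide_left_mono) auto
    then show ?thesis using n that by linarith
  qed
  then show ?thesis unfolding eventually_sequentially by blast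
qed

lemma eventually_fine:
  assumes "path c" shows "\<forall>\<^sub>F N in sequentially. fine_mesh N c"
proof -
  have "uniformly_continuous_on {0..1} c"
    using assms by (simp add: path_def compact_uniformly_continuous)
  moreover have "0 < \<theta> / t" using t_pos theta_ge_1 by simp
  ultimately obtain d where d: "0 < d"
    "\<And>u v. u \<in> {0..1} \<Longrightarrow> v \<in> {0..1} \<Longrightarrow> dist v u < d \<Longrightarrow> dist (c v) (c u) < \<theta> / t"
    unfolding uniformly_continuous_on_def by metis
  show ?thesis
    using eventually_inverse_less[OF d(1)]
  proof eventually_elim
    case (elim N)
    have "t * dist (c u) (c v) \<le> \<theta>" if "u \<in> {0..1}" "v \<in> {0..1}" "\<bar>u - v\<bar> \<le> 1 / real N" for u v
    proof -
      have "dist (c u) (c v) < \<theta> / t"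
        using d(2)[of v u] that elim by (simp add: dist_real_def)
      then show ?thesis using t_pos by (simp add: field_simps)
    qed
    then show ?case using elim by (simp add: fine_mesh_def)
  qed
qed

lemma tp_upath: "fine_mesh N c \<Longrightarrow> tp (upath N c)"
  unfolding theta_path_def
proof (intro conjI allI impI)
  fix i assume f: "fine_mesh N c" and "Suc i < length (upath N c)"
  then have i: "i < N" by simp
  have "t * dist (c (real i / real N)) (c (real (Suc i) / real N)) \<le> \<theta>"
  proof -
    have "real (Suc i) \<le> real N" using i by simp
    then have "real i / real N \<in> {0..1}" "real (Suc i) / real N \<in> {0..1}"
      "\<bar>real i / real N - real (Suc i) / real N\<bar> \<le> 1 / real N"
      using i by (auto simp: field_simps)
    then show ?thesis using f unfolding fine_mesh_def by blast
  qed
  then show "\<rho> (upath N c ! i) (upath N c ! Suc i) \<le> \<theta>"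
    using rho_le_dist[of "c (real i / real N)" "c (real (Suc i) / real N)"] i
    by (simp del: of_nat_Suc)
qed simp

lemma discretisation_upath:
  assumes "fine_mesh N c" shows "discretisation t \<theta> c (upath N c)"
proof -
  define \<tau> where "\<tau> = map (\<lambda>i. real i / real N) [0..<Suc N]"
  have N: "0 < N" using assms by (simp add: fine_mesh_def)
  have len: "length \<tau> = Suc N" by (simp add: \<tau>_def)
  have nth: "\<tau> ! i = real i / real N" if "i \<le> N" for i
    using that unfolding \<tau>_def by (simp del: upt_Suc)
  have ne: "\<tau> \<noteq> []" using len by auto
  have "sorted_wrt (<) \<tau>"
    using N by (auto simp: sorted_wrt_iff_nth_less len nth divide_strict_right_mono)
  moreover have "hd \<tau> = 0" "last \<tau> = 1"
    using N ne by (simp_all add: hd_conv_nth last_conv_nth nth len)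
  moreover have "upath N c = map c \<tau>" by (simp add: upath_def \<tau>_def del: upt_Suc)
  moreover have "t * dist (c (\<tau> ! i)) (c u) \<le> \<theta>"
    if "Suc i < length \<tau>" "u \<in> {\<tau> ! i..\<tau> ! Suc i}" for i u
  proof -
    have "0 \<le> \<tau> ! i" "\<tau> ! Suc i \<le> 1" "\<tau> ! Suc i = \<tau> ! i + 1 / real N"
      using that N by (auto simp: len nth field_simps)
    then have "\<tau> ! i \<in> {0..1}" "u \<in> {0..1}" "\<bar>\<tau> ! i - u\<bar> \<le> 1 / real N"
      using that by auto
    then show ?thesis using assms unfolding fine_mesh_def by blast
  qed
  ultimately show ?thesis unfolding discretisation_def using ne by blast
qed

text \<open>The discretisation is lazified by sending \<open>i / N\<close> to the last time of the discretisation
  before it; the result is pointwise close to the uniform one.\<close>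

lemma discretisation_th_upath:
  assumes "discretisation t \<theta> c zs" "path c"
  shows "\<forall>\<^sub>F N in sequentially. th zs (upath N c)"
proof -
  obtain \<tau> where ne: "\<tau> \<noteq> []" and sorted: "sorted_wrt (<) \<tau>" and ends: "hd \<tau> = 0" "last \<tau> = 1"
    and zs: "zs = map c \<tau>"
    and close: "\<And>i u. Suc i < length \<tau> \<Longrightarrow> u \<in> {\<tau> ! i..\<tau> ! Suc i} \<Longrightarrow> t * dist (c (\<tau> ! i)) (c u) \<le> \<theta>"
    using assms(1) unfolding discretisation_def by auto
  define n where "n = length \<tau>"
  have n: "0 < n" using ne by (simp add: n_def)
  have first: "\<tau> ! 0 = 0" and final: "\<tau> ! (n - 1) = 1"
    using ends ne by (simp_all add: hd_conv_nth last_conv_nth n_def)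
  have less: "\<tau> ! i < \<tau> ! j" if "i < j" "j < n" for i j
    using sorted that by (simp add: sorted_wrt_iff_nth_less n_def)
  have le: "\<tau> ! i \<le> \<tau> ! j" if "i \<le> j" "j < n" for i j
    using less[of i j] that by (cases "i = j") auto
  have in01: "\<tau> ! i \<in> {0..1}" if "i < n" for i
    using le[of 0 i] le[of i "n - 1"] that first final by auto
  have tpz: "tp zs" unfolding theta_path_def
  proof (intro conjI allI impI)
    fix i assume "Suc i < length zs"
    then have i: "Suc i < length \<tau>" by (simp add: zs)
    then have "t * dist (c (\<tau> ! i)) (c (\<tau> ! Suc i)) \<le> \<theta>"
      using close[OF i, of "\<tau> ! Suc i"] le[of i "Suc i"] by (simp add: n_def)
    then show "\<rho> (zs ! i) (zs ! Suc i) \<le> \<theta>"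
      using rho_le_dist[of "c (\<tau> ! i)" "c (\<tau> ! Suc i)"] i by (simp add: zs)
  qed (simp add: zs ne)
  have "\<forall>\<^sub>F N in sequentially. \<forall>i\<in>{..<n - 1}. 0 < N \<and> 1 / real N < \<tau> ! Suc i - \<tau> ! i"
    by (intro eventually_ball_finite ballI eventually_inverse_less) (auto simp: less)
  then show ?thesis
    using eventually_fine[OF assms(2)]
  proof eventually_elim
    case (elim N)
    have N: "0 < N" using elim by (simp add: fine_mesh_def)
    define K where "K i = {k. k < n \<and> \<tau> ! k \<le> real i / real N}" for i
    define f where "f i = Max (K i)" for i
    have K: "finite (K i)" "0 \<in> K i" for i using n first by (auto simp: K_def)
    have fK: "f i \<in> K i" for i unfolding f_def using K by (intro Max_in) auto
    have fge: "k \<le> f i" if "k \<in> K i" for k i unfolding f_def using that K by (intro Max_ge)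
    have fn: "f i < n" "\<tau> ! f i \<le> real i / real N" for i using fK[of i] by (auto simp: K_def)
    have feq: "f i = k" if "k < n" "\<tau> ! k \<le> real i / real N" "Suc k < n \<Longrightarrow> real i / real N < \<tau> ! Suc k" for i k
    proof (rule antisym)
      show "k \<le> f i" using that by (intro fge) (simp add: K_def)
      show "f i \<le> k"
      proof (rule ccontr)
        assume "\<not> f i \<le> k"
        then have "Suc k \<le> f i" by simp
        then have "\<tau> ! Suc k \<le> \<tau> ! f i" using fn by (intro le) auto
        then show False using that(3) fn[of i] \<open>Suc k \<le> f i\<close> by force
      qed
    qed
    define ys where "ys = map (\<lambda>i. c (\<tau> ! f i)) [0..<Suc N]"
    have leny: "length ys = Suc N" by (simp add: ys_def)
    have nthy: "ys ! i = c (\<tau> ! f i)" if "i \<le> N" for i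
      using that unfolding ys_def by (simp del: upt_Suc)
    have "mono_on {..<length ys} f"
    proof (rule mono_onI)
      fix r s :: nat assume "r \<le> s"
      then have "real r / real N \<le> real s / real N" by (simp add: divide_right_mono)
      then show "f r \<le> f s" using fn[of r] by (intro fge) (auto simp: K_def)
    qed
    moreover have "f ` {..<length ys} = {..<length zs}"
    proof
      show "f ` {..<length ys} \<subseteq> {..<length zs}" using fn by (auto simp: zs n_def)
      show "{..<length zs} \<subseteq> f ` {..<length ys}"
      proof
        fix k assume "k \<in> {..<length zs}"
        then have k: "k < n" by (simp add: zs n_def)
        show "k \<in> f ` {..<length ys}"
        \<comment> \<open>\<open>N\<close> is so large that every gap of \<open>\<tau>\<close>
          exceeds 1/N, so rounding the time of \<open>k\<close> up to the grid stays before the next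
          time and \<open>k\<close> is hit. The last index is hit at \<open>N\<close>
          itself.\<close>
        proof (cases "Suc k < n")
          case True
          define i where "i = nat \<lceil>\<tau> ! k * real N\<rceil>"
          have k0: "0 \<le> \<tau> ! k * real N" using in01[OF k] by simp
          have i1: "\<tau> ! k * real N \<le> real i" and i2: "real i < \<tau> ! k * real N + 1"
            using k0 unfolding i_def by (simp_all add: ceiling_correct le_of_int_ceiling of_nat_nat)
              linarith+
          have gap: "1 / real N < \<tau> ! Suc k - \<tau> ! k" using elim(1) True by simp
          have a: "\<tau> ! k \<le> real i / real N" using i1 N by (simp add: field_simps)
          have "real i / real N < \<tau> ! k + 1 / real N" using i2 N by (simp add: field_simps)
          then have b: "real i / real N < \<tau> ! Suc k" using gap by linarith
          then have "real i / real N < 1" using in01[OF True] by auto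
          then have "i < Suc N" using N by (simp add: field_simps)
          moreover have "f i = k" using k a b by (rule feq)
          ultimately show ?thesis using leny by force
        next
          case False
          then have "k = n - 1" using k by simp
          then have "f N = k" using k N final by (intro feq) auto
          then show ?thesis using leny by force
        qed
      qed
    qed
    moreover have "ys ! i = zs ! f i" if "i < length ys" for i
      using that fn[of i] leny by (simp add: nthy zs n_def)
    ultimately have lazy: "lazification zs ys" unfolding lazification_def by blast
    have yne: "ys \<noteq> []" using leny by auto
    have tpy: "tp ys" using tp_lazification[OF lazy tpz yne] .
    have "\<rho> (c (\<tau> ! f i)) (c (real i / real N)) \<le> \<theta>" if "i \<le> N" for i
    proof (cases "Suc (f i) < n")
      case True
      have "\<not> \<tau> ! Suc (f i) \<le> real i / real N"
        using fge[of "Suc (f i)" i] True by (auto simp: K_def)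
      then have "t * dist (c (\<tau> ! f i)) (c (real i / real N)) \<le> \<theta>"
        using True fn[of i] by (intro close) (auto simp: n_def)
      then show ?thesis using rho_le_dist order_trans by blast
    next
      case False
      then have "f i = n - 1" using fn[of i] by linarith
      then have "1 \<le> real i / real N" using fn[of i] final by simp
      then have "real i / real N = 1" using that N by (simp add: field_simps)
      then show ?thesis using \<open>f i = n - 1\<close> final by simp
    qed
    then have "list_all2 (\<lambda>x y. \<rho> x y \<le> \<theta>) ys (upath N c)"
      using leny by (auto simp: list_all2_conv_all_nth nthy)
    moreover have "hd ys = hd (upath N c)" "last ys = last (upath N c)"
      using lazification_hd_last[OF lazy yne] ends N ne
      by (simp_all add: zs hd_map last_map pathstart_def pathfinish_def)
    ultimately have "pointwise_close ys (upath N c)"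
      using tpy tp_upath[OF elim(2)] by (simp add: pointwise_close_def)
    then show ?case using th_lazification[OF tpz tpy lazy] th_if_close th_trans by blast
  qed
qed

text \<open>Demanding all sufficiently fine meshes instead of one makes uniqueness immediate: two
  representatives of the same pair are compared on a common mesh.\<close>

definition repr :: "(real \<Rightarrow> 'a) \<Rightarrow> ('a \<Rightarrow> 'a) letter list \<Rightarrow> 'a list \<Rightarrow> bool" where
  "repr c w zs \<longleftrightarrow> (\<forall>\<^sub>F N in sequentially. th zs (upath N c @ jump_back w (pathfinish c)))"

lemma tp_upath_jump_back:
  "fine_mesh N c \<Longrightarrow> wd w \<Longrightarrow> tp (upath N c @ jump_back w (pathfinish c))"
  by (rule tp_append_jump_back[OF tp_upath]) (simp_all add: fine_mesh_def)

lemma repr_discretisation: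
  assumes "discretisation t \<theta> c zs" "path c" "wd w"
  shows "repr c w (zs @ jump_back w (pathfinish c))"
  unfolding repr_def
  using discretisation_th_upath[OF assms(1,2)] eventually_fine[OF assms(2)]
proof eventually_elim
  case (elim N)
  have "th ([] @ upath N c @ jump_back w (pathfinish c)) ([] @ zs @ jump_back w (pathfinish c))"
    using tp_upath[OF elim(2)] tp_upath_jump_back[OF elim(2) assms(3)]
    by (intro th_context th_sym[OF elim(1)]) simp_all
  then show ?case using th_sym by simp
qed

lemma repr_upath:
  assumes "fine_mesh N c" "path c" "wd w" shows "repr c w (upath N c @ jump_back w (pathfinish c))"
  using repr_discretisation discretisation_upath assms by blast

lemma repr_exists:
  assumes "path c" "wd w" shows "\<exists>zs. repr c w zs"
proof -
  obtain N where "fine_mesh N c" using eventually_happens[OF eventually_fine[OF assms(1)]] by auto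
  then show ?thesis using repr_upath assms by blast
qed

lemma repr_unique:
  assumes "repr c w zs" "repr c w zs'" shows "th zs zs'"
proof -
  have "\<forall>\<^sub>F N in sequentially. th zs zs'"
    using assms unfolding repr_def by eventually_elim (use th_sym th_trans in blast)
  then show ?thesis by simp
qed

lemma repr_th: "repr c w zs \<Longrightarrow> th zs zs' \<Longrightarrow> repr c w zs'"
  unfolding repr_def by (erule eventually_mono) (use th_sym th_trans in blast)

lemma repr_obtain:
  assumes "repr c w zs" "path c" "wd w"
  obtains N where "fine_mesh N c" "th zs (upath N c @ jump_back w (pathfinish c))"
proof -
  have "\<forall>\<^sub>F N in sequentially. fine_mesh N c \<and> th zs (upath N c @ jump_back w (pathfinish c))"
    using assms(1)[unfolded repr_def] eventually_fine[OF assms(2)] by eventually_elim simp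
  then show ?thesis using that eventually_happens by force
qed

lemma
  assumes "repr c w zs" "path c" "wd w"
  shows repr_tp: "tp zs" and repr_hd: "hd zs = pathstart c"
    and repr_last: "last zs = word_act (word_inv w) (pathfinish c)"
proof -
  obtain N where N: "fine_mesh N c" "th zs (upath N c @ jump_back w (pathfinish c))"
    using repr_obtain[OF assms] .
  note tp = tp_upath_jump_back[OF N(1) assms(3)]
  have th: "th (upath N c @ jump_back w (pathfinish c)) zs" using th_sym[OF N(2)] .
  show "tp zs" using th_tp[OF th tp] .
  show "hd zs = pathstart c" using th_hd[OF th tp] by simp
  have e: "last (upath N c @ jump_back w (pathfinish c)) = last (pathfinish c # jump_back w (pathfinish c))"
    using N(1) by (simp add: last_append fine_mesh_def)
  show "last zs = word_act (word_inv w) (pathfinish c)"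
    by (simp only: th_last[OF th tp] e last_jump_back)
qed

text \<open>By uniform continuity of the homotopy on the square, adjacent rows of an N by N grid are
  pointwise close once N is large.\<close>

lemma repr_homotopic:
  assumes "hpaths c c'" "repr c w zs" "wd w" shows "repr c' w zs"
proof -
  obtain h :: "real \<times> real \<Rightarrow> 'a" where h: "continuous_on ({0..1} \<times> {0..1}) h"
    and "\<forall>x\<in>{0..1}. h (0, x) = c x" "\<forall>x\<in>{0..1}. h (1, x) = c' x"
      "\<forall>s\<in>{0..1}. h (s, 0) = pathstart c \<and> h (s, 1) = pathfinish c"
    using assms(1) unfolding homotopic_paths by (auto simp: pathstart_def pathfinish_def)
  then have h0: "h (0, x) = c x" and h1: "h (1, x) = c' x"
    and hs: "h (x, 0) = pathstart c" and hf: "h (x, 1) = pathfinish c" if "x \<in> {0..1}" for x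
    using that by blast+
  note P = hpathsD[OF assms(1)]
  have "uniformly_continuous_on ({0..1} \<times> {0..1::real}) h"
    using h by (intro compact_uniformly_continuous compact_Times) auto
  moreover have "0 < \<theta> / t" using t_pos theta_ge_1 by simp
  ultimately obtain d where d: "0 < d"
    "\<And>p q. p \<in> {0..1} \<times> {0..1} \<Longrightarrow> q \<in> {0..1} \<times> {0..1} \<Longrightarrow> dist q p < d \<Longrightarrow> dist (h q) (h p) < \<theta> / t"
    unfolding uniformly_continuous_on_def by metis
  have "\<forall>\<^sub>F N in sequentially. th (upath N c) (upath N c')"
    using eventually_inverse_less[OF d(1)]
  proof eventually_elim
    case (elim N)
    have rho: "\<rho> (h q) (h p) \<le> \<theta>" if "p \<in> {0..1} \<times> {0..1}" "q \<in> {0..1} \<times> {0..1}" "dist q p < d" for p q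
    proof -
      have "t * dist (h q) (h p) \<le> \<theta>" using d(2)[OF that] t_pos by (simp add: field_simps)
      then show ?thesis using rho_le_dist order_trans by blast
    qed
    define row where "row j = upath N (\<lambda>x. h (real j / real N, x))" for j
    have I: "real i / real N \<in> {0..1}" if "i \<le> N" for i using that elim by (simp add: field_simps)
    have diff: "\<bar>real (Suc i) / real N - real i / real N\<bar> = 1 / real N" for i
      using elim by (simp add: field_simps)
    have tp: "tp (row j)" if "j \<le> N" for j
      unfolding theta_path_def
    proof (intro conjI allI impI)
      fix i assume "Suc i < length (row j)"
      then have i: "Suc i \<le> N" by (simp add: row_def)
      then show "\<rho> (row j ! i) (row j ! Suc i) \<le> \<theta>"
        using rho[of "(real j / real N, real (Suc i) / real N)" "(real j / real N, real i / real N)"]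
          I[of j] I[of i] I[of "Suc i"] that diff[of i] elim
        by (simp add: row_def dist_Pair_Pair dist_real_def abs_minus_commute del: of_nat_Suc)
    qed (simp add: row_def)
    have close: "pointwise_close (row j) (row (Suc j))" if "Suc j \<le> N" for j
    proof -
      have "\<rho> (row j ! i) (row (Suc j) ! i) \<le> \<theta>" if "i \<le> N" for i
        using rho[of "(real (Suc j) / real N, real i / real N)" "(real j / real N, real i / real N)"]
          I[of j] I[of i] I[of "Suc j"] that \<open>Suc j \<le> N\<close> diff[of j] elim
        by (simp add: row_def dist_Pair_Pair dist_real_def abs_minus_commute del: of_nat_Suc)
      moreover have "hd (row j) = hd (row (Suc j))" "last (row j) = last (row (Suc j))"
        using I[of j] I[of "Suc j"] that elim
        by (simp_all add: row_def hs hf pathstart_def pathfinish_def del: of_nat_Suc)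
      ultimately show ?thesis
        using tp[of j] tp[of "Suc j"] that
        by (auto simp: pointwise_close_def list_all2_conv_all_nth row_def)
    qed
    have "th (row 0) (row j)" if "j \<le> N" for j
      using that
    proof (induction j)
      case (Suc j)
      then show ?case using th_trans[OF _ th_if_close[OF close[OF Suc.prems]]] by simp
    qed simp
    moreover have "row 0 = upath N c" "row N = upath N c'"
      using I elim by (auto simp: row_def upath_def h0 h1 simp del: upt_Suc)
    ultimately show ?case by (metis order_refl)
  qed
  then show ?thesis
    unfolding repr_def
    using assms(2)[unfolded repr_def] eventually_fine[OF P(1)]
  proof eventually_elim
    case (elim N)
    have "th ([] @ upath N c @ jump_back w (pathfinish c)) ([] @ upath N c' @ jump_back w (pathfinish c))"
      using tp_upath[OF elim(3)] tp_upath_jump_back[OF elim(3) assms(3)]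
      by (intro th_context elim(1)) simp_all
    then show ?case using elim(2) th_trans P(4) by simp
  qed
qed

lemma repr_reduce:
  assumes "repr c w zs" "path c" "wd w" shows "repr c (reduce_word w) zs"
proof -
  obtain N where N: "fine_mesh N c" "th zs (upath N c @ jump_back w (pathfinish c))"
    using repr_obtain[OF assms] .
  have "th (upath N c @ tl (pathfinish c # jump_back w (pathfinish c)))
     (upath N c @ tl (pathfinish c # jump_back (reduce_word w) (pathfinish c)))"
    using N(1) tp_upath[OF N(1)]
    by (intro th_append_tl(1) th_refl jump_back_reduce assms tp_jump_back) (simp_all add: fine_mesh_def)
  then have "th (upath N c @ jump_back (reduce_word w) (pathfinish c)) zs"
    using N(2) th_sym th_trans by (metis list.sel(3))
  moreover have "repr c (reduce_word w) (upath N c @ jump_back (reduce_word w) (pathfinish c))"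
    using repr_upath[OF N(1) assms(2)] assms(3) by simp
  ultimately show ?thesis using repr_th by blast
qed

lemma tp_Cons: "zs \<noteq> [] \<Longrightarrow> tp (x # zs) \<longleftrightarrow> \<rho> x (hd zs) \<le> \<theta> \<and> tp zs"
  by (cases zs) auto

lemma tp_map_letter_snoc:
  assumes "l \<in> S \<times> UNIV" "tp (map (letter_act l) u)"
  shows "tp (map (letter_act l) u @ [last u])"
proof -
  have "u \<noteq> []" using tp_ne[OF assms(2)] by simp
  then show ?thesis
    using assms rho_letter_le'[OF assms(1), of "last u"] by (simp add: tp_append last_map)
qed

text \<open>Between \<open>u\<close> and its translate lies a strip of squares with rungs of length
  at most one; the jump slides along the strip, one square at a time.\<close>

lemma th_push_letter:
  assumes "l \<in> S \<times> UNIV" "tp u" "tp (map (letter_act l) u)"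
  shows "th (map (letter_act l) u @ [last u]) (letter_act l (hd u) # u)"
  using assms(2,3)
proof (induction u)
  case (Cons x u)
  show ?case
  proof (cases u)
    case (Cons y v)
    have tp: "tp (y # v)" "tp (map (letter_act l) (y # v))" "\<rho> x y \<le> \<theta>"
      "\<rho> (letter_act l x) (letter_act l y) \<le> \<theta>"
      using Cons.prems Cons by auto
    have IH: "th (map (letter_act l) (y # v) @ [last (y # v)]) (letter_act l y # y # v)"
      using Cons.IH tp Cons by simp
    have tp1: "tp (map (letter_act l) (y # v) @ [last (y # v)])"
      using tp_map_letter_snoc[OF assms(1) tp(2)] .
    have "th ([letter_act l x] @ (map (letter_act l) (y # v) @ [last (y # v)]) @ [])
        ([letter_act l x] @ (letter_act l y # y # v) @ [])"
      using tp tp1 by (intro th_context IH) simp_all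
    also have "th ([letter_act l x] @ (letter_act l y # y # v) @ []) (letter_act l x # x # y # v)"
      using th_square[of "[]" "letter_act l x" "letter_act l y" y v x] tp
        rho_letter_le'[OF assms(1)] by simp
    finally show ?thesis using Cons by simp
  qed simp
qed simp

text \<open>Jumps slide past a continuous path at the price of translating it. The mesh must be fine
  for the translate by every suffix of the word, which holds eventually.\<close>

lemma th_push_word:
  assumes "wd w" "path c"
  shows "\<forall>\<^sub>F N in sequentially. th (upath N (word_act w \<circ> c) @ jump_back w (word_act w (pathfinish c)))
     (word_act w (pathstart c) # jump_back w (word_act w (pathstart c)) @ tl (upath N c))"
  using assms(1)
proof (induction w)
  case Nil
  have "upath N c = pathstart c # tl (upath N c)" for N
    by (metis hd_upath list.collapse upath_ne)
  then show ?case by (simp add: comp_def)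
next
  case (Cons l w)
  then have l: "l \<in> S \<times> UNIV" and w: "wd w" by auto
  have p: "path (word_act w \<circ> c)" "path (word_act (l # w) \<circ> c)"
    using path_comp[OF assms(2)] continuous_word_act w Cons.prems by blast+
  show ?case
    using Cons.IH[OF w] eventually_fine[OF p(1)] eventually_fine[OF p(2)] eventually_fine[OF assms(2)]
  proof eventually_elim
    case (elim N)
    have N: "0 < N" using elim by (simp add: fine_mesh_def)
    let ?u = "upath N (word_act w \<circ> c)"
    have eq: "upath N (word_act (l # w) \<circ> c) = map (letter_act l) ?u"
      by (simp add: upath_def)
    have tpu: "tp ?u" "tp (map (letter_act l) ?u)" using tp_upath elim(2,3) eq by metis+
    have lu: "last ?u = word_act w (pathfinish c)" "hd ?u = word_act w (pathstart c)"
      using N by (simp_all add: pathfinish_compose pathstart_compose)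
    have tpl: "tp (map (letter_act l) ?u @ [last ?u])"
      using tp_map_letter_snoc[OF l tpu(2)] .
    have "th ((map (letter_act l) ?u @ [last ?u]) @ jump_back w (last ?u))
      ((letter_act l (hd ?u) # ?u) @ jump_back w (last ?u))"
      using th_context[OF th_push_letter[OF l tpu] tpl, of "[]" "jump_back w (last ?u)"]
        tp_append_jump_back[OF tpl w] by simp
    also have "th ((letter_act l (hd ?u) # ?u) @ jump_back w (last ?u))
      (letter_act l (hd ?u) # word_act w (pathstart c) # jump_back w (word_act w (pathstart c)) @ tl (upath N c))"
    proof -
      have tpj: "tp (?u @ jump_back w (last ?u))" by (rule tp_append_jump_back[OF tpu(1) w]) simp
      have "tp ([letter_act l (hd ?u)] @ (?u @ jump_back w (last ?u)) @ [])"
        using tpj rho_letter_le'[OF l, of "hd ?u"] by (simp add: tp_Cons)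
      from th_context[OF _ tpj this, of "word_act w (pathstart c) # jump_back w (word_act w (pathstart c)) @ tl (upath N c)"]
      show ?thesis using elim(1) lu by simp
    qed
    finally show ?case
      unfolding eq using lu l by simp
  qed
qed

text \<open>In \<open>zs @ tl zs'\<close> the jumps of \<open>w\<close> stand between the two paths.
  Sliding them past \<open>c'\<close> turns \<open>c'\<close> into its translate by \<open>w\<close>
  and collects all jumps at the end.\<close>

lemma repr_cmp:
  assumes "repr c w zs" "repr c' w' zs'" "path c" "path c'" "wd w" "wd w'"
    "pathfinish c = word_act w (pathstart c')"
  shows "repr (c +++ (word_act w \<circ> c')) (w @ w') (zs @ tl zs')"
proof -
  let ?d = "word_act w \<circ> c'"
  have pd: "path ?d" using path_comp assms continuous_word_act by blast
  have join: "pathfinish c = pathstart ?d" using assms(7) by (simp add: pathstart_compose)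
  have pj: "path (c +++ ?d)" using pd join assms(3) by simp
  \<comment> \<open>The concatenation is sampled with \<open>2 * N\<close> steps so that each factor
    gets \<open>N\<close>; its fineness is therefore wanted along even numbers.\<close>
  obtain N0 where N0: "\<And>N. N \<ge> N0 \<Longrightarrow> fine_mesh N (c +++ ?d)"
    using eventually_fine[OF pj] unfolding eventually_sequentially by blast
  have "\<forall>\<^sub>F N in sequentially. fine_mesh (2 * N) (c +++ ?d)"
    unfolding eventually_sequentially by (intro exI[of _ N0] allI impI N0) simp
  then have "\<forall>\<^sub>F N in sequentially. repr (c +++ ?d) (w @ w') (zs @ tl zs')"
    using eventually_fine[OF assms(3)] eventually_fine[OF assms(4)] eventually_fine[OF pd]
      assms(1)[unfolded repr_def] assms(2)[unfolded repr_def] th_push_word[OF assms(5,4)]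
  proof eventually_elim
    case (elim N)
    have N: "0 < N" using elim by (simp add: fine_mesh_def)
    let ?y = "word_act w (pathfinish c')"
    have tp1: "tp (upath N c @ jump_back w (pathfinish c))" (is "tp ?A")
      and tp2: "tp (upath N c' @ jump_back w' (pathfinish c'))" (is "tp ?B")
      using tp_upath_jump_back elim(2,3) assms(5,6) by blast+
    have lA: "last ?A = pathstart c'"
      using repr_last[OF repr_upath[OF elim(2) assms(3,5)] assms(3,5)] assms(5,7) by simp
    have "th zs ?A" "th zs' ?B" using elim by auto
    then have 1: "th (?A @ tl ?B) (zs @ tl zs')"
      using tp1 tp2 lA by (intro th_append_tl(1)) (auto intro: th_sym)
    have tp3: "tp (upath N ?d @ jump_back w ?y)" (is "tp ?C")
      using tp_upath_jump_back[OF elim(4) assms(5)] by (simp add: pathfinish_compose)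
    have lC: "last ?C = pathfinish c'"
      using repr_last[OF repr_upath[OF elim(4) pd assms(5)] pd assms(5)] assms(5)
      by (simp add: pathfinish_compose)
    have tp4: "tp (pathfinish c' # jump_back w' (pathfinish c'))" (is "tp ?E")
      by (rule tp_jump_back[OF assms(6)])
    have 2: "th (?C @ tl ?E) ((word_act w (pathstart c') # jump_back w (word_act w (pathstart c')) @ tl (upath N c')) @ tl ?E)"
      (is "th _ (?F @ tl ?E)")
      using elim(7) tp3 tp4 lC by (intro th_append_tl(1)) simp_all
    have tp5: "tp (?C @ tl ?E)" using tp3 tp4 lC by (intro th_append_tl(2)[OF th_refl th_refl]) simp_all
    have 3: "th (upath N c @ tl (?C @ tl ?E)) (upath N c @ tl (?F @ tl ?E))"
      by (rule th_append_tl(1)[OF th_refl 2 tp_upath[OF elim(2)] tp5]) (use N join in simp)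
    have e1: "upath N c @ tl (?F @ tl ?E) = ?A @ tl ?B"
      using assms(7) by simp
    have "pathfinish (c +++ ?d) = ?y" by (simp add: pathfinish_compose)
    then have e2: "upath (2 * N) (c +++ ?d) @ jump_back (w @ w') (pathfinish (c +++ ?d))
        = upath N c @ tl (?C @ tl ?E)"
      using upath_join[OF N join] assms(5) by (simp add: jump_back_append)
    have "repr (c +++ ?d) (w @ w') (upath (2 * N) (c +++ ?d) @ jump_back (w @ w') (pathfinish (c +++ ?d)))"
      using repr_upath[OF elim(1) pj] assms(5,6) by simp
    then show ?case
      unfolding e2 using 1 3 e1 repr_th by metis
  qed
  then show ?thesis by simp
qed

end

section \<open>The warped metric on a compact geodesic space\<close>

lemma finite_common_bound:
  assumes "finite W" "\<And>w. w \<in> W \<Longrightarrow> \<exists>d>0::real. P w d"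
    "\<And>w d d'. P w d \<Longrightarrow> 0 < d' \<Longrightarrow> d' \<le> d \<Longrightarrow> P w d'"
  shows "\<exists>d>0. \<forall>w\<in>W. P w d"
  using assms(1,2)
proof (induction W rule: finite_induct)
  case empty
  show ?case by (intro exI[of _ 1]) simp
next
  case (insert w W)
  then obtain d d' where *: "0 < d" "\<forall>w\<in>W. P w d" "0 < d'" "P w d'" by (metis insertCI)
  have "P v (min d d')" if "v \<in> insert w W" for v
    using that * assms(3)[of v d "min d d'"] assms(3)[of v d' "min d d'"] by auto
  then show ?case using * by (intro exI[of _ "min d d'"]) auto
qed

locale warped_compact = warped_base S \<alpha> x0
  for S :: "('a::metric_space \<Rightarrow> 'a) set" and \<alpha> :: "('a \<Rightarrow> 'a) \<Rightarrow> real \<Rightarrow> 'a" and x0 :: 'a +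
  assumes cpt: "compact (UNIV :: 'a set)" and finS: "finite S" and geo: "geodesic_space (UNIV :: 'a set)"
begin

section \<open>The continuous part of jumping paths\<close>

lemma geodesic_path:
  obtains g where "path g" "pathstart g = x" "pathfinish g = (y::'a)"
    "\<forall>u\<in>{0..1}. dist x (g u) = u * dist x y"
proof -
  have "\<exists>g::real \<Rightarrow> 'a. g ` {0..1} \<subseteq> UNIV \<and> g 0 = x \<and> g 1 = y \<and>
        (\<forall>u\<in>{0..1}. \<forall>v\<in>{0..1}. dist (g u) (g v) = \<bar>u - v\<bar> * dist x y)"
    using geo[unfolded geodesic_space_def ball_UNIV, THEN spec[of _ x], THEN spec[of _ y]] .
  then obtain g :: "real \<Rightarrow> 'a" where G: "g ` {0..1} \<subseteq> UNIV \<and> g 0 = x \<and> g 1 = y \<and>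
        (\<forall>u\<in>{0..1}. \<forall>v\<in>{0..1}. dist (g u) (g v) = \<bar>u - v\<bar> * dist x y)" by (elim exE)
  then have g: "g 0 = x" "g 1 = y"
    "\<And>u v. u \<in> {0..1} \<Longrightarrow> v \<in> {0..1} \<Longrightarrow> dist (g u) (g v) = \<bar>u - v\<bar> * dist x y"
    by simp_all
  have "(dist x y)-lipschitz_on {0..1} g"
    using g(3) by (intro lipschitz_onI) (simp_all add: dist_real_def mult.commute)
  then have "path g" unfolding path_def by (rule lipschitz_on_continuous_on)
  moreover have "pathstart g = x" "pathfinish g = y"
    using g(1,2) by (simp_all add: pathstart_def pathfinish_def)
  moreover have "\<forall>u\<in>{0..1}. dist x (g u) = u * dist x y"
    using g(3)[of 0] g(1) by auto
  ultimately show ?thesis by (rule that)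
qed

text \<open>\<open>gap w x y\<close> is the least total length of the continuous parts of a jumping path from \<open>x\<close> to
  \<open>y\<close> with the jumps \<open>w\<close>.\<close>

primrec gap :: "('a \<Rightarrow> 'a) letter list \<Rightarrow> 'a \<Rightarrow> 'a \<Rightarrow> real" where
  "gap [] x y = dist x y"
| "gap (l # w) x y = (INF b. dist x b + gap w (letter_act l b) y)"

lemma gap_nonneg: "0 \<le> gap w x y"
  by (induction w arbitrary: x) (auto intro!: cINF_greatest add_nonneg_nonneg)

lemma gap_Cons_le: "gap (l # w) x y \<le> dist x b + gap w (letter_act l b) y"
  unfolding gap.simps
  by (rule cINF_lower) (auto intro!: bdd_belowI[of _ 0] add_nonneg_nonneg gap_nonneg)

text \<open>A continuous function of the jumping point \<open>b\<close> on a compact space has a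
  minimum. The Lipschitz bound is a premise because its own induction uses this lemma for shorter
  words.\<close>

lemma gap_attained_aux:
  assumes "wd (l # w)" "\<And>x x'. gap w x y \<le> dist x x' + gap w x' y"
  shows "\<exists>b. gap (l # w) x y = dist x b + gap w (letter_act l b) y"
proof -
  have "1-lipschitz_on UNIV (\<lambda>z. gap w z y)"
  proof (rule lipschitz_onI)
    show "dist (gap w p y) (gap w q y) \<le> 1 * dist p q" for p q
      using assms(2)[of p q] assms(2)[of q p] by (simp add: dist_real_def dist_commute abs_le_iff)
  qed simp
  then have "continuous_on UNIV (\<lambda>z. gap w z y)" by (rule lipschitz_on_continuous_on)
  then have "continuous_on UNIV (\<lambda>b. dist x b + gap w (letter_act l b) y)"
    using continuous_letter_act[of l] assms(1)
    by (auto intro!: continuous_intros continuous_on_compose2[of UNIV "\<lambda>z. gap w z y"])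
  then obtain b where b: "\<And>b'. dist x b + gap w (letter_act l b) y \<le> dist x b' + gap w (letter_act l b') y"
    using continuous_attains_inf[OF cpt] by blast
  have "gap (l # w) x y = dist x b + gap w (letter_act l b) y"
    unfolding gap.simps by (rule cInf_eq_minimum) (use b in auto)
  then show ?thesis by blast
qed

lemma gap_lipschitz: "wd w \<Longrightarrow> gap w x y \<le> dist x x' + gap w x' y"
proof (induction w arbitrary: x x')
  case Nil
  show ?case by (simp add: dist_triangle)
next
  case (Cons l w)
  then have "\<And>x x'. gap w x y \<le> dist x x' + gap w x' y" by simp
  then obtain b where b: "gap (l # w) x' y = dist x' b + gap w (letter_act l b) y"
    using gap_attained_aux[OF Cons.prems] by blast
  show ?case using gap_Cons_le[of l w x y b] b dist_triangle[of x b x'] by linarith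
qed

lemma gap_attained:
  assumes "wd (l # w)" obtains b where "gap (l # w) x y = dist x b + gap w (letter_act l b) y"
proof -
  have "wd w" using assms by simp
  then have "\<exists>b. gap (l # w) x y = dist x b + gap w (letter_act l b) y"
    by (intro gap_attained_aux[OF assms] gap_lipschitz)
  then show ?thesis using that by blast
qed

lemma gap_append: "wd u \<Longrightarrow> wd v \<Longrightarrow> gap (u @ v) x z \<le> gap u x y + gap v y z"
proof (induction u arbitrary: x)
  case Nil
  then show ?case using gap_lipschitz[of v x z y] by simp
next
  case (Cons l u)
  obtain b where b: "gap (l # u) x y = dist x b + gap u (letter_act l b) y"
    using gap_attained[OF Cons.prems(1)] .
  show ?case
    using gap_Cons_le[of l "u @ v" x z b] Cons.IH[of "letter_act l b"] Cons.prems b by simp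
qed

lemma gap_inv: "wd w \<Longrightarrow> gap (word_inv w) y x \<le> gap w x y"
proof (induction w arbitrary: x)
  case (Cons l w)
  then have l: "l \<in> S \<times> UNIV" "wd [letter_inv l]" "wd w" by (auto simp: letter_inv_mem)
  obtain b where b: "gap (l # w) x y = dist x b + gap w (letter_act l b) y"
    using gap_attained[OF Cons.prems] .
  have "gap [letter_inv l] (letter_act l b) x \<le> dist b x"
    using gap_Cons_le[of "letter_inv l" "[]" "letter_act l b" x "letter_act l b"] l by simp
  then show ?case
    using gap_append[of "word_inv w" "[letter_inv l]" y x "letter_act l b"] l Cons.IH[of "letter_act l b"] b
    by (simp add: dist_commute)
qed (simp add: dist_commute)

lemma finite_words: "finite {w. wd w \<and> length w \<le> n}"
  by (rule finite_lists_length_le) (simp add: finS)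

section \<open>The warped metric as a least cost\<close>

definition cost :: "real \<Rightarrow> ('a \<Rightarrow> 'a) letter list \<Rightarrow> 'a \<Rightarrow> 'a \<Rightarrow> real" where
  "cost t w x y = real (length w) + t * gap w x y"

definition least_cost :: "real \<Rightarrow> 'a \<Rightarrow> 'a \<Rightarrow> real" where
  "least_cost t x y = (INF w\<in>{w. wd w}. cost t w x y)"

lemma cost_nonneg: "0 < t \<Longrightarrow> 0 \<le> cost t w x y"
  by (simp add: cost_def gap_nonneg)

lemma least_cost_le: "0 < t \<Longrightarrow> wd w \<Longrightarrow> least_cost t x y \<le> cost t w x y"
  unfolding least_cost_def
  by (rule cINF_lower) (auto intro!: bdd_belowI[of _ 0] cost_nonneg)

lemma least_cost_attained:
  assumes "0 < t" shows "\<exists>w. wd w \<and> least_cost t x y = cost t w x y"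
proof -
  \<comment> \<open>The empty word costs \<open>t * dist x y\<close>, so words with more letters
    than that are no cheaper and only finitely many compete.\<close>
  define n where "n = nat \<lceil>t * dist x y\<rceil>"
  let ?W = "{w. wd w \<and> length w \<le> n}"
  have W: "finite ?W" "?W \<noteq> {}" using finite_words by (auto intro: exI[of _ "[]"])
  obtain w where w: "w \<in> ?W" "\<And>v. v \<in> ?W \<Longrightarrow> cost t w x y \<le> cost t v x y"
    using ex_is_arg_min_if_finite[OF W, of "\<lambda>w. cost t w x y"]
    by (auto simp: is_arg_min_linorder)
  have "cost t w x y \<le> cost t v x y" if v: "wd v" for v
  proof (cases "length v \<le> n")
    case False
    have "cost t w x y \<le> t * dist x y" using w(2)[of "[]"] by (simp add: cost_def)
    also have "\<dots> \<le> real n" unfolding n_def by linarith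
    also have "\<dots> \<le> real (length v)" using False by simp
    also have "\<dots> \<le> cost t v x y" using assms by (simp add: cost_def gap_nonneg)
    finally show ?thesis .
  qed (use w v in auto)
  then have "least_cost t x y = cost t w x y"
    unfolding least_cost_def by (intro cInf_eq_minimum) (use w in auto)
  then show ?thesis using w by blast
qed

lemma metric_scaled_dist: "0 < t \<Longrightarrow> Metric_space UNIV (\<lambda>x y::'a. t * dist x y)"
  unfolding Metric_space_def
  by (auto simp: dist_commute simp flip: distrib_left intro: dist_triangle)

text \<open>Since the infimum is attained, cost zero forces the empty word and distance zero.
  Inverse words give symmetry, concatenated words the triangle inequality.\<close>

lemma least_cost_admissible:
  assumes t: "0 < t" shows "warp_admissible (\<lambda>x y. t * dist x y) S (least_cost t)"
  unfolding warp_admissible_def Metric_space_def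
proof (intro conjI allI ballI impI)
  fix x y z :: 'a
  obtain w where w: "wd w" "least_cost t x y = cost t w x y" using least_cost_attained[OF t] by blast
  obtain v where v: "wd v" "least_cost t y z = cost t v y z" using least_cost_attained[OF t] by blast
  show "0 \<le> least_cost t x y" using w cost_nonneg t by simp
  show "least_cost t x y = least_cost t y x"
  proof (rule antisym)
    show *: "least_cost t x y \<le> least_cost t y x" for x y
    proof -
      obtain w where w: "wd w" "least_cost t y x = cost t w y x" using least_cost_attained[OF t] by blast
      have "least_cost t x y \<le> cost t (word_inv w) x y" using t w by (intro least_cost_le) auto
      also have "\<dots> \<le> cost t w y x" using gap_inv[OF w(1)] t by (simp add: cost_def)
      finally show ?thesis using w by simp
    qed
    show "least_cost t y x \<le> least_cost t x y" by (rule *)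
  qed
  show "(least_cost t x y = 0) = (x = y)"
  proof
    assume "least_cost t x y = 0"
    then have "real (length w) + t * gap w x y = 0" using w by (simp add: cost_def)
    moreover have "0 \<le> t * gap w x y" using t by (simp add: gap_nonneg)
    ultimately have "w = []" "t * gap w x y = 0" by (auto simp: add_nonneg_eq_0_iff)
    then show "x = y" using t by simp
  next
    assume "x = y"
    then show "least_cost t x y = 0"
      using least_cost_le[OF t, of "[]" x y] w cost_nonneg[OF t, of w x y] by (simp add: cost_def)
  qed
  have "least_cost t x z \<le> cost t (w @ v) x z" using t w v by (intro least_cost_le) auto
  also have "\<dots> \<le> cost t w x y + cost t v y z"
    using mult_left_mono[OF gap_append[OF w(1) v(1), of x z y], of t] t
    by (simp add: cost_def algebra_simps)
  finally show "least_cost t x z \<le> least_cost t x y + least_cost t y z" using w v by simp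
  show "least_cost t x y \<le> t * dist x y"
    using least_cost_le[OF t, of "[]" x y] by (simp add: cost_def)
next
  fix x s assume s: "s \<in> S"
  have "gap [(s, True)] x (s x) \<le> 0"
    using gap_Cons_le[of "(s, True)" "[]" x "s x" x] by (simp add: letter_act_def)
  then have "t * gap [(s, True)] x (s x) \<le> 0" using t by (simp add: mult_nonneg_nonpos)
  then have "cost t [(s, True)] x (s x) \<le> 1" by (simp add: cost_def)
  then show "least_cost t x (s x) \<le> 1"
    using least_cost_le[OF t, of "[(s, True)]" x "s x"] s by simp
qed

lemma warped_scale:
  assumes "0 < t" "1 \<le> n"
  shows "warped_scale S \<alpha> x0 (warped_metric (\<lambda>x y. t * dist x y) S) t n"
proof -
  have "warp_admissible (\<lambda>x y. t * dist x y) S (warped_metric (\<lambda>x y. t * dist x y) S)"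
    using warp_admissible_warped_metric metric_scaled_dist assms by blast
  then show ?thesis
    using assms by unfold_locales (auto simp: warp_admissible_def Metric_space_def)
qed

lemma warped_metric_le_cost:
  assumes "0 < t" "wd w"
  shows "warped_metric (\<lambda>x y. t * dist x y) S x y \<le> cost t w x y"
proof -
  define \<rho> where "\<rho> = warped_metric (\<lambda>x y. t * dist x y) S"
  interpret warped_scale S \<alpha> x0 \<rho> t 1 unfolding \<rho>_def by (rule warped_scale) (use assms in auto)
  have "\<rho> x y \<le> cost t w x y"
    using assms(2)
  proof (induction w arbitrary: x)
    case Nil
    show ?case using rho_le_dist by (simp add: cost_def)
  next
    case (Cons l w)
    obtain b where b: "gap (l # w) x y = dist x b + gap w (letter_act l b) y"
      using gap_attained[OF Cons.prems] .
    have "\<rho> x y \<le> \<rho> x b + (\<rho> b (letter_act l b) + \<rho> (letter_act l b) y)"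
      using rho_triangle[of x y b] rho_triangle[of b y "letter_act l b"] by linarith
    moreover have "\<rho> b (letter_act l b) \<le> 1" using Cons.prems by (intro rho_letter) simp
    moreover have "\<rho> (letter_act l b) y \<le> cost t w (letter_act l b) y"
      using Cons.prems by (intro Cons.IH) simp
    moreover have "cost t (l # w) x y = t * dist x b + 1 + cost t w (letter_act l b) y"
      unfolding cost_def b by (simp add: distrib_left)
    ultimately show ?case using rho_le_dist[of x b] by linarith
  qed
  then show ?thesis by (simp add: \<rho>_def)
qed

text \<open>The least cost is admissible, hence below the greatest admissible metric, which in turn
  is below every cost; at a minimising word all three agree.\<close>

lemma warped_metric_attained:
  assumes "0 < t"
  shows "\<exists>w. wd w \<and> warped_metric (\<lambda>x y. t * dist x y) S x y = cost t w x y"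
proof -
  let ?\<rho> = "warped_metric (\<lambda>x y. t * dist x y) S"
  have "least_cost t x y \<le> ?\<rho> x y"
    using warped_metric_greatest[OF metric_scaled_dist[OF assms] least_cost_admissible[OF assms]]
    by (simp add: le_fun_def)
  moreover obtain w where w: "wd w" "least_cost t x y = cost t w x y"
    using least_cost_attained[OF assms] by blast
  ultimately have "?\<rho> x y = cost t w x y"
    using warped_metric_le_cost[OF assms w(1), of x y] by simp
  then show ?thesis using w by blast
qed

section \<open>Compactness estimates for words of bounded length\<close>

lemma words_equicontinuous:
  assumes "0 < e"
  shows "\<exists>d>0. \<forall>w. wd w \<longrightarrow> length w \<le> n \<longrightarrow> (\<forall>p q. dist p q < d \<longrightarrow> dist (word_act w p) (word_act w q) < e)"
proof -
  have "\<exists>d>0. \<forall>w\<in>{w. wd w \<and> length w \<le> n}. \<forall>p q. dist p q < d \<longrightarrow> dist (word_act w p) (word_act w q) < e"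
  proof (rule finite_common_bound[OF finite_words])
    fix w assume "w \<in> {w. wd w \<and> length w \<le> n}"
    then have "uniformly_continuous_on UNIV (word_act w)"
      using cpt by (intro compact_uniformly_continuous) auto
    then show "\<exists>d>0. \<forall>p q. dist p q < d \<longrightarrow> dist (word_act w p) (word_act w q) < e"
      using assms unfolding uniformly_continuous_on_def by (metis UNIV_I)
  qed (meson less_le_trans)
  then show ?thesis by blast
qed

text \<open>On the compact set of points at distance at least \<open>e\<close> from all fixed points
  the displacement has a positive minimum. If there is no fixed point this set is the whole space,
  so small displacement does produce a fixed point.\<close>

lemma near_fixed_point:
  assumes "0 < e"
  shows "\<exists>d>0. \<forall>w. wd w \<longrightarrow> length w \<le> n \<longrightarrow>
    (\<forall>a. dist a (word_act w a) < d \<longrightarrow> (\<exists>x\<in>Fix_word w. dist a x < e))"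
proof -
  have "\<exists>d>0. \<forall>w\<in>{w. wd w \<and> length w \<le> n}. \<forall>a. dist a (word_act w a) < d \<longrightarrow> (\<exists>x\<in>Fix_word w. dist a x < e)"
  proof (rule finite_common_bound[OF finite_words])
    fix w assume "w \<in> {w. wd w \<and> length w \<le> n}"
    then have w: "continuous_on UNIV (word_act w)" by simp
    define K where "K = (\<Inter>x\<in>Fix_word w. {a. e \<le> dist a x})"
    have "closed {a. e \<le> dist a x}" for x :: 'a
      by (intro closed_Collect_le continuous_intros)
    then have "closed K" unfolding K_def by (intro closed_INT) auto
    then have K: "compact K" using compact_Int_closed[OF cpt] by simp
    show "\<exists>d>0. \<forall>a. dist a (word_act w a) < d \<longrightarrow> (\<exists>x\<in>Fix_word w. dist a x < e)"
    proof (cases "K = {}")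
      case True
      have "\<exists>x\<in>Fix_word w. dist a x < e" for a
      proof -
        have "a \<notin> K" using True by simp
        then show ?thesis by (auto simp: K_def not_le)
      qed
      then show ?thesis using zero_less_one by blast
    next
      case False
      have "continuous_on K (\<lambda>a. dist a (word_act w a))"
        by (intro continuous_intros continuous_on_subset[OF w]) simp
      then obtain a where a: "a \<in> K" "\<And>b. b \<in> K \<Longrightarrow> dist a (word_act w a) \<le> dist b (word_act w b)"
        using continuous_attains_inf[OF K False] by blast
      have "a \<notin> Fix_word w" using a(1) assms by (force simp: K_def)
      then have "0 < dist a (word_act w a)" by (auto simp: Fix_word_def)
      moreover have "\<exists>x\<in>Fix_word w. dist b x < e" if "dist b (word_act w b) < dist a (word_act w a)" for b
        using a(2)[of b] that by (force simp: K_def)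
      ultimately show ?thesis by blast
    qed
  qed (meson less_le_trans)
  then show ?thesis by blast
qed

text \<open>A short morphism from \<open>x\<close> to \<open>y\<close>. Size is the distance from
  the starting point rather than length, because words act uniformly continuously but need not
  preserve finite length.\<close>

definition small :: "real \<Rightarrow> nat \<Rightarrow> 'a \<Rightarrow> 'a \<Rightarrow> (real \<Rightarrow> 'a) \<Rightarrow> ('a \<Rightarrow> 'a) letter list \<Rightarrow> bool" where
  "small e n x y c w \<longleftrightarrow> path c \<and> pathstart c = x \<and> pathfinish c = word_act w y \<and>
     wd w \<and> length w \<le> n \<and> (\<forall>u\<in>{0..1}. dist x (c u) < e)"

lemma dist_join:
  assumes "\<And>u. u \<in> {0..1} \<Longrightarrow> dist x (c u) < e" "\<And>u. u \<in> {0..1} \<Longrightarrow> dist x (c' u) < e" "u \<in> {0..1}"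
  shows "dist x ((c +++ c') u) < e"
  using assms(1)[of "2 * u"] assms(2)[of "2 * u - 1"] assms(3) by (auto simp: joinpaths_def)

text \<open>Everything after the first jump is pulled back by its inverse; this merges the
  continuous parts and leaves the inverted letters in the same order. Each pull-back costs a modulus
  of continuity, so the radius shrinks with every letter.\<close>

lemma small_if_gap_less:
  assumes "0 < e"
  shows "\<exists>d>0. \<forall>w x y. wd w \<longrightarrow> length w \<le> n \<longrightarrow> gap w x y < d \<longrightarrow>
    (\<exists>c. small e n x y c (map letter_inv w))"
  using assms
proof (induction n arbitrary: e)
  case 0
  have "\<exists>c. small e 0 x y c []" if "dist x y < e" for x y
  proof -
    obtain g where g: "path g" "pathstart g = x" "pathfinish g = y"
      "\<forall>u\<in>{0..1}. dist x (g u) = u * dist x y" using geodesic_path[of x y] .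
    have "dist x (g u) < e" if "u \<in> {0..1}" for u
      using bspec[OF g(4) that] that \<open>dist x y < e\<close> mult_left_le_one_le[of "dist x y" u] by auto
    then show ?thesis using g by (auto simp: small_def)
  qed
  then show ?case using 0 by (intro exI[of _ e]) auto
next
  case (Suc n)
  obtain e' where e': "0 < e'" "\<And>w p q. wd w \<Longrightarrow> length w \<le> 1 \<Longrightarrow> dist p q < e' \<Longrightarrow>
      dist (word_act w p) (word_act w q) < e / 2"
    using words_equicontinuous[of "e / 2" 1] Suc.prems by auto
  obtain d where d: "0 < d" "\<And>w x y. wd w \<Longrightarrow> length w \<le> n \<Longrightarrow> gap w x y < d \<Longrightarrow>
      \<exists>c. small e' n x y c (map letter_inv w)"
    using Suc.IH[OF e'(1)] by blast
  have "\<exists>c. small e (Suc n) x y c (map letter_inv w)"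
    if w: "wd w" "length w \<le> Suc n" "gap w x y < min (e / 2) d" for w x y
  proof (cases w)
    case Nil
    obtain g where g: "path g" "pathstart g = x" "pathfinish g = y"
      "\<forall>u\<in>{0..1}. dist x (g u) = u * dist x y" using geodesic_path[of x y] .
    have "dist x (g u) < e" if "u \<in> {0..1}" for u
      using bspec[OF g(4) that] that w(3) Nil mult_left_le_one_le[of "dist x y" u] Suc.prems by auto
    then show ?thesis using g Nil by (auto simp: small_def)
  next
    case (Cons l v)
    have l: "l \<in> S \<times> UNIV" "letter_inv l \<in> S \<times> UNIV" "wd v" using w(1) Cons by (auto simp: letter_inv_mem)
    obtain b where b: "gap w x y = dist x b + gap v (letter_act l b) y"
      using gap_attained[of l v] w(1) unfolding Cons by blast
    have xb: "dist x b < e / 2" and gv: "gap v (letter_act l b) y < d"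
      using b w(3) gap_nonneg[of v "letter_act l b" y] zero_le_dist[of x b] by linarith+
    obtain c where c: "small e' n (letter_act l b) y c (map letter_inv v)"
      using d(2)[OF l(3) _ gv] w(2) Cons by auto
    obtain g where g: "path g" "pathstart g = x" "pathfinish g = b"
      "\<forall>u\<in>{0..1}. dist x (g u) = u * dist x b" using geodesic_path[of x b] .
    have 1: "dist x (g u) < e" if "u \<in> {0..1}" for u
      using bspec[OF g(4) that] that xb mult_left_le_one_le[of "dist x b" u] Suc.prems by auto
    have 2: "dist x ((letter_act (letter_inv l) \<circ> c) u) < e" if "u \<in> {0..1}" for u
    proof -
      have "dist (letter_act (letter_inv l) (letter_act l b)) (letter_act (letter_inv l) (c u)) < e / 2"
        using e'(2)[of "[letter_inv l]" "letter_act l b" "c u"] l c that by (simp add: small_def)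
      then show ?thesis using l xb dist_triangle[of x "letter_act (letter_inv l) (c u)" b] by simp
    qed
    have "small e (Suc n) x y (g +++ (letter_act (letter_inv l) \<circ> c)) (map letter_inv w)"
      unfolding small_def
    proof (intro conjI ballI dist_join)
      show "path (g +++ (letter_act (letter_inv l) \<circ> c))"
        using g c l by (auto simp: small_def path_comp continuous_letter_act pathstart_compose)
    qed (use c l g w(2) 1 2 Cons in \<open>auto simp: small_def pathfinish_compose\<close>)
    then show ?thesis by blast
  qed
  then show ?case using d Suc.prems by (intro exI[of _ "min (e / 2) d"]) auto
qed

text \<open>Only the second path is moved, and only by the first word, so only the number
  \<open>m\<close> of jumps in the first word is bounded in advance.\<close>

lemma small_cmp:
  assumes "0 < e"
  shows "\<exists>d>0. d \<le> e \<and> (\<forall>x y z c c' w w' m m'. small d m x y c w \<longrightarrow> small d m' y z c' w' \<longrightarrow> m \<le> n \<longrightarrow>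
    small e (m + m') x z (c +++ (word_act w \<circ> c')) (w @ w'))"
proof -
  obtain d where d: "0 < d" "\<And>w p q. wd w \<Longrightarrow> length w \<le> n \<Longrightarrow> dist p q < d \<Longrightarrow>
      dist (word_act w p) (word_act w q) < e / 2"
    using words_equicontinuous[of "e / 2" n] assms by auto
  have "small e (m + m') x z (c +++ (word_act w \<circ> c')) (w @ w')"
    if c: "small (min d (e / 2)) m x y c w" and c': "small (min d (e / 2)) m' y z c' w'" and m: "m \<le> n"
    for x y z c c' w w' m m'
  proof -
    have 1: "dist x (c u) < e" if "u \<in> {0..1}" for u
      using c that assms unfolding small_def by fastforce
    have xy: "dist x (word_act w y) < e / 2"
    proof -
      have "\<forall>u\<in>{0..1}. dist x (c u) < min d (e / 2)" using c by (simp add: small_def)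
      from bspec[OF this, of 1] show ?thesis using c by (simp add: small_def pathfinish_def)
    qed
    have 2: "dist x ((word_act w \<circ> c') u) < e" if "u \<in> {0..1}" for u
      using d(2)[of w y "c' u"] c c' m that xy dist_triangle[of x "word_act w (c' u)" "word_act w y"]
      by (auto simp: small_def)
    show ?thesis
      unfolding small_def
    proof (intro conjI ballI dist_join)
      show "path (c +++ (word_act w \<circ> c'))"
        using c c' by (auto simp: small_def path_comp pathstart_compose)
    qed (use c c' 1 2 in \<open>auto simp: small_def pathfinish_compose\<close>)
  qed
  then show ?thesis using d assms by (intro exI[of _ "min d (e / 2)"]) auto
qed

lemma small_reduce: "small e n x y c w \<Longrightarrow> small e n x y c (reduce_word w)"
  using length_reduce_word[of w] by (auto simp: small_def)

text \<open>A Lebesgue number gives one radius for all base points. The local condition concerns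
  loops based at the centre \<open>x\<close>, so the given loop is first conjugated by a geodesic
  from \<open>x\<close>.\<close>

lemma small_loops_null:
  assumes "semi_locally_simply_connected (UNIV :: 'a set)"
  shows "\<exists>e>0. \<forall>(x::'a) p. path p \<longrightarrow> pathstart p = x \<longrightarrow> pathfinish p = x \<longrightarrow>
    (\<forall>u\<in>{0..1}. dist x (p u) < e) \<longrightarrow> pc p = cn x"
proof -
  have "\<exists>r>0. \<forall>p. path p \<longrightarrow> path_image p \<subseteq> ball x r \<longrightarrow> pathstart p = x \<longrightarrow> pathfinish p = x
      \<longrightarrow> hpaths p (\<lambda>_. x)" for x :: 'a
  proof -
    have "\<exists>U. open U \<and> x \<in> U \<and> (\<forall>p. path p \<and> path_image p \<subseteq> U \<and> pathstart p = x \<and> pathfinish p = x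
        \<longrightarrow> hpaths p (\<lambda>_. x))"
      using assms unfolding semi_locally_simply_connected_def by simp
    then obtain U where U: "open U" "x \<in> U" "\<forall>p. path p \<and> path_image p \<subseteq> U \<and> pathstart p = x \<and> pathfinish p = x
        \<longrightarrow> hpaths p (\<lambda>_. x)"
      by blast
    obtain r where r: "0 < r" "ball x r \<subseteq> U" using U(1,2) open_contains_ball by blast
    have "hpaths p (\<lambda>_. x)" if "path p" "path_image p \<subseteq> ball x r" "pathstart p = x" "pathfinish p = x" for p
      using U(3) r(2) that by (metis subset_trans)
    then show ?thesis using r(1) by blast
  qed
  then obtain r where r: "\<And>x::'a. 0 < r x" "\<And>x p. path p \<Longrightarrow> path_image p \<subseteq> ball x (r x) \<Longrightarrow>
      pathstart p = x \<Longrightarrow> pathfinish p = x \<Longrightarrow> hpaths p (\<lambda>_. x)" by metis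
  have cov: "UNIV \<subseteq> \<Union>(range (\<lambda>x. ball x (r x / 2)))"
  proof
    fix x :: 'a
    have "x \<in> ball x (r x / 2)" using r(1)[of x] by simp
    then show "x \<in> \<Union>(range (\<lambda>x. ball x (r x / 2)))" by blast
  qed
  obtain e where e: "0 < e" "\<And>y::'a. \<exists>T\<in>range (\<lambda>x. ball x (r x / 2)). ball y e \<subseteq> T"
    by (rule Heine_Borel_lemma[OF cpt cov]) auto
  have "pc p = cn y" if p: "path p" "pathstart p = y" "pathfinish p = y" "\<And>u. u \<in> {0..1} \<Longrightarrow> dist y (p u) < e"
    for y :: 'a and p
  proof -
    obtain x where x: "ball y e \<subseteq> ball x (r x / 2)" using e(2)[of y] by auto
    have "y \<in> ball y e" using e(1) by simp
    then have "y \<in> ball x (r x / 2)" using x by blast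
    then have xy: "dist x y < r x / 2" by simp
    obtain g where g: "path g" "pathstart g = x" "pathfinish g = y"
      "\<forall>u\<in>{0..1}. dist x (g u) = u * dist x y" using geodesic_path[of x y] .
    have gi: "path_image g \<subseteq> ball x (r x)"
    proof
      fix z assume "z \<in> path_image g"
      then obtain u where u: "u \<in> {0..1}" "z = g u" by (auto simp: path_image_def)
      then have "dist x z \<le> dist x y" using bspec[OF g(4) u(1)] mult_left_le_one_le[of "dist x y" u] by simp
      then show "z \<in> ball x (r x)" using xy r(1)[of x] by simp
    qed
    have "path_image p \<subseteq> ball y e" using p(4) by (auto simp: path_image_def)
    then have pI: "path_image p \<subseteq> ball x (r x)" using x r(1)[of x] by (fastforce simp: subset_iff)
    have "path_image (g +++ p +++ reversepath g) \<subseteq> ball x (r x)"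
      using gi pI by (intro subset_path_image_join) simp_all
    then have "hpaths (g +++ p +++ reversepath g) (\<lambda>_. x)"
      using g p by (intro r(2)) simp_all
    then have "pc g \<star> pc p \<star> rv (pc g) = cn x"
      using g p by (simp add: rv_pc cmp_pc pc_eq_iff)
    then have "rv (pc g) \<star> (pc g \<star> pc p \<star> rv (pc g)) \<star> pc g = rv (pc g) \<star> cn x \<star> pc g" by simp
    then show ?thesis using g p by simp
  qed
  then show ?thesis using e(1) by blast
qed

text \<open>The path \<open>c\<close> runs from \<open>a\<close> to its image under
  \<open>w\<close>, so small \<open>c\<close> means small displacement and hence a fixed point
  nearby. Any path from \<open>a\<close> to it that stays close then describes \<open>c\<close> up
  to a small loop.\<close>

lemma small_loop_elliptic:
  "\<exists>e>0. \<forall>a c w. small e n a a c w \<longrightarrow> Fix_word w \<noteq> {} \<and>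
    (semi_locally_simply_connected (UNIV :: 'a set) \<longrightarrow>
      (\<exists>b. arr b \<and> src b = a \<and> tgt b \<in> Fix_word w \<and> pc c = b \<star> im (word_act w) (rv b)))"
proof -
  \<comment> \<open>If the space is not semi-locally simply connected, \<open>null\<close> is
    vacuous and any positive radius will do.\<close>
  obtain e where e: "0 < e" and null: "semi_locally_simply_connected (UNIV :: 'a set) \<Longrightarrow>
     \<forall>(x::'a) p. path p \<longrightarrow> pathstart p = x \<longrightarrow> pathfinish p = x \<longrightarrow>
      (\<forall>u\<in>{0..1}. dist x (p u) < e) \<longrightarrow> pc p = cn x"
    using small_loops_null zero_less_one by blast
  obtain d where d: "0 < d" "\<And>w p q. wd w \<Longrightarrow> length w \<le> n \<Longrightarrow> dist p q < d \<Longrightarrow>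
      dist (word_act w p) (word_act w q) < e"
    using words_equicontinuous[OF e, of n] by auto
  \<comment> \<open>The geodesic to the fixed point must be so short that its translate by
    \<open>w\<close>, controlled by \<open>d\<close>, stays within \<open>e\<close> as well.\<close>
  define e2 where "e2 = min (e / 4) (d / 2)"
  have e2: "0 < e2" "e2 \<le> e / 4" "e2 \<le> d / 2" using e d by (auto simp: e2_def)
  obtain d1 where d1: "0 < d1" "\<And>w a. wd w \<Longrightarrow> length w \<le> n \<Longrightarrow> dist a (word_act w a) < d1 \<Longrightarrow>
      \<exists>x\<in>Fix_word w. dist a x < e2"
    using near_fixed_point[OF e2(1), of n] by auto
  define e1 where "e1 = min d1 (e / 4)"
  have "Fix_word w \<noteq> {} \<and> (semi_locally_simply_connected (UNIV :: 'a set) \<longrightarrow>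
      (\<exists>b. arr b \<and> src b = a \<and> tgt b \<in> Fix_word w \<and> pc c = b \<star> im (word_act w) (rv b)))"
    if c: "small e1 n a a c w" for a c w
  proof -
    have c': "path c" "pathstart c = a" "pathfinish c = word_act w a" "wd w" "length w \<le> n"
      "\<And>u. u \<in> {0..1} \<Longrightarrow> dist a (c u) < e1" using c by (auto simp: small_def)
    have "dist a (word_act w a) < d1"
      using c'(6)[of 1] c'(3) by (simp add: pathfinish_def e1_def)
    then obtain x where x: "x \<in> Fix_word w" "dist a x < e2" using d1(2) c' by blast
    have wx: "word_act w x = x" using x(1) by (simp add: Fix_word_def)
    obtain g where g: "path g" "pathstart g = x" "pathfinish g = a"
      "\<forall>u\<in>{0..1}. dist x (g u) = u * dist x a" using geodesic_path[of x a] .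
    have gx: "dist x (g u) < e2" if "u \<in> {0..1}" for u
      using bspec[OF g(4) that] that x(2) mult_left_le_one_le[of "dist x a" u] by (auto simp: dist_commute)
    have wg: "path (word_act w \<circ> reversepath g)" "path (word_act w \<circ> g)"
      by (rule path_comp; use g c'(4) in simp)+
    \<comment> \<open>As \<open>w\<close> fixes \<open>x\<close>, joining \<open>x\<close> to both
      ends of \<open>c\<close> by \<open>g\<close> and by its translate closes \<open>c\<close> up
      to a loop at \<open>x\<close>.\<close>
    let ?p = "g +++ c +++ (word_act w \<circ> reversepath g)"
    have p: "path ?p" "pathstart ?p = x" "pathfinish ?p = x"
      using g c' wg wx by (simp_all add: pathstart_compose pathfinish_compose)
    have near: "dist x (?p u) < e" if "u \<in> {0..1}" for u
    proof (intro dist_join that)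
      fix u :: real assume u: "u \<in> {0..1}"
      show "dist x (g u) < e" using gx[OF u] e2 e by simp
      show "dist x (c u) < e"
        using c'(6)[OF u] x(2) e2 dist_triangle[of x "c u" a] e by (simp add: dist_commute e1_def)
      have "dist x (reversepath g u) < d"
        using gx[of "1 - u"] u e2 d by (simp add: reversepath_def)
      then show "dist x ((word_act w \<circ> reversepath g) u) < e"
        using d(2)[OF c'(4,5), of x "reversepath g u"] wx by simp
    qed
    have "\<exists>b. arr b \<and> src b = a \<and> tgt b \<in> Fix_word w \<and> pc c = b \<star> im (word_act w) (rv b)"
      if "semi_locally_simply_connected (UNIV :: 'a set)"
    proof -
      have "pc ?p = cn x" using null[OF that] p near by blast
      moreover have "pc ?p = pc g \<star> pc c \<star> im (word_act w) (rv (pc g))"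
        using g c' wg by (simp add: cmp_pc rv_pc im_pc pathstart_compose)
      ultimately have "pc g \<star> pc c \<star> im (word_act w) (rv (pc g)) = cn x" by simp
      then have "rv (pc g) \<star> (pc g \<star> pc c \<star> im (word_act w) (rv (pc g))) \<star> im (word_act w) (pc g)
          = rv (pc g) \<star> cn x \<star> im (word_act w) (pc g)" by simp
      then have "pc c = rv (pc g) \<star> im (word_act w) (rv (rv (pc g)))"
        using g c' wx by simp
      then show ?thesis using g x by (intro exI[of _ "rv (pc g)"]) simp
    qed
    then show ?thesis using x(1) by blast
  qed
  then show ?thesis using e d1 by (intro exI[of _ e1]) (auto simp: e1_def)
qed

end

section \<open>Normal closures\<close>

lemma normal_closure_normal:
  assumes "group G" "A \<subseteq> carrier G" shows "normal_closure G A \<lhd> G"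
proof -
  interpret group G by fact
  let ?\<N> = "{N. N \<lhd> G \<and> A \<subseteq> N}"
  have "carrier G \<lhd> G" by (intro normal_invI subgroup_self) auto
  \<comment> \<open>An empty family would have the whole type as its intersection.\<close>
  then have ne: "?\<N> \<noteq> {}" using assms(2) by blast
  show ?thesis unfolding normal_closure_def
  proof (rule normal_invI)
    show "subgroup (\<Inter>?\<N>) G"
      by (rule subgroups_Inter) (use ne normal_imp_subgroup in auto)
    show "x \<otimes>\<^bsub>G\<^esub> h \<otimes>\<^bsub>G\<^esub> inv\<^bsub>G\<^esub> x \<in> \<Inter>?\<N>" if "x \<in> carrier G" "h \<in> \<Inter>?\<N>" for x h
      using that normal_invE(2) by auto
  qed
qed

lemma subset_normal_closure: "A \<subseteq> normal_closure G A"
  by (auto simp: normal_closure_def)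

lemma normal_closure_minimal: "N \<lhd> G \<Longrightarrow> A \<subseteq> N \<Longrightarrow> normal_closure G A \<subseteq> N"
  by (auto simp: normal_closure_def)

lemma rcos_eq_one_iff:
  assumes "N \<lhd> G" "x \<in> carrier G" shows "N #>\<^bsub>G\<^esub> x = \<one>\<^bsub>G Mod N\<^esub> \<longleftrightarrow> x \<in> N"
proof -
  interpret normal N G by fact
  show ?thesis
    using coset_join1[of N x] coset_join2[of x N] assms(2) subgroup_axioms by (auto simp: FactGroup_def)
qed

section \<open>The comparison homomorphism\<close>

locale warped_compact_scale = warped_compact S \<alpha> x0
  for S :: "('a::metric_space \<Rightarrow> 'a) set" and \<alpha> :: "('a \<Rightarrow> 'a) \<Rightarrow> real \<Rightarrow> 'a" and x0 :: 'a +
  fixes t :: real and n\<theta> :: nat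
  assumes t_pos': "0 < t" and theta_ge_1': "1 \<le> n\<theta>"
begin

abbreviation \<rho> where "\<rho> \<equiv> warped_metric (\<lambda>x y::'a. t * dist x y) S"

sublocale warped_scale S \<alpha> x0 \<rho> t n\<theta>
  by (rule warped_scale) (rule t_pos' theta_ge_1')+

abbreviation H where "H \<equiv> warped_pi1 t S (real n\<theta>) x0"
abbreviation Phi where "Phi \<equiv> Phi_S t S (real n\<theta>) \<alpha> x0"
abbreviation tc where "tc \<equiv> theta_class \<rho> (real n\<theta>)"

lemma tc_eq_iff: "tc zs = tc ws \<longleftrightarrow> th zs ws"
proof
  assume "tc zs = tc ws"
  moreover have "ws \<in> tc ws" by (simp add: theta_class_def)
  ultimately show "th zs ws" by (simp add: theta_class_def set_eq_iff)
next
  assume "th zs ws"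
  then have "th zs us \<longleftrightarrow> th ws us" for us using th_trans th_sym by blast
  then show "tc zs = tc ws" by (simp add: theta_class_def)
qed

lemma mem_tc: "ws \<in> tc zs \<longleftrightarrow> th zs ws"
  by (simp add: theta_class_def)

lemma H_carrier: "A \<in> carrier H \<longleftrightarrow> (\<exists>zs. A = tc zs \<and> tp zs \<and> hd zs = x0 \<and> last zs = x0)"
  by (auto simp: warped_pi1_def discrete_fundamental_group_def)

lemma H_one: "\<one>\<^bsub>H\<^esub> = tc [x0]"
  by (simp add: warped_pi1_def discrete_fundamental_group_def)

lemma H_mult:
  assumes "tp zs" "tp ws" "last zs = hd ws" shows "tc zs \<otimes>\<^bsub>H\<^esub> tc ws = tc (zs @ tl ws)"
proof -
  have eq: "tc (zs' @ tl ws') = tc (zs @ tl ws)" if "zs' \<in> tc zs" "ws' \<in> tc ws" for zs' ws'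
    using that assms th_append_tl(1)[of zs zs' ws ws'] th_sym by (simp add: mem_tc tc_eq_iff)
  have "tc zs \<otimes>\<^bsub>H\<^esub> tc ws = (\<Union>zs'\<in>tc zs. \<Union>ws'\<in>tc ws. tc (zs' @ tl ws'))"
    by (simp add: warped_pi1_def discrete_fundamental_group_def)
  also have "\<dots> = (\<Union>zs'\<in>tc zs. \<Union>ws'\<in>tc ws. tc (zs @ tl ws))"
    by (intro SUP_cong refl eq)
  also have "\<dots> = tc (zs @ tl ws)"
    using mem_tc[of zs zs] mem_tc[of ws ws] th_refl by blast
  finally show ?thesis .
qed

text \<open>\<open>Phi_S\<close> is a union over all representatives and all discretisations. All
  members agree by \<open>repr_unique\<close>, and a fine mesh shows that the union is not
  empty.\<close>

lemma Phi_J: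
  assumes "path c" "mor x0 x0 (pc c) w" "repr c w zs" shows "Phi (J (pc c) w) = tc zs"
proof -
  have w: "wd w" and c: "pathstart c = x0" "pathfinish c = word_act w x0"
    using assms by (auto simp: mor_def)
  let ?A = "pc c \<star> rv (al w)"
  let ?\<gamma>0 = "c +++ reversepath (alpha_word \<alpha> x0 w)"
  have \<gamma>0: "path ?\<gamma>0" "?A = pc ?\<gamma>0"
    using assms(1) w c by (auto simp: al_def alpha_word rv_pc cmp_pc)
  have *: "path (\<gamma> +++ alpha_word \<alpha> x0 w)" "hpaths (\<gamma> +++ alpha_word \<alpha> x0 w) c"
    if "\<gamma> \<in> ?A" for \<gamma>
  proof -
    have g: "hpaths ?\<gamma>0 \<gamma>" using that \<gamma>0 by (simp add: mem_pc)
    have \<gamma>: "path \<gamma>" "pathstart \<gamma> = x0" "pathfinish \<gamma> = x0"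
      using hpathsD[OF g] c alpha_word[OF w] by auto
    have A: "pc \<gamma> = ?A" using g \<gamma>0 pc_eq_iff[of ?\<gamma>0 \<gamma>] by simp
    have "pc (\<gamma> +++ alpha_word \<alpha> x0 w) = pc \<gamma> \<star> al w"
      using \<gamma> w by (simp add: al_def alpha_word cmp_pc)
    also have "\<dots> = ?A \<star> al w" by (simp only: A)
    also have "\<dots> = pc c" using assms(1) c w by simp
    finally have e: "pc (\<gamma> +++ alpha_word \<alpha> x0 w) = pc c" .
    show p: "path (\<gamma> +++ alpha_word \<alpha> x0 w)" using \<gamma> alpha_word[OF w] by simp
    show "hpaths (\<gamma> +++ alpha_word \<alpha> x0 w) c" using pc_eq_iff[OF p, of c] e by simp
  qed
  have eq: "tc (ds @ jump_back w (word_act w x0)) = tc zs"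
    if "\<gamma> \<in> ?A" "discretisation t \<theta> (\<gamma> +++ alpha_word \<alpha> x0 w) ds" for \<gamma> ds
  proof -
    have "repr (\<gamma> +++ alpha_word \<alpha> x0 w) w (ds @ jump_back w (word_act w x0))"
      using repr_discretisation[OF that(2) *(1)[OF that(1)] w] alpha_word[OF w] by simp
    then have "repr c w (ds @ jump_back w (word_act w x0))"
      using repr_homotopic *(2)[OF that(1)] w by blast
    then show ?thesis using repr_unique assms(3) by (simp add: tc_eq_iff)
  qed
  have in_A: "?\<gamma>0 \<in> ?A" using \<gamma>0 mem_pc_self by metis
  obtain N where "fine_mesh N (?\<gamma>0 +++ alpha_word \<alpha> x0 w)"
    using eventually_happens[OF eventually_fine[OF *(1)[OF in_A]]] by auto
  then obtain ds0 where ds0: "discretisation t \<theta> (?\<gamma>0 +++ alpha_word \<alpha> x0 w) ds0"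
    using discretisation_upath by blast
  show ?thesis
    unfolding Phi_S_def J_def prod.case
  proof (intro equalityI subsetI)
    fix x assume "x \<in> (\<Union>\<gamma>\<in>?A. \<Union>zs\<in>{zs. discretisation t (real n\<theta>) (\<gamma> +++ alpha_word \<alpha> x0 w) zs}.
        tc (zs @ jump_back w (word_act w x0)))"
    then obtain \<gamma> ds where "\<gamma> \<in> ?A" "discretisation t \<theta> (\<gamma> +++ alpha_word \<alpha> x0 w) ds"
      "x \<in> tc (ds @ jump_back w (word_act w x0))" by blast
    then show "x \<in> tc zs" using eq by simp
  next
    fix x assume "x \<in> tc zs"
    then have "x \<in> tc (ds0 @ jump_back w (word_act w x0))" using eq[OF in_A ds0] by simp
    then show "x \<in> (\<Union>\<gamma>\<in>?A. \<Union>zs\<in>{zs. discretisation t (real n\<theta>) (\<gamma> +++ alpha_word \<alpha> x0 w) zs}.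
        tc (zs @ jump_back w (word_act w x0)))" using in_A ds0 by blast
  qed
qed

lemma GG_repr:
  assumes "g \<in> carrier GG"
  obtains c w zs where "path c" "mor x0 x0 (pc c) w" "reduced_word w" "g = J (pc c) w" "repr c w zs"
    "Phi g = tc zs" "tp zs" "hd zs = x0" "last zs = x0"
proof -
  obtain a w where a: "mor x0 x0 a w" "reduced_word w" "g = J a w" using GG_cases[OF assms] .
  obtain c where c: "path c" "a = pc c" using a(1) by (auto simp: mor_def arr_def)
  have w: "wd w" using a by (simp add: mor_def)
  obtain zs where zs: "repr c w zs" using repr_exists[OF c(1) w] by blast
  have m: "mor x0 x0 (pc c) w" using a c by simp
  then have cs: "pathstart c = x0" "pathfinish c = word_act w x0" using c(1) by (auto simp: mor_def)
  show ?thesis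
    using c(1) m a(2) _ zs
  proof (rule that)
    show "g = J (pc c) w" using a c by simp
    then show "Phi g = tc zs" using Phi_J[OF c(1) m zs] by simp
    show "tp zs" "hd zs = x0" "last zs = x0"
      using repr_tp[OF zs c(1) w] repr_hd[OF zs c(1) w] repr_last[OF zs c(1) w] cs w by simp_all
  qed
qed

lemma Phi_hom: "Phi \<in> hom GG H"
proof (rule homI)
  fix g assume "g \<in> carrier GG"
  then show "Phi g \<in> carrier H" by (rule GG_repr) (auto simp: H_carrier)
next
  fix g h assume "g \<in> carrier GG" "h \<in> carrier GG"
  then obtain c w zs d v ws where g: "path c" "mor x0 x0 (pc c) w" "g = J (pc c) w" "repr c w zs"
      "Phi g = tc zs" "tp zs" "hd zs = x0" "last zs = x0"
    and h: "path d" "mor x0 x0 (pc d) v" "h = J (pc d) v" "repr d v ws"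
      "Phi h = tc ws" "tp ws" "hd ws = x0" "last ws = x0"
    using GG_repr[of g] GG_repr[of h] by metis
  have w: "wd w" "wd v" and ends: "pathstart c = x0" "pathfinish c = word_act w x0"
    "pathstart d = x0" "pathfinish d = word_act v x0"
    using g(1,2) h(1,2) by (auto simp: mor_def)
  have wdp: "path (word_act w \<circ> d)" by (rule path_comp) (use h(1) w in simp_all)
  let ?e = "c +++ (word_act w \<circ> d)"
  have e: "path ?e" "pc ?e = pc c \<star> im (word_act w) (pc d)"
    using g(1) h(1) wdp w ends by (simp_all add: im_pc cmp_pc pathstart_compose)
  have r: "repr ?e (reduce_word (w @ v)) (zs @ tl ws)"
    using g h w ends e(1) by (intro repr_reduce repr_cmp) simp_all
  have m: "mor x0 x0 (pc ?e) (reduce_word (w @ v))"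
    unfolding e(2) by (intro mor_reduce mor_cmp[OF g(2) h(2)])
  have "Phi (g \<otimes>\<^bsub>GG\<^esub> h) = tc (zs @ tl ws)"
    using Phi_J[OF e(1) m r] g(3) h(3) J_mult[OF g(2) h(2)] e(2) by simp
  then show "Phi (g \<otimes>\<^bsub>GG\<^esub> h) = Phi g \<otimes>\<^bsub>H\<^esub> Phi h"
    using g h H_mult[of zs ws] by simp
qed

lemma repr_const_word:
  assumes "wd w" shows "repr (\<lambda>_. x) w (x # jump_back w x)"
proof -
  \<comment> \<open>The times increase strictly from 0 to 1, so even a constant path is discretised
    by two points; the extra copy is removed below.\<close>
  have "discretisation t \<theta> (\<lambda>_. x) [x, x]"
    unfolding discretisation_def
    by (rule exI[of _ "[0, 1]"]) auto
  then have "repr (\<lambda>_. x) w ([x, x] @ jump_back w (pathfinish (\<lambda>_. x)))"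
    by (intro repr_discretisation assms) simp_all
  moreover have "th ([x, x] @ jump_back w x) (x # jump_back w x)"
    using th_sym[OF th_dup[of "[]" x "jump_back w x"]] tp_jump_back[OF assms] by simp
  ultimately show ?thesis using repr_th by simp
qed

lemma repr_const: "repr (\<lambda>_. x) [] [x]"
  using repr_const_word[of "[]" x] by simp

text \<open>Arbitrary end points are allowed because a closed \<theta>-path is cut at points other
  than the base point.\<close>

definition realised :: "'a \<Rightarrow> 'a \<Rightarrow> 'a list \<Rightarrow> bool" where
  "realised x y zs \<longleftrightarrow> (\<exists>c w. path c \<and> wd w \<and> pathstart c = x \<and> pathfinish c = word_act w y \<and> repr c w zs)"

lemma realised_cmp:
  assumes "realised x y zs" "realised y z ws" shows "realised x z (zs @ tl ws)"
proof -
  obtain c w d v where *: "path c" "wd w" "pathstart c = x" "pathfinish c = word_act w y" "repr c w zs"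
    "path d" "wd v" "pathstart d = y" "pathfinish d = word_act v z" "repr d v ws"
    using assms unfolding realised_def by blast
  have "path (word_act w \<circ> d)" by (rule path_comp) (use * in simp_all)
  moreover have "repr (c +++ (word_act w \<circ> d)) (w @ v) (zs @ tl ws)"
    using * by (intro repr_cmp) simp_all
  ultimately show ?thesis unfolding realised_def
    using * by (intro exI[of _ "c +++ (word_act w \<circ> d)"] exI[of _ "w @ v"])
      (simp add: pathstart_compose pathfinish_compose)
qed

lemma realised_th: "realised x y zs \<Longrightarrow> th zs ws \<Longrightarrow> realised x y ws"
  unfolding realised_def using repr_th by blast

lemma realised_close:
  assumes "t * dist x y \<le> \<theta>" shows "realised x y [x, y]"
proof -
  obtain g where g: "path g" "pathstart g = x" "pathfinish g = y"
    "\<forall>u\<in>{0..1}. dist x (g u) = u * dist x y" using geodesic_path[of x y] .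
  have "t * dist (g 0) (g u) \<le> \<theta>" if "u \<in> {0..1}" for u
  proof -
    have "dist (g 0) (g u) \<le> dist x y"
      using bspec[OF g(4) that] that g(2) mult_left_le_one_le[of "dist x y" u]
      by (simp add: pathstart_def)
    then have "t * dist (g 0) (g u) \<le> t * dist x y" using t_pos by (intro mult_left_mono) auto
    then show ?thesis using assms by simp
  qed
  then have "discretisation t \<theta> g [x, y]"
    unfolding discretisation_def
    using g by (intro exI[of _ "[0, 1]"]) (auto simp: pathstart_def pathfinish_def)
  then have "repr g [] ([x, y] @ jump_back [] (pathfinish g))"
    using g(1) by (intro repr_discretisation) simp_all
  then show ?thesis unfolding realised_def using g by (intro exI[of _ g] exI[of _ "[]"]) simp
qed

lemma realised_jump:
  assumes "l \<in> S \<times> UNIV" shows "realised x (letter_act l x) [x, letter_act l x]"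
proof -
  \<comment> \<open>Jumping back along the inverse letter is jumping forward along
    \<open>l\<close>.\<close>
  have l: "wd [letter_inv l]" using assms by (simp add: letter_inv_mem)
  show ?thesis unfolding realised_def
    using repr_const_word[OF l, of x] l assms
    by (intro exI[of _ "\<lambda>_. x"] exI[of _ "[letter_inv l]"]) simp
qed

lemma rho_le_cost: "wd w \<Longrightarrow> \<rho> x y \<le> cost t w x y"
  by (rule warped_metric_le_cost[OF t_pos])

text \<open>A minimal jumping path subdivides a step into jumps and short continuous steps, and all of its
  intermediate points stay \<open>\<theta>\<close>-close to both ends.\<close>

lemma realised_if_cost_le: "wd w \<Longrightarrow> cost t w x y \<le> \<theta> \<Longrightarrow> realised x y [x, y]"
proof (induction w arbitrary: x)
  case Nil
  then show ?case using realised_close by (simp add: cost_def)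
next
  case (Cons l w)
  obtain b where b: "gap (l # w) x y = dist x b + gap w (letter_act l b) y"
    using gap_attained[OF Cons.prems(1)] .
  let ?b' = "letter_act l b"
  have l: "l \<in> S \<times> UNIV" "wd w" using Cons.prems by auto
  have split: "cost t (l # w) x y = t * dist x b + 1 + cost t w ?b' y"
    unfolding cost_def b by (simp add: distrib_left)
  have nn: "0 \<le> t * dist x b" "0 \<le> cost t w ?b' y" using t_pos cost_nonneg by simp_all
  have xb: "t * dist x b \<le> \<theta>" and by': "cost t w ?b' y \<le> \<theta>" using split nn Cons.prems(2) by linarith+
  have r: "\<rho> x b \<le> \<theta>" "\<rho> b ?b' \<le> 1" "\<rho> ?b' y \<le> \<theta>"
    using rho_le_dist[of x b] xb rho_letter[OF l(1), of b] rho_le_cost[OF l(2), of ?b' y] by' by linarith+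
  have xy: "\<rho> x y \<le> \<theta>" using rho_le_cost[OF Cons.prems(1), of x y] Cons.prems(2) by linarith
  have bb: "\<rho> b ?b' \<le> \<theta>" using r(2) theta_ge_1 by simp
  \<comment> \<open>The jump is already counted in the total cost, so the remaining route from
    \<open>b\<close> costs at most \<theta> and not \<theta> + 1.\<close>
  have byy: "\<rho> b y \<le> \<theta>"
    using rho_triangle[of b y ?b'] r(2) rho_le_cost[OF l(2), of ?b' y] split nn Cons.prems(2) by linarith
  have "th [x, b, ?b', y] [x, b, y]" using th_triangle[of "[x]" b ?b' y "[]"] r bb byy by simp
  also have "th [x, b, y] [x, y]" using th_triangle[of "[]" x b y "[]"] r byy xy by simp
  finally have "th [x, b, ?b', y] [x, y]" .
  moreover have "realised x y (([x, b] @ tl [b, ?b']) @ tl [?b', y])"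
    using realised_cmp[OF realised_cmp[OF realised_close[OF xb] realised_jump[OF l(1), of b]]
        Cons.IH[OF l(2) by']] .
  ultimately show ?case using realised_th by simp
qed

lemma realised_theta_path: "tp zs \<Longrightarrow> realised (hd zs) (last zs) zs"
proof (induction zs rule: rev_induct)
  case (snoc z zs)
  show ?case
  proof (cases "zs = []")
    case True
    then show ?thesis
      unfolding realised_def using repr_const[of z] by (intro exI[of _ "\<lambda>_. z"] exI[of _ "[]"]) simp
  next
    case False
    then have z: "tp zs" "\<rho> (last zs) z \<le> \<theta>" using snoc.prems by (auto simp: tp_append)
    obtain w where "wd w" "\<rho> (last zs) z = cost t w (last zs) z"
      using warped_metric_attained[OF t_pos, of "last zs" z] by blast
    then have "realised (last zs) z [last zs, z]" using realised_if_cost_le z(2) by simp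
    from realised_cmp[OF snoc.IH[OF z(1)] this] show ?thesis using False by simp
  qed
qed simp

lemma Phi_surj: "Phi ` carrier GG = carrier H"
proof
  show "Phi ` carrier GG \<subseteq> carrier H" using Phi_hom by (auto simp: hom_def)
  show "carrier H \<subseteq> Phi ` carrier GG"
  proof
    fix A assume "A \<in> carrier H"
    then obtain zs where zs: "A = tc zs" "tp zs" "hd zs = x0" "last zs = x0" by (auto simp: H_carrier)
    then obtain c w where c: "path c" "wd w" "pathstart c = x0" "pathfinish c = word_act w x0" "repr c w zs"
      using realised_theta_path[OF zs(2)] unfolding realised_def by auto
    then have m: "mor x0 x0 (pc c) w" by (simp add: mor_def)
    have "Phi (J (pc c) (reduce_word w)) = A"
      using Phi_J[OF c(1) mor_reduce[OF m] repr_reduce[OF c(5,1,2)]] zs by simp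
    moreover have "J (pc c) (reduce_word w) \<in> carrier GG"
      using J_carrier[OF mor_reduce[OF m]] by simp
    ultimately show "A \<in> Phi ` carrier GG" by blast
  qed
qed

lemma Phi_one: "Phi \<one>\<^bsub>GG\<^esub> = \<one>\<^bsub>H\<^esub>"
  unfolding GG_one H_one using repr_const[of x0] by (intro Phi_J) (simp_all add: mor_def)

text \<open>The group axioms for the discrete fundamental group are inherited along the surjective
  multiplicative map \<open>Phi\<close>.\<close>

lemma group_H: "group H"
proof -
  have "group (H \<lparr>carrier := Phi ` carrier GG, one := Phi \<one>\<^bsub>GG\<^esub>\<rparr>)"
    by (rule group.hom_imp_img_group[OF group_GG Phi_hom])
  then show ?thesis unfolding Phi_surj Phi_one by simp
qed

lemma Phi_group_hom: "group_hom GG H Phi"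
  using group_GG group_H Phi_hom by (simp add: group_hom_def group_hom_axioms_def)

text \<open>At the fixed point \<open>y\<close> the constant path with word \<open>w\<close> and the
  constant path with empty word are both represented by \<open>[y]\<close>. Hence the element of
  \<open>K\<close> and the null loop that goes out and back along \<open>\<beta>\<close> share a
  representing \<theta>-path.\<close>

lemma K_set_subset_kernel: "K_set S n\<theta> \<alpha> x0 \<subseteq> kernel GG H Phi"
proof
  fix g assume "g \<in> K_set S n\<theta> \<alpha> x0"
  then obtain b w where g: "g = J (b \<star> im (word_act w) (rv b)) w" and w: "w \<in> Ell S n\<theta>"
    and b: "arr b" "src b = x0" "tgt b \<in> Fix_word w"
    unfolding K_set_eq by blast
  have w': "wd w" "reduced_word w" "length w \<le> 4 * n\<theta>" using w by (auto simp: Ell_def)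
  obtain \<beta> where \<beta>: "path \<beta>" "b = pc \<beta>" using b(1) by (auto simp: arr_def)
  define y where "y = pathfinish \<beta>"
  have y: "word_act w y = y" using b(3) \<beta> by (simp add: Fix_word_def y_def)
  have \<beta>s: "pathstart \<beta> = x0" using b(2) \<beta> by simp
  obtain zs where zs: "repr \<beta> [] zs" using repr_exists[OF \<beta>(1), of "[]"] by auto
  obtain ws where ws: "repr (reversepath \<beta>) [] ws" using repr_exists[of "reversepath \<beta>" "[]"] \<beta>(1) by auto
  have wr: "path (word_act w \<circ> reversepath \<beta>)" by (rule path_comp) (use \<beta>(1) w'(1) in simp_all)
  have loop: "repr (\<lambda>_. y) w [y]"
    using repr_const_word[OF w'(1), of y] jump_loop_null[OF w'(1,3) y] repr_th by blast
  have id: "word_act [] \<circ> f = f" for f :: "real \<Rightarrow> 'a" by (simp add: fun_eq_iff)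
  have id': "word_act [] z = z" for z :: 'a by simp
  have "repr ((\<lambda>_. y) +++ (word_act w \<circ> reversepath \<beta>)) (w @ []) ([y] @ tl ws)"
    by (rule repr_cmp[OF loop ws]) (use \<beta>(1) w' y in \<open>simp_all add: y_def\<close>)
  then have "repr (\<beta> +++ (word_act [] \<circ> ((\<lambda>_. y) +++ (word_act w \<circ> reversepath \<beta>)))) ([] @ (w @ [])) (zs @ tl ([y] @ tl ws))"
    by (rule repr_cmp[OF zs]) (use \<beta>(1) w' wr y in \<open>simp_all add: y_def pathstart_compose\<close>)
  then have end1: "repr (\<beta> +++ ((\<lambda>_. y) +++ (word_act w \<circ> reversepath \<beta>))) w (zs @ tl ([y] @ tl ws))"
    by (simp only: id append_Nil append_Nil2)
  have "repr ((\<lambda>_. y) +++ (word_act [] \<circ> reversepath \<beta>)) ([] @ []) ([y] @ tl ws)"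
    by (rule repr_cmp[OF repr_const ws]) (use \<beta>(1) in \<open>simp_all add: y_def\<close>)
  then have "repr (\<beta> +++ (word_act [] \<circ> ((\<lambda>_. y) +++ (word_act [] \<circ> reversepath \<beta>)))) ([] @ ([] @ [])) (zs @ tl ([y] @ tl ws))"
    by (rule repr_cmp[OF zs]) (use \<beta>(1) in \<open>simp_all add: id id' y_def del: word_act_simps\<close>)
  then have end2: "repr (\<beta> +++ ((\<lambda>_. y) +++ reversepath \<beta>)) [] (zs @ tl ([y] @ tl ws))"
    by (simp only: id append_Nil append_Nil2)
  have p2: "path (\<beta> +++ ((\<lambda>_. y) +++ reversepath \<beta>))" using \<beta>(1) by (simp add: y_def)
  have "pc (\<beta> +++ ((\<lambda>_. y) +++ reversepath \<beta>)) = b \<star> cn y \<star> rv b"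
    using \<beta> by (simp add: cmp_pc rv_pc y_def del: cmp_cn_left)
  also have "\<dots> = cn x0" using b \<beta> by (simp add: y_def)
  finally have "hpaths (\<beta> +++ ((\<lambda>_. y) +++ reversepath \<beta>)) (\<lambda>_. x0)" using pc_eq_iff[OF p2] by simp
  then have "repr (\<lambda>_. x0) [] (zs @ tl ([y] @ tl ws))" using repr_homotopic end2 by simp
  then have null: "th (zs @ tl ([y] @ tl ws)) [x0]" using repr_unique repr_const by blast
  let ?e = "\<beta> +++ ((\<lambda>_. y) +++ (word_act w \<circ> reversepath \<beta>))"
  have pe: "path ?e" using \<beta>(1) wr y by (simp add: y_def pathstart_compose)
  have "pc ?e = b \<star> cn y \<star> im (word_act w) (rv b)"
    using \<beta> wr w' y by (simp add: cmp_pc rv_pc im_pc y_def pathstart_compose del: cmp_cn_left)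
  also have "\<dots> = b \<star> im (word_act w) (rv b)"
    using b \<beta> w' y by (simp add: y_def)
  finally have pce: "pc ?e = b \<star> im (word_act w) (rv b)" .
  have m: "mor x0 x0 (pc ?e) w"
    unfolding pce using b w' y \<beta> by (simp add: mor_def y_def)
  have "Phi g = tc (zs @ tl ([y] @ tl ws))"
    using Phi_J[OF pe m end1] g pce by simp
  then have "Phi g = \<one>\<^bsub>H\<^esub>" using null by (simp add: H_one tc_eq_iff)
  moreover have "g \<in> carrier GG" using J_carrier[OF m w'(2)] g pce by simp
  ultimately show "g \<in> kernel GG H Phi" by (simp add: kernel_def)
qed

end

section \<open>The kernel of the comparison homomorphism\<close>

text \<open>Before applying \<open>c\<close>, both sides are paths in the interval with the same
  ends, so a linear homotopy joins them.\<close>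

lemma pc_segment_join:
  assumes "path c" "u \<in> {0..1}" "v \<in> {0..1}" "w \<in> {0..1}"
  shows "pc (c \<circ> linepath u v) \<star> pc (c \<circ> linepath v w) = pc (c \<circ> linepath u w)"
    and "path (c \<circ> linepath u v)"
proof -
  have seg: "closed_segment p q \<subseteq> {0..1}" if "p \<in> {0..1}" "q \<in> {0..1}" for p q :: real
    using that by (intro closed_segment_subset) auto
  have p: "path (c \<circ> linepath p q)" if "p \<in> {0..1}" "q \<in> {0..1}" for p q
    using assms(1) seg[OF that] by (intro path_continuous_image) (auto simp: path_def intro: continuous_on_subset)
  then show "path (c \<circ> linepath u v)" using assms by blast
  have "homotopic_paths {0..1} (linepath u v +++ linepath v w) (linepath u w)"
  proof (rule homotopic_paths_linear)
    fix t :: real assume t: "t \<in> {0..1}"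
    have "(linepath u v +++ linepath v w) t \<in> path_image (linepath u v +++ linepath v w)"
      using t by (simp add: path_image_def)
    also have "\<dots> \<subseteq> {0..1}" using seg assms by (intro subset_path_image_join) simp_all
    finally have "(linepath u v +++ linepath v w) t \<in> {0..1}" .
    moreover have "linepath u w t \<in> {0..1}"
      using t seg[of u w] assms linepath_in_path by blast
    ultimately show "closed_segment ((linepath u v +++ linepath v w) t) (linepath u w t) \<subseteq> {0..1}"
      by (rule seg)
  qed simp_all
  from hpaths_image_of_interval[OF assms(1) this]
  show "pc (c \<circ> linepath u v) \<star> pc (c \<circ> linepath v w) = pc (c \<circ> linepath u w)"
    using p assms by (simp add: cmp_pc pc_eq_iff path_compose_join pathstart_compose pathfinish_compose)
qed

text \<open>This is applied to the quotient of the free group by the normal closure of the elliptic words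
  and to the quotient of the semidirect product by the normal closure of \<open>K\<close>.\<close>

locale warped_kernel = warped_compact_scale S \<alpha> x0 t n\<theta> + warped_based S \<alpha> x0 bs + pi: group_hom GG Q \<pi>
  for S :: "('a::metric_space \<Rightarrow> 'a) set" and \<alpha> x0 t n\<theta> bs
    and Q :: "('q, 'm) monoid_scheme" (structure) and \<pi> +
  fixes \<epsilon> \<delta> :: real
  assumes small_loop_trivial: "small \<epsilon> (4 * n\<theta>) a a c w \<Longrightarrow> reduced_word w \<Longrightarrow> \<pi> (B a a (pc c) w) = \<one>"
    and delta: "0 < \<delta>" "\<delta> \<le> \<epsilon>"
    and small_four: "small \<delta> n\<theta> a b c1 w1 \<Longrightarrow> small \<delta> n\<theta> b p c2 w2 \<Longrightarrow> small \<delta> n\<theta> p q c3 w3 \<Longrightarrow>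
      small \<delta> n\<theta> q a c4 w4 \<Longrightarrow> small \<epsilon> (4 * n\<theta>) a a ((c1 +++ (word_act w1 \<circ> c2)) +++
        (word_act (w1 @ w2) \<circ> (c3 +++ (word_act w3 \<circ> c4)))) ((w1 @ w2) @ (w3 @ w4))"
    and small_step: "\<rho> x y \<le> \<theta> \<Longrightarrow> \<exists>c w. small \<delta> n\<theta> x y c w"
begin

abbreviation sm where "sm \<equiv> small \<delta> n\<theta>"

lemma mor_small: "small e n x y c w \<Longrightarrow> mor x y (pc c) w"
  by (simp add: mor_def small_def)

definition P :: "'a \<Rightarrow> 'a \<Rightarrow> (real \<Rightarrow> 'a) \<Rightarrow> ('a \<Rightarrow> 'a) letter list \<Rightarrow> 'q" where
  "P x y c w = \<pi> (B x y (pc c) w)"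

lemma P_closed: "mor x y (pc c) w \<Longrightarrow> P x y c w \<in> carrier Q"
  unfolding P_def by (intro pi.hom_closed B_carrier)

lemma P_mult:
  assumes "mor x y (pc c) w" "mor y z (pc d) v" "path c" "path d"
  shows "P x y c w \<otimes> P y z d v = P x z (c +++ (word_act w \<circ> d)) (w @ v)"
proof -
  have w: "wd w" "pathfinish c = word_act w (pathstart d)" "path (word_act w \<circ> d)"
    using assms path_comp[OF assms(4) continuous_word_act[of w]] by (auto simp: mor_def)
  then have "pc c \<star> im (word_act w) (pc d) = pc (c +++ (word_act w \<circ> d))"
    using assms by (simp add: im_pc cmp_pc pathstart_compose)
  then show ?thesis
    unfolding P_def using B_mult[OF assms(1,2)] pi.hom_mult[OF B_carrier[OF assms(1)] B_carrier[OF assms(2)]]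
    by simp
qed

lemma P_loop:
  assumes "small \<epsilon> (4 * n\<theta>) a a c w" shows "P a a c w = \<one>"
  using small_loop_trivial[OF small_reduce[OF assms]] B_reduce[OF mor_small[OF assms]]
  by (simp add: P_def)

lemma P_self: "sm a a c w \<Longrightarrow> P a a c w = \<one>"
  using delta by (intro P_loop) (auto simp: small_def)

lemma sm_D: "sm x y c w \<Longrightarrow> path c" "sm x y c w \<Longrightarrow> mor x y (pc c) w"
  by (simp_all add: small_def mor_def)

lemma P_four:
  assumes "sm a b c1 w1" "sm b p c2 w2" "sm p q c3 w3" "sm q a c4 w4"
  shows "(P a b c1 w1 \<otimes> P b p c2 w2) \<otimes> (P p q c3 w3 \<otimes> P q a c4 w4) = \<one>"
proof -
  note D = assms[THEN sm_D(1)] assms[THEN sm_D(2)]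
  have w: "wd w1" "wd w2" "wd w3" "wd w4" using D by (auto simp: mor_def)
  have p: "path (c1 +++ (word_act w1 \<circ> c2))" "path (c3 +++ (word_act w3 \<circ> c4))"
    using assms path_comp[of c2 "word_act w1"] path_comp[of c4 "word_act w3"]
    by (auto simp: small_def pathstart_compose)
  have m: "mor a p (pc (c1 +++ (word_act w1 \<circ> c2))) (w1 @ w2)"
    "mor p a (pc (c3 +++ (word_act w3 \<circ> c4))) (w3 @ w4)"
    using p assms by (auto simp: mor_def small_def pathfinish_compose)
  show ?thesis
    using P_loop[OF small_four[OF assms]] P_mult[OF D(5,6,1,2)] P_mult[OF D(7,8,3,4)] P_mult[OF m p]
    by simp
qed

definition E :: "'a \<Rightarrow> 'a \<Rightarrow> (real \<Rightarrow> 'a) \<times> ('a \<Rightarrow> 'a) letter list" where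
  "E x y = (SOME e. sm x y (fst e) (snd e))"

definition M :: "'a \<Rightarrow> 'a \<Rightarrow> 'q" where
  "M x y = P x y (fst (E x y)) (snd (E x y))"

lemma E_small: assumes "\<rho> x y \<le> \<theta>" shows "sm x y (fst (E x y)) (snd (E x y))"
  unfolding E_def using small_step[OF assms] by (intro someI_ex[of "\<lambda>e. sm x y (fst e) (snd e)"]) simp

lemma E_self: "sm x x (fst (E x x)) (snd (E x x))"
  by (rule E_small) simp

lemma M_closed: "\<rho> x y \<le> \<theta> \<Longrightarrow> M x y \<in> carrier Q"
  unfolding M_def by (intro P_closed sm_D(2) E_small)

lemma M_self: "M x x = \<one>"
  unfolding M_def by (intro P_self E_self)

text \<open>Complete the two steps to a quadrilateral with two sides from \<open>x\<close> to
  \<open>x\<close>, whose values are trivial.\<close>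

lemma P_back:
  assumes "sm x y c w" "\<rho> y x \<le> \<theta>" shows "P x y c w \<otimes> M y x = \<one>"
  using P_four[OF assms(1) E_small[OF assms(2)] E_self E_self] P_closed[OF sm_D(2)[OF assms(1)]]
    M_closed[OF assms(2)] M_self by (simp add: M_def[symmetric])

text \<open>The choice made in \<open>E\<close> does not matter: every small morphism from
  \<open>x\<close> to \<open>y\<close> is mapped to the inverse of \<open>M y x\<close>. Hence
  \<open>M\<close> can be computed with any convenient morphism.\<close>

lemma P_small_eq:
  assumes "sm x y c w" "\<rho> x y \<le> \<theta>" shows "P x y c w = M x y"
proof -
  have r: "\<rho> y x \<le> \<theta>" using assms(2) by (simp add: rho_commute)
  have "inv M y x = P x y c w"
    using P_back[OF assms(1) r] M_closed[OF r] P_closed[OF sm_D(2)[OF assms(1)]]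
    by (rule pi.H.inv_equality)
  moreover have "inv M y x = M x y"
    using P_back[OF E_small[OF assms(2)] r] M_closed[OF r] M_closed[OF assms(2)]
    unfolding M_def[of x y, symmetric] by (rule pi.H.inv_equality)
  ultimately show ?thesis by simp
qed

lemma M_square:
  assumes "\<rho> a b \<le> \<theta>" "\<rho> b c \<le> \<theta>" "\<rho> a d \<le> \<theta>" "\<rho> d c \<le> \<theta>"
  shows "M a b \<otimes> M b c = M a d \<otimes> M d c"
proof -
  have r: "\<rho> c d \<le> \<theta>" "\<rho> d a \<le> \<theta>" using assms by (simp_all add: rho_commute)
  note cl = M_closed[OF assms(1)] M_closed[OF assms(2)] M_closed[OF assms(3)] M_closed[OF assms(4)]
    M_closed[OF r(1)] M_closed[OF r(2)]
  have 1: "(M a b \<otimes> M b c) \<otimes> (M c d \<otimes> M d a) = \<one>"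
    using P_four[OF E_small[OF assms(1)] E_small[OF assms(2)] E_small[OF r(1)] E_small[OF r(2)]]
    by (simp add: M_def)
  have "M d c \<otimes> M c d = \<one>" "M a d \<otimes> M d a = \<one>"
    using P_back[OF E_small[OF assms(4)] r(1)] P_back[OF E_small[OF assms(3)] r(2)] by (simp_all add: M_def)
  then have 2: "(M a d \<otimes> M d c) \<otimes> (M c d \<otimes> M d a) = \<one>"
    using cl by (metis pi.H.m_assoc pi.H.m_closed pi.H.r_one)
  have c: "M c d \<otimes> M d a \<in> carrier Q" "M a b \<otimes> M b c \<in> carrier Q" "M a d \<otimes> M d c \<in> carrier Q"
    using cl by simp_all
  show ?thesis
    using pi.H.inv_equality[OF 1 c(1,2)] pi.H.inv_equality[OF 2 c(1,3)] by simp
qed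

sublocale inv: discrete_invariant \<rho> "real n\<theta>" Q M
  by unfold_locales ((rule M_closed M_self M_square; assumption)+)

lemma sm_segment:
  assumes "path c" "u \<in> {0..1}" "v \<in> {0..1}" "\<And>x. x \<in> closed_segment u v \<Longrightarrow> dist (c u) (c x) < \<delta>"
  shows "sm (c u) (c v) (c \<circ> linepath u v) []"
  unfolding small_def
proof (intro conjI ballI)
  show "path (c \<circ> linepath u v)" using pc_segment_join(2) assms by blast
  show "dist (c u) ((c \<circ> linepath u v) x) < \<delta>" if "x \<in> {0..1}" for x
    using assms(4)[of "linepath u v x"] linepath_in_path[OF that, of u v] by simp
qed (simp_all add: pathstart_compose pathfinish_compose)

text \<open>The product over the first \<open>i\<close> steps is the value on \<open>c\<close>
  restricted to [0, i/N]. By \<open>P_small_eq\<close>, each factor is computed with the segment of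
  \<open>c\<close> instead of the chosen morphism.\<close>

lemma mu_upath:
  assumes "path c" "0 < N"
    "\<And>u v. u \<in> {0..1} \<Longrightarrow> v \<in> {0..1} \<Longrightarrow> \<bar>u - v\<bar> \<le> 1 / real N \<Longrightarrow> dist (c u) (c v) < \<delta>"
    "fine_mesh N c"
  shows "inv.mu (upath N c) = P (pathstart c) (pathfinish c) c []"
proof -
  have I: "real i / real N \<in> {0..1}" if "i \<le> N" for i using that assms(2) by (simp add: field_simps)
  have mor: "mor (c u) (c v) (pc (c \<circ> linepath u v)) []" if "u \<in> {0..1}" "v \<in> {0..1}" for u v
    using pc_segment_join(2)[OF assms(1) that that(1)] by (simp add: mor_def pathstart_compose pathfinish_compose)
  have "inv.partial_product (upath N c) i = P (c 0) (c (real i / real N)) (c \<circ> linepath 0 (real i / real N)) []"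
    if "i \<le> N" for i
    using that
  proof (induction i)
    case 0
    have "sm (c 0) (c 0) (c \<circ> linepath 0 0) []"
      using delta by (intro sm_segment assms(1)) auto
    moreover have "c \<circ> linepath 0 0 = (\<lambda>_. c 0)" by (simp add: fun_eq_iff linepath_def)
    ultimately show ?case using P_self[of "c 0" "\<lambda>_. c 0" "[]"] by simp
  next
    case (Suc i)
    let ?u = "real i / real N" and ?v = "real (Suc i) / real N"
    have uv: "?u \<in> {0..1}" "?v \<in> {0..1}" using I[of i] I[of "Suc i"] Suc.prems by auto
    have d: "?v - ?u = 1 / real N" using assms(2) by (simp add: field_simps)
    have le: "?u \<le> ?v" by (intro divide_right_mono) auto
    have "sm (c ?u) (c ?v) (c \<circ> linepath ?u ?v) []"
    proof (rule sm_segment[OF assms(1) uv])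
      fix x assume "x \<in> closed_segment ?u ?v"
      then have "?u \<le> x" "x \<le> ?v" using le by (simp_all add: closed_segment_eq_real_ivl del: of_nat_Suc)
      moreover have "0 \<le> ?u" "?v \<le> 1" using uv by simp_all
      ultimately have "0 \<le> x \<and> x \<le> 1" "\<bar>?u - x\<bar> \<le> 1 / real N" using d by linarith+
      then have "x \<in> {0..1}" "\<bar>?u - x\<bar> \<le> 1 / real N" by simp_all
      then show "dist (c ?u) (c x) < \<delta>" using uv by (intro assms(3))
    qed
    moreover have "\<rho> (c ?u) (c ?v) \<le> \<theta>"
      using tp_upath[OF assms(4)] Suc.prems by (simp add: theta_path_def del: of_nat_Suc)
    ultimately have M: "M (c ?u) (c ?v) = P (c ?u) (c ?v) (c \<circ> linepath ?u ?v) []"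
      using P_small_eq by simp
    have "inv.partial_product (upath N c) (Suc i) = P (c 0) (c ?u) (c \<circ> linepath 0 ?u) [] \<otimes> M (c ?u) (c ?v)"
      using Suc.prems by (simp only: inv.partial_product.simps Suc.IH[OF Suc_leD[OF Suc.prems]] nth_upath Suc_leD)
    also have "\<dots> = \<pi> (B (c 0) (c ?u) (pc (c \<circ> linepath 0 ?u)) [] \<otimes>\<^bsub>GG\<^esub> B (c ?u) (c ?v) (pc (c \<circ> linepath ?u ?v)) [])"
      unfolding M P_def using uv by (intro pi.hom_mult[symmetric] B_carrier mor) simp_all
    also have "\<dots> = \<pi> (B (c 0) (c ?v) (pc (c \<circ> linepath 0 ?u) \<star> pc (c \<circ> linepath ?u ?v)) [])"
      using B_mult[OF mor[of 0 ?u] mor[OF uv]] uv pc_segment_join(2)[OF assms(1) uv uv(1)]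
      by (simp del: of_nat_Suc)
    also have "\<dots> = P (c 0) (c ?v) (c \<circ> linepath 0 ?v) []"
      unfolding P_def using pc_segment_join(1)[OF assms(1), of 0 ?u ?v] uv by simp
    finally show ?case .
  qed
  from this[of N] show ?thesis
    using assms(2) by (simp add: inv.mu_def path_comp_linepath pathstart_def pathfinish_def)
qed

text \<open>A jump is the small morphism with constant path and one letter: it extends the word and
  leaves the continuous part alone.\<close>

lemma mu_jump_back:
  assumes "wd w" "tp zs" "mor x (last zs) a v" "inv.mu zs = \<pi> (B x (last zs) a v)"
  shows "inv.mu (zs @ jump_back w (last zs)) = \<pi> (B x (word_act (word_inv w) (last zs)) a (v @ w))"
  using assms
proof (induction w arbitrary: zs v)
  case (Cons l w)
  define y where "y = last zs"
  define z where "z = letter_act (letter_inv l) y"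
  have l: "l \<in> S \<times> UNIV" "letter_inv l \<in> S \<times> UNIV" "wd w" using Cons.prems(1) by (auto simp: letter_inv_mem)
  have lz: "letter_act l z = y" using l by (simp add: z_def)
  have s: "sm y z (\<lambda>_. y) [l]"
    using l lz delta theta_ge_1 by (simp add: small_def)
  have r: "\<rho> y z \<le> \<theta>" unfolding z_def by (rule rho_letter_le[OF l(2)])
  have m: "mor y z (cn y) [l]" using sm_D(2)[OF s] .
  have "inv.mu (zs @ [z]) = \<pi> (B x y a v) \<otimes> \<pi> (B y z (cn y) [l])"
    using inv.mu_snoc[OF tp_ne[OF Cons.prems(2)], of z] Cons.prems(4) P_small_eq[OF s r]
    by (simp add: y_def P_def)
  also have "\<dots> = \<pi> (B x z a (v @ [l]))"
  proof -
    have m': "mor x y a v" using Cons.prems(3) by (simp add: y_def)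
    have "a \<star> im (word_act v) (cn y) = a" using m' by (simp add: mor_def)
    then show ?thesis
      using pi.hom_mult[OF B_carrier[OF m'] B_carrier[OF m]] B_mult[OF m' m] by simp
  qed
  finally have mu: "inv.mu (zs @ [z]) = \<pi> (B x z a (v @ [l]))" .
  have "mor x z a (v @ [l])" using Cons.prems(3) l lz by (simp add: mor_def y_def)
  moreover have "tp (zs @ [z])" using Cons.prems(2) r tp_ne[OF Cons.prems(2)] by (simp add: tp_append y_def)
  ultimately have "inv.mu ((zs @ [z]) @ jump_back w z) = \<pi> (B x (word_act (word_inv w) z) a ((v @ [l]) @ w))"
    using Cons.IH[OF l(3), of "zs @ [z]" "v @ [l]"] mu by simp
  then show ?case by (simp add: y_def z_def)
qed simp

text \<open>On a \<theta>-path representing \<open>g\<close> the invariant \<open>mu\<close> returns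
  \<open>\<pi> g\<close>, and for \<open>g\<close> in the kernel this path is homotopic to
  \<open>[x0]\<close>, where \<open>mu\<close> is trivial.\<close>

lemma kernel_trivial:
  assumes "g \<in> kernel GG H Phi" shows "\<pi> g = \<one>"
proof -
  have g: "g \<in> carrier GG" "Phi g = \<one>\<^bsub>H\<^esub>" using assms by (auto simp: kernel_def)
  obtain c w zs where c: "path c" "mor x0 x0 (pc c) w" "reduced_word w" "g = J (pc c) w" "repr c w zs"
    "Phi g = tc zs" "tp zs" using GG_repr[OF g(1)] by metis
  have w: "wd w" and ends: "pathstart c = x0" "pathfinish c = word_act w x0"
    using c(1,2) by (auto simp: mor_def)
  have "uniformly_continuous_on {0..1} c"
    using c(1) by (simp add: path_def compact_uniformly_continuous)
  then obtain d where d: "0 < d"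
    "\<And>u v. u \<in> {0..1} \<Longrightarrow> v \<in> {0..1} \<Longrightarrow> dist v u < d \<Longrightarrow> dist (c v) (c u) < \<delta>"
    using delta(1) unfolding uniformly_continuous_on_def by metis
  have "\<forall>\<^sub>F N in sequentially. fine_mesh N c \<and> th zs (upath N c @ jump_back w (pathfinish c)) \<and> 1 / real N < d"
    using eventually_fine[OF c(1)] c(5)[unfolded repr_def] eventually_inverse_less[OF d(1)]
    by eventually_elim simp
  then obtain N where N: "fine_mesh N c" "th zs (upath N c @ jump_back w (pathfinish c))" "1 / real N < d"
    using eventually_happens by force
  have N0: "0 < N" using N(1) by (simp add: fine_mesh_def)
  have "dist (c u) (c v) < \<delta>" if "u \<in> {0..1}" "v \<in> {0..1}" "\<bar>u - v\<bar> \<le> 1 / real N" for u v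
    using d(2)[of v u] that N(3) by (simp add: dist_real_def)
  then have mu: "inv.mu (upath N c) = P x0 (word_act w x0) c []"
    using mu_upath[OF c(1) N0 _ N(1)] ends by simp
  have l: "last (upath N c) = word_act w x0" using N0 ends by simp
  have "inv.mu (upath N c @ jump_back w (last (upath N c)))
      = \<pi> (B x0 (word_act (word_inv w) (last (upath N c))) (pc c) ([] @ w))"
    using mu l c(1) ends w
    by (intro mu_jump_back tp_upath N(1)) (simp_all add: P_def mor_def)
  then have 1: "inv.mu (upath N c @ jump_back w (pathfinish c)) = \<pi> g"
    using l ends w c(2,3,4) by (simp add: B_base)
  have "th zs [x0]" using g(2) c(6) by (simp add: H_one tc_eq_iff)
  then have "inv.mu zs = inv.mu [x0]" using c(7) by (rule inv.mu_th)
  moreover have "inv.mu zs = inv.mu (upath N c @ jump_back w (pathfinish c))"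
    using N(2) c(7) by (rule inv.mu_th)
  ultimately show ?thesis using 1 by simp
qed

end

lemma (in warped_base) snd_hom: "snd \<in> hom GG (free_group S)"
  by (auto simp: hom_def pi1_semidirect_def semidirect_product_def intro: order_trans[OF set_reduce_word])

lemma (in warped_base) snd_surj: "snd ` carrier GG = carrier (free_group S)"
proof
  show "snd ` carrier GG \<subseteq> carrier (free_group S)" using snd_hom by (auto simp: hom_def)
  show "carrier (free_group S) \<subseteq> snd ` carrier GG"
  proof
    fix w assume w: "w \<in> carrier (free_group S)"
    then have "J (al w) w \<in> carrier GG" by (intro J_carrier) (auto simp: mor_def)
    moreover have "w = snd (J (al w) w)" by (simp add: J_def)
    ultimately show "w \<in> snd ` carrier GG" by blast
  qed
qed

text \<open>The constants are chosen backwards: \<open>d1\<close> lets two halves with up to 2n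
  jumps compose within \<open>e\<close>, \<open>d\<close> lets two steps with up to n jumps compose
  within \<open>d1\<close>, and \<open>t0\<close> makes every step that small.\<close>

lemma (in warped_compact) small_constants:
  assumes "0 < e"
  shows "\<exists>d t0. 0 < d \<and> d \<le> e \<and> 1 \<le> t0 \<and>
    (\<forall>a b p q c1 c2 c3 c4 w1 w2 w3 w4. small d n a b c1 w1 \<longrightarrow> small d n b p c2 w2 \<longrightarrow>
       small d n p q c3 w3 \<longrightarrow> small d n q a c4 w4 \<longrightarrow>
       small e (4 * n) a a ((c1 +++ (word_act w1 \<circ> c2)) +++
        (word_act (w1 @ w2) \<circ> (c3 +++ (word_act w3 \<circ> c4)))) ((w1 @ w2) @ (w3 @ w4))) \<and>
    (\<forall>t\<ge>t0. \<forall>x y. warped_metric (\<lambda>x y. t * dist x y) S x y \<le> real n \<longrightarrow> (\<exists>c w. small d n x y c w))"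
proof -
  obtain d1 where d1: "0 < d1" "d1 \<le> e" "\<And>x y z c c' w w' m m'. small d1 m x y c w \<Longrightarrow>
      small d1 m' y z c' w' \<Longrightarrow> m \<le> n + n \<Longrightarrow> small e (m + m') x z (c +++ (word_act w \<circ> c')) (w @ w')"
    using small_cmp[OF assms, of "n + n"] by blast
  obtain d where d: "0 < d" "d \<le> d1" "\<And>x y z c c' w w' m m'. small d m x y c w \<Longrightarrow>
      small d m' y z c' w' \<Longrightarrow> m \<le> n \<Longrightarrow> small d1 (m + m') x z (c +++ (word_act w \<circ> c')) (w @ w')"
    using small_cmp[OF d1(1), of n] by blast
  obtain h where h: "0 < h" "\<And>w x y. wd w \<Longrightarrow> length w \<le> n \<Longrightarrow> gap w x y < h \<Longrightarrow>
      \<exists>c. small d n x y c (map letter_inv w)"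
    using small_if_gap_less[OF d(1), of n] by blast
  \<comment> \<open>A step costs at most \<open>n\<close> altogether, so its continuous part is at
    most n/t, which must fall below \<open>h\<close>.\<close>
  define t0 where "t0 = max 1 (real n / h + 1)"
  have four: "small e (4 * n) a a ((c1 +++ (word_act w1 \<circ> c2)) +++
        (word_act (w1 @ w2) \<circ> (c3 +++ (word_act w3 \<circ> c4)))) ((w1 @ w2) @ (w3 @ w4))"
    if "small d n a b c1 w1" "small d n b p c2 w2" "small d n p q c3 w3" "small d n q a c4 w4"
    for a b p q c1 c2 c3 c4 w1 w2 w3 w4
  proof -
    have "n + n + (n + n) = 4 * n" by simp
    then show ?thesis
      using d1(3)[OF d(3)[OF that(1,2) order_refl] d(3)[OF that(3,4) order_refl] order_refl] by metis
  qed
  have step: "\<exists>c w. small d n x y c w"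
    if t: "t \<ge> t0" and le: "warped_metric (\<lambda>x y. t * dist x y) S x y \<le> real n" for t x y
  proof -
    have t1: "1 \<le> t" "real n / h < t" using t by (simp_all add: t0_def)
    obtain w where w: "wd w" "warped_metric (\<lambda>x y. t * dist x y) S x y = cost t w x y"
      using warped_metric_attained[of t x y] t1 by auto
    have c: "real (length w) + t * gap w x y \<le> real n" using le w(2) by (simp add: cost_def)
    moreover have "0 \<le> t * gap w x y" using t1 by (simp add: gap_nonneg)
    ultimately have "length w \<le> n" "t * gap w x y \<le> real n" by linarith+
    moreover have "real n < h * t" using t1(2) h(1) by (simp add: field_simps)
    ultimately have "t * gap w x y < t * h" by (simp add: mult.commute)
    then have "gap w x y < h" using t1 by (simp add: mult_less_cancel_left_pos)
    then show ?thesis using h(2)[OF w(1) \<open>length w \<le> n\<close>] by blast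
  qed
  have "1 \<le> t0" by (simp add: t0_def)
  with d(1) order_trans[OF d(2) d1(2)] four step show ?thesis by blast
qed

theorem theorem7p1:
  fixes S :: "('a::metric_space \<Rightarrow> 'a) set"
    and x0 :: 'a
    and \<alpha> :: "('a \<Rightarrow> 'a) \<Rightarrow> real \<Rightarrow> 'a"
    and \<theta> :: nat
  assumes "compact (UNIV :: 'a set)"
    and "path_connected (UNIV :: 'a set)"
    and "locally path_connected (UNIV :: 'a set)"
    and "homotopy_rectifiable_paths (UNIV :: 'a set)"
    and "finite S"
    and "\<forall>s\<in>S. \<exists>g. homeomorphism UNIV UNIV s g"
    and "jumping_geodesic S"
    and "\<forall>s\<in>S. path (\<alpha> s) \<and> pathstart (\<alpha> s) = x0 \<and> pathfinish (\<alpha> s) = s x0"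
    and "\<theta> \<ge> 1"
  shows "\<exists>t0::real. t0 \<ge> 1 \<and>
    (\<forall>t\<ge>t0. \<forall>w\<in>carrier (free_group S).
        (\<exists>A\<in>carrier (fundamental_group UNIV x0).
           (A, w) \<in> kernel (pi1_semidirect S \<alpha> x0) (warped_pi1 t S (real \<theta>) x0)
                      (Phi_S t S (real \<theta>) \<alpha> x0))
        \<longleftrightarrow> w \<in> normal_closure (free_group S) (Ell S \<theta>)) \<and>
    (semi_locally_simply_connected (UNIV :: 'a set) \<longrightarrow>
      (\<forall>t\<ge>t0. warped_pi1 t S (real \<theta>) x0 \<cong>
         pi1_semidirect S \<alpha> x0 Mod normal_closure (pi1_semidirect S \<alpha> x0) (K_set S \<theta> \<alpha> x0)))"
proof -
  interpret warped_compact S \<alpha> x0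
    by unfold_locales (use assms in \<open>auto simp: jumping_geodesic_def\<close>)
  \<comment> \<open>The class at the base point is forced to be constant so that \<open>B\<close>
    agrees with \<open>J\<close> there.\<close>
  have "\<exists>a. arr a \<and> src a = x0 \<and> tgt a = z \<and> (z = x0 \<longrightarrow> a = cn x0)" for z
  proof (cases "z = x0")
    case True
    then show ?thesis by (intro exI[of _ "cn x0"]) simp
  next
    case False
    obtain g where "path g" "pathstart g = x0" "pathfinish g = z"
      using assms(2) unfolding path_connected_def by auto
    then show ?thesis using False by (intro exI[of _ "pc g"]) simp
  qed
  then obtain bs where bs: "\<And>z. arr (bs z) \<and> src (bs z) = x0 \<and> tgt (bs z) = z \<and> (z = x0 \<longrightarrow> bs z = cn x0)"
    by metis
  interpret warped_based S \<alpha> x0 bs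
    by unfold_locales (simp_all add: bs)
  obtain e where e: "0 < e" "\<And>a c w. small e (4 * \<theta>) a a c w \<Longrightarrow> Fix_word w \<noteq> {} \<and>
    (semi_locally_simply_connected (UNIV :: 'a set) \<longrightarrow>
      (\<exists>b. arr b \<and> src b = a \<and> tgt b \<in> Fix_word w \<and> pc c = b \<star> im (word_act w) (rv b)))"
    using small_loop_elliptic[of "4 * \<theta>"] by blast
  obtain d t0 where C: "0 < d \<and> d \<le> e \<and> 1 \<le> t0 \<and>
    (\<forall>a b p q c1 c2 c3 c4 w1 w2 w3 w4. small d \<theta> a b c1 w1 \<longrightarrow> small d \<theta> b p c2 w2 \<longrightarrow>
       small d \<theta> p q c3 w3 \<longrightarrow> small d \<theta> q a c4 w4 \<longrightarrow>
       small e (4 * \<theta>) a a ((c1 +++ (word_act w1 \<circ> c2)) +++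
        (word_act (w1 @ w2) \<circ> (c3 +++ (word_act w3 \<circ> c4)))) ((w1 @ w2) @ (w3 @ w4))) \<and>
    (\<forall>t\<ge>t0. \<forall>x y. warped_metric (\<lambda>x y. t * dist x y) S x y \<le> real \<theta> \<longrightarrow> (\<exists>c w. small d \<theta> x y c w))"
    using small_constants[OF e(1), of \<theta>] by (elim exE)
  note d = C[THEN conjunct1] C[THEN conjunct2, THEN conjunct1]
  note C' = C[THEN conjunct2, THEN conjunct2]
  note t0 = C'[THEN conjunct1]
  note four = C'[THEN conjunct2, THEN conjunct1, rule_format]
  note step = C'[THEN conjunct2, THEN conjunct2, rule_format]
  let ?F = "free_group S"
  let ?N = "normal_closure ?F (Ell S \<theta>)" and ?NK = "normal_closure GG (K_set S \<theta> \<alpha> x0)"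
  have scale: "warped_compact_scale S \<alpha> x0 t \<theta>" if "t \<ge> t0" for t
    by unfold_locales (use that t0 assms(9) in auto)
  \<comment> \<open>Stated for an arbitrary quotient: the two claims differ only in the quotient and
    in the reason why small loops die in it.\<close>
  have kernel: "warped_kernel S \<alpha> x0 t \<theta> bs Q \<pi> e d"
    if "t \<ge> t0" "group_hom GG Q \<pi>"
      "\<And>a c w. small e (4 * \<theta>) a a c w \<Longrightarrow> reduced_word w \<Longrightarrow> \<pi> (B a a (pc c) w) = \<one>\<^bsub>Q\<^esub>"
    for t \<pi> and Q :: "'q monoid"
    using scale[OF that(1)] warped_based_axioms that(2)
  proof (rule warped_kernel.intro)
    show "warped_kernel_axioms S \<alpha> x0 t \<theta> bs Q \<pi> e d"
      by (rule warped_kernel_axioms.intro) (use that d four step in auto)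
  qed
  have Ell: "Ell S \<theta> \<subseteq> carrier ?F" by (auto simp: Ell_def)
  have N: "?N \<lhd> ?F" by (rule normal_closure_normal[OF group_free_group Ell])
  have elliptic: "w \<in> Ell S \<theta>" if "small e (4 * \<theta>) a a c w" "reduced_word w" for a c w
    using e(2)[OF that(1)] that by (auto simp: Ell_def small_def)
  have K: "K_set S \<theta> \<alpha> x0 \<subseteq> carrier GG"
  proof -
    \<comment> \<open>\<open>K_set\<close> does not involve the scale, so its inclusion in the
      carrier can be read off at any large \<open>t\<close>.\<close>
    interpret warped_compact_scale S \<alpha> x0 t0 \<theta> by (rule scale) simp
    show ?thesis using K_set_subset_kernel by (auto simp: kernel_def)
  qed
  have NK: "?NK \<lhd> GG" by (rule normal_closure_normal[OF group_GG K])
  have part1: "(\<exists>A\<in>carrier (fundamental_group UNIV x0).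
           (A, w) \<in> kernel GG (warped_pi1 t S (real \<theta>) x0) (Phi_S t S (real \<theta>) \<alpha> x0)) \<longleftrightarrow> w \<in> ?N"
    if t: "t \<ge> t0" and w: "w \<in> carrier ?F" for t w
  proof
    \<comment> \<open>Keeping only the word makes small loops die as soon as their words are
      elliptic, without any control of their homotopy classes.\<close>
    have hom: "group_hom GG (?F Mod ?N) (\<lambda>g. ?N #>\<^bsub>?F\<^esub> snd g)"
    proof -
      have "(\<lambda>g. ?N #>\<^bsub>?F\<^esub> snd g) \<in> hom GG (?F Mod ?N)"
        using hom_compose[OF snd_hom normal.r_coset_hom_Mod[OF N]] by (simp add: comp_def)
      then show ?thesis
        using group_GG normal.factorgroup_is_group[OF N] by (simp add: group_hom_def group_hom_axioms_def)
    qed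
    interpret warped_kernel S \<alpha> x0 t \<theta> bs "?F Mod ?N" "\<lambda>g. ?N #>\<^bsub>?F\<^esub> snd g" e d
    proof (rule kernel[OF t hom])
      fix a c w assume s: "small e (4 * \<theta>) a a c w" "reduced_word w"
      have snd: "snd (B a a (pc c) w) = w" using s(2) by (simp add: B_def J_def)
      have "w \<in> carrier ?F" using subsetD[OF Ell elliptic[OF s]] .
      moreover have "w \<in> ?N" using subsetD[OF subset_normal_closure elliptic[OF s]] .
      ultimately show "?N #>\<^bsub>?F\<^esub> snd (B a a (pc c) w) = \<one>\<^bsub>?F Mod ?N\<^esub>"
        unfolding snd by (rule iffD2[OF rcos_eq_one_iff[OF N]])
    qed
    assume "\<exists>A\<in>carrier (fundamental_group UNIV x0).
       (A, w) \<in> kernel GG (warped_pi1 t S (real \<theta>) x0) (Phi_S t S (real \<theta>) \<alpha> x0)"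
    then obtain A where "(A, w) \<in> kernel GG H Phi" by blast
    from kernel_trivial[OF this] show "w \<in> ?N"
      unfolding snd_conv by (rule iffD1[OF rcos_eq_one_iff[OF N w]])
  next
    interpret warped_compact_scale S \<alpha> x0 t \<theta> by (rule scale[OF t])
    interpret Phi: group_hom GG H Phi by (rule Phi_group_hom)
    \<comment> \<open>The words of kernel elements form a normal subgroup because \<open>snd\<close>
      is onto. It contains each elliptic word, since a path to any of its fixed points gives an
      element of \<open>K\<close> with that word.\<close>
    have "group_hom GG ?F snd"
      using group_GG group_free_group snd_hom by (simp add: group_hom_def group_hom_axioms_def)
    then have "snd ` kernel GG H Phi \<lhd> ?F"
      using normal.surj_hom_normal_subgroup[OF Phi.normal_kernel _ snd_surj] by blast
    moreover have "Ell S \<theta> \<subseteq> snd ` kernel GG H Phi"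
    proof
      fix v assume v: "v \<in> Ell S \<theta>"
      then obtain y where "y \<in> Fix_word v" by (auto simp: Ell_def)
      then have "J (bs y \<star> im (word_act v) (rv (bs y))) v \<in> K_set S \<theta> \<alpha> x0"
        unfolding K_set_eq using v bs[of y] by (intro CollectI exI[of _ "bs y"] exI[of _ v]) simp
      then have "J (bs y \<star> im (word_act v) (rv (bs y))) v \<in> kernel GG H Phi"
        using K_set_subset_kernel by blast
      then show "v \<in> snd ` kernel GG H Phi" by (intro image_eqI) (simp_all add: J_def)
    qed
    ultimately have "?N \<subseteq> snd ` kernel GG H Phi" by (rule normal_closure_minimal)
    moreover assume "w \<in> ?N"
    ultimately obtain A where A: "(A, w) \<in> kernel GG H Phi" by force
    then have "A \<in> carrier (fundamental_group UNIV x0)"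
      by (simp add: kernel_def pi1_semidirect_def semidirect_product_def)
    then show "\<exists>A\<in>carrier (fundamental_group UNIV x0). (A, w) \<in> kernel GG H Phi" using A by blast
  qed
  have part2: "warped_pi1 t S (real \<theta>) x0 \<cong> GG Mod ?NK"
    if slsc: "semi_locally_simply_connected (UNIV :: 'a set)" and t: "t \<ge> t0" for t
  proof -
    have hom: "group_hom GG (GG Mod ?NK) (\<lambda>g. ?NK #>\<^bsub>GG\<^esub> g)"
      using group_GG normal.factorgroup_is_group[OF NK] normal.r_coset_hom_Mod[OF NK]
      by (simp add: group_hom_def group_hom_axioms_def)
    interpret warped_kernel S \<alpha> x0 t \<theta> bs "GG Mod ?NK" "\<lambda>g. ?NK #>\<^bsub>GG\<^esub> g" e d
    proof (rule kernel[OF t hom])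
      fix a c w assume s: "small e (4 * \<theta>) a a c w" "reduced_word w"
      obtain b where b: "arr b" "src b = a" "tgt b \<in> Fix_word w" "pc c = b \<star> im (word_act w) (rv b)"
        using e(2)[OF s(1)] slsc by blast
      have w: "wd w" and fixed: "word_act w (tgt b) = tgt b" using s b by (auto simp: small_def Fix_word_def)
      \<comment> \<open>Preceding \<open>b\<close> by \<open>bs a\<close> gives a path from the base
        point to the same fixed point, which is the form required in \<open>K\<close>.\<close>
      have "B a a (pc c) w = J ((bs a \<star> b) \<star> im (word_act w) (rv (bs a \<star> b))) w"
        unfolding B_def b(4) using b(1,2) w fixed s(2) by simp
      then have "B a a (pc c) w \<in> K_set S \<theta> \<alpha> x0"
        unfolding K_set_eq using b(1-3) elliptic[OF s]
        by (intro CollectI exI[of _ "bs a \<star> b"] exI[of _ w]) simp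
      then show "?NK #>\<^bsub>GG\<^esub> B a a (pc c) w = \<one>\<^bsub>GG Mod ?NK\<^esub>"
        using rcos_eq_one_iff[OF NK] K subset_normal_closure[of "K_set S \<theta> \<alpha> x0" GG] by blast
    qed
    interpret Phi: group_hom GG H Phi by (rule Phi_group_hom)
    have "kernel GG H Phi = ?NK"
    proof
      show "kernel GG H Phi \<subseteq> ?NK"
      proof
        fix g assume g: "g \<in> kernel GG H Phi"
        then have "g \<in> carrier GG" by (simp add: kernel_def)
        then show "g \<in> ?NK" using kernel_trivial[OF g] rcos_eq_one_iff[OF NK] by blast
      qed
      show "?NK \<subseteq> kernel GG H Phi"
        by (rule normal_closure_minimal[OF Phi.normal_kernel K_set_subset_kernel])
    qed
    then have "GG Mod ?NK \<cong> H" using Phi.FactGroup_iso[OF Phi_surj] by simp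
    then show ?thesis by (rule group.iso_sym[OF normal.factorgroup_is_group[OF NK]])
  qed
  show ?thesis using t0 part1 part2 by blast
qed

end
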